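(* Let $\ell\equiv 1\bmod 4$ be a prime satisfying: (1) the class number of $\mathbb{Q}(\sqrt{\ell})$ is divisible by $3$, so that there is an unramified cubic extension $L/\mathbb{Q}(\sqrt{\ell})$ with $\operatorname{Gal}(L/\mathbb{Q})\simeq S_3$; and (2) for such an $L$, the group $\operatorname{Gal}(L^{(2)}_{\{\ell\}}/L)$, regarded as a module over $\mathbb{F}_2[\operatorname{Gal}(L/\mathbb{Q}(\sqrt{\ell}))]\simeq\mathbb{F}_2[\mathbb{Z}/3\mathbb{Z}]$, has an irreducible $2$-dimensional Jordan–Hölder factor. Then there exists a totally real extension $K/\mathbb{Q}$ with $\operatorname{Gal}(K/\mathbb{Q})\simeq S_4$ unramified outside $\ell$.
   Context: For a number field $E$, a set $S$ of places of $\mathbb{Q}$ and a prime $p$, $E^{(p)}_S$ denotes the maximal $p$-elementary abelian extension of $E$ unramified outside the places of $E$ above $S$. The group $\operatorname{Gal}(L/\mathbb{Q}(\sqrt{\ell}))$ acts on $\operatorname{Gal}(L^{(2)}_{\{\ell\}}/L)$ by conjugation. *)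

theory Defs
  imports
    "HOL-Algebra.Algebra"
    "HOL-Algebra.Algebraic_Closure_Type"
    "HOL-Library.Extended_Nat"
    "HOL-Number_Theory.Residues"
begin

text \<open>
  All fields are subfields of the complex numbers; every number field, and every algebraic
  extension of one, embeds there.
\<close>

abbreviation CC :: "complex ring"
  where "CC \<equiv> ring_of_type_algebra"

abbreviation sub_CC :: "complex set \<Rightarrow> complex ring"
  where "sub_CC K \<equiv> CC\<lparr>carrier := K\<rparr>"

definition number_field :: "complex set \<Rightarrow> bool"
  where "number_field K \<longleftrightarrow> subfield K CC \<and> ring.finite_dimension CC \<rat> K"

definition sqrt_field :: "nat \<Rightarrow> complex set"
  where "sqrt_field d = generate_field CC {complex_of_real (sqrt (real d))}"


section \<open>Galois groups\<close>

text \<open>Automorphisms of \<open>F\<close> are represented by functions that are extensional on \<open>F\<close>.\<close>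

definition Gal :: "complex set \<Rightarrow> complex set \<Rightarrow> (complex \<Rightarrow> complex) monoid"
  where "Gal F E = (BijGroup F)
    \<lparr>carrier := {\<sigma> \<in> Bij F. \<sigma> \<in> ring_hom (sub_CC F) (sub_CC F) \<and> (\<forall>x\<in>E. \<sigma> x = x)}\<rparr>"

text \<open>The extension \<open>F/E\<close> may have infinite degree.\<close>

definition galois_ext :: "complex set \<Rightarrow> complex set \<Rightarrow> bool"
  where "galois_ext E F \<longleftrightarrow>
    subfield E CC \<and> subfield F CC \<and> E \<subseteq> F \<and>
    (\<forall>x\<in>F. ring.algebraic CC E x) \<and>
    {x \<in> F. \<forall>\<sigma>\<in>carrier (Gal F E). \<sigma> x = x} = E"

definition elementary_abelian_ext :: "nat \<Rightarrow> complex set \<Rightarrow> complex set \<Rightarrow> bool"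
  where "elementary_abelian_ext p E F \<longleftrightarrow>
    galois_ext E F \<and> comm_group (Gal F E) \<and>
    (\<forall>\<sigma>\<in>carrier (Gal F E). \<sigma> [^]\<^bsub>Gal F E\<^esub> p = \<one>\<^bsub>Gal F E\<^esub>)"


section \<open>Rings of integers and class numbers\<close>

definition ring_of_integers :: "complex set \<Rightarrow> complex ring"
  where "ring_of_integers K = sub_CC {x \<in> K. algebraic_int x}"

definition nonzero_ideals :: "complex set \<Rightarrow> complex set set"
  where "nonzero_ideals K = {I. ideal I (ring_of_integers K) \<and> I \<noteq> {0}}"

definition ideal_class_rel :: "complex set \<Rightarrow> (complex set \<times> complex set) set"
  where "ideal_class_rel K = {(I, J). I \<in> nonzero_ideals K \<and> J \<in> nonzero_ideals K \<and>
    (\<exists>a\<in>carrier (ring_of_integers K) - {0}. \<exists>b\<in>carrier (ring_of_integers K) - {0}.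
       (\<lambda>x. a * x) ` I = (\<lambda>x. b * x) ` J)}"

definition class_number :: "complex set \<Rightarrow> nat"
  where "class_number K = card (nonzero_ideals K // ideal_class_rel K)"


section \<open>Ramification\<close>

datatype rat_place = Finite_Place nat | Infinite_Place

definition finite_places :: "complex set \<Rightarrow> complex set set"
  where "finite_places K = {P. primeideal P (ring_of_integers K) \<and> P \<noteq> {0}}"

text \<open>
  For number fields \<open>E \<subseteq> F\<close> and a finite place \<open>Q\<close> of \<open>F\<close> above the finite place \<open>P\<close> of \<open>E\<close>,
  the exponent of \<open>Q\<close> in \<open>P\<close> times the ring of integers of \<open>F\<close>.
\<close>

definition ramification_index :: "complex set \<Rightarrow> complex set \<Rightarrow> complex set \<Rightarrow> enat"
  where "ramification_index F P Q =
    Sup {enat n | n. Idl\<^bsub>ring_of_integers F\<^esub> P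
                       \<subseteq> Q [^]\<^bsub>ideals_set (ring_of_integers F)\<^esub> n}"

text \<open>The residue fields are finite, so separability of their extensions is automatic.\<close>

definition unramified_at_finite :: "complex set \<Rightarrow> complex set \<Rightarrow> complex set \<Rightarrow> bool"
  where "unramified_at_finite E F P \<longleftrightarrow>
    (\<forall>Q\<in>finite_places F. Q \<inter> E = P \<longrightarrow> ramification_index F P Q = 1)"

text \<open>No real embedding of \<open>E\<close> extends to a non-real embedding of \<open>F\<close>.\<close>

definition unramified_at_infinity :: "complex set \<Rightarrow> complex set \<Rightarrow> bool"
  where "unramified_at_infinity E F \<longleftrightarrow>
    (\<forall>\<tau>\<in>ring_hom (sub_CC F) CC. \<tau> ` E \<subseteq> \<real> \<longrightarrow> \<tau> ` F \<subseteq> \<real>)"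

text \<open>
  \<open>F/E\<close> is an algebraic extension of a number field \<open>E\<close>. As it may have infinite degree, the
  condition is imposed on its finite subextensions. A finite place \<open>P\<close> of \<open>E\<close> lies above the
  rational prime \<open>p\<close> iff \<open>p \<in> P\<close>. The infinite places are exempt only if \<open>Infinite_Place \<in> S\<close>.
\<close>

definition unramified_outside :: "rat_place set \<Rightarrow> complex set \<Rightarrow> complex set \<Rightarrow> bool"
  where "unramified_outside S E F \<longleftrightarrow>
    (\<forall>F'. number_field F' \<and> E \<subseteq> F' \<and> F' \<subseteq> F \<longrightarrow>
      (\<forall>P\<in>finite_places E.
         (\<forall>p. Factorial_Ring.prime p \<and> Finite_Place p \<in> S \<longrightarrow> of_nat p \<notin> P) \<longrightarrow> unramified_at_finite E F' P) \<and>
      (Infinite_Place \<notin> S \<longrightarrow> unramified_at_infinity E F'))"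

definition totally_real :: "complex set \<Rightarrow> bool"
  where "totally_real K \<longleftrightarrow> (\<forall>\<tau>\<in>ring_hom (sub_CC K) CC. \<tau> ` K \<subseteq> \<real>)"

text \<open>\<open>M\<close> is the maximal \<open>p\<close>-elementary abelian extension of \<open>E\<close> unramified outside \<open>S\<close>.\<close>

definition is_max_elementary_ext ::
    "nat \<Rightarrow> rat_place set \<Rightarrow> complex set \<Rightarrow> complex set \<Rightarrow> bool"
  where "is_max_elementary_ext p S E M \<longleftrightarrow>
    elementary_abelian_ext p E M \<and> unramified_outside S E M \<and>
    (\<forall>M'. elementary_abelian_ext p E M' \<and> unramified_outside S E M' \<longrightarrow> M' \<subseteq> M)"


section \<open>Modules and their composition factors\<close>

text \<open>
  The library's locale \<open>module\<close> assumes a commutative ring of scalars. The notions below only use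
  its record type and the predicate \<open>submodule\<close>, and so apply to left modules over any ring. The
  fields \<open>mult\<close> and \<open>one\<close> of a module record have no meaning.
\<close>

definition quotient_module :: "('r, 'v) module \<Rightarrow> 'v set \<Rightarrow> ('r, 'v set) module"
  where "quotient_module V N =
    \<lparr>carrier = a_rcosets\<^bsub>V\<^esub> N, monoid.mult = undefined, one = undefined,
     ring.zero = N, add = set_add V,
     module.smult = (\<lambda>r A. N <+>\<^bsub>V\<^esub> ((\<lambda>x. r \<odot>\<^bsub>V\<^esub> x) ` A))\<rparr>"

definition irreducible_module :: "'r ring \<Rightarrow> ('r, 'v) module \<Rightarrow> bool"
  where "irreducible_module R V \<longleftrightarrow>
    carrier V \<noteq> {\<zero>\<^bsub>V\<^esub>} \<and>
    (\<forall>W. submodule W R V \<longrightarrow> W = {\<zero>\<^bsub>V\<^esub>} \<or> W = carrier V)"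

abbreviation subquotient :: "('r, 'v) module \<Rightarrow> 'v set \<Rightarrow> 'v set \<Rightarrow> ('r, 'v set) module"
  where "subquotient V W N \<equiv> quotient_module (V\<lparr>carrier := W\<rparr>) N"

definition composition_series :: "'r ring \<Rightarrow> ('r, 'v) module \<Rightarrow> 'v set list \<Rightarrow> bool"
  where "composition_series R V Ws \<longleftrightarrow>
    Ws \<noteq> [] \<and> hd Ws = {\<zero>\<^bsub>V\<^esub>} \<and> last Ws = carrier V \<and>
    (\<forall>W\<in>set Ws. submodule W R V) \<and>
    (\<forall>i. Suc i < length Ws \<longrightarrow>
       Ws ! i \<subseteq> Ws ! Suc i \<and> irreducible_module R (subquotient V (Ws ! Suc i) (Ws ! i)))"

definition Jordan_Hoelder_factor :: "'r ring \<Rightarrow> ('r, 'v) module \<Rightarrow> ('r, 'v set) module \<Rightarrow> bool"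
  where "Jordan_Hoelder_factor R V Q \<longleftrightarrow>
    (\<exists>Ws i. composition_series R V Ws \<and> Suc i < length Ws \<and>
            Q = subquotient V (Ws ! Suc i) (Ws ! i))"

definition has_dimension :: "'r ring \<Rightarrow> ('r, 'v) module \<Rightarrow> nat \<Rightarrow> bool"
  where "has_dimension F V n \<longleftrightarrow>
    (\<exists>B \<subseteq> carrier V. finite B \<and> card B = n \<and>
       (\<forall>v\<in>carrier V. \<exists>!c. c \<in> B \<rightarrow>\<^sub>E carrier F \<and> v = (\<Oplus>\<^bsub>V\<^esub>b\<in>B. c b \<odot>\<^bsub>V\<^esub> b)))"


section \<open>Group algebras\<close>

text \<open>\<open>F[G]\<close> for a finite group \<open>G\<close>: functions from \<open>G\<close> to \<open>F\<close> under convolution.\<close>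

definition group_algebra :: "'r ring \<Rightarrow> 'g monoid \<Rightarrow> ('g \<Rightarrow> 'r) ring"
  where "group_algebra F G =
    \<lparr>carrier = carrier G \<rightarrow>\<^sub>E carrier F,
     monoid.mult = (\<lambda>a b. \<lambda>x\<in>carrier G.
       \<Oplus>\<^bsub>F\<^esub>y\<in>carrier G. a y \<otimes>\<^bsub>F\<^esub> b (inv\<^bsub>G\<^esub> y \<otimes>\<^bsub>G\<^esub> x)),
     one = (\<lambda>x\<in>carrier G. if x = \<one>\<^bsub>G\<^esub> then \<one>\<^bsub>F\<^esub> else \<zero>\<^bsub>F\<^esub>),
     ring.zero = (\<lambda>x\<in>carrier G. \<zero>\<^bsub>F\<^esub>),
     add = (\<lambda>a b. \<lambda>x\<in>carrier G. a x \<oplus>\<^bsub>F\<^esub> b x)\<rparr>"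

text \<open>Restriction of scalars along the embedding of \<open>F\<close> into \<open>F[G]\<close>.\<close>

definition restrict_scalars ::
    "'r ring \<Rightarrow> 'g monoid \<Rightarrow> ('g \<Rightarrow> 'r, 'v) module \<Rightarrow> ('r, 'v) module"
  where "restrict_scalars F G V =
    \<lparr>carrier = carrier V, monoid.mult = undefined, one = undefined,
     ring.zero = \<zero>\<^bsub>V\<^esub>, add = ring.add V,
     module.smult = (\<lambda>c v. (\<lambda>x\<in>carrier G. if x = \<one>\<^bsub>G\<^esub> then c else \<zero>\<^bsub>F\<^esub>) \<odot>\<^bsub>V\<^esub> v)\<rparr>"


section \<open>The Galois module\<close>

text \<open>
  For \<open>k \<subseteq> L \<subseteq> M\<close> with \<open>L/k\<close> and \<open>M/k\<close> Galois and \<open>Gal M L\<close> abelian, \<open>g \<in> Gal L k\<close> acts on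
  \<open>\<sigma> \<in> Gal M L\<close> by conjugation with any lift of \<open>g\<close> to \<open>M\<close>; the choice does not matter.
\<close>

definition conj_action ::
    "complex set \<Rightarrow> complex set \<Rightarrow> complex set \<Rightarrow>
     (complex \<Rightarrow> complex) \<Rightarrow> (complex \<Rightarrow> complex) \<Rightarrow> (complex \<Rightarrow> complex)"
  where "conj_action k L M g \<sigma> =
    (let h = (SOME h. h \<in> carrier (Gal M k) \<and> restrict h L = g)
     in h \<otimes>\<^bsub>Gal M k\<^esub> \<sigma> \<otimes>\<^bsub>Gal M k\<^esub> inv\<^bsub>Gal M k\<^esub> h)"

text \<open>
  If moreover \<open>Gal M L\<close> has exponent \<open>p\<close>, it is a module over \<open>group_algebra (residue_ring p) (Gal L k)\<close>,
  written multiplicatively: an integer scalar acts as an exponent.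
\<close>

definition galois_module ::
    "complex set \<Rightarrow> complex set \<Rightarrow> complex set \<Rightarrow>
     ((complex \<Rightarrow> complex) \<Rightarrow> int, complex \<Rightarrow> complex) module"
  where "galois_module k L M =
    \<lparr>carrier = carrier (Gal M L), monoid.mult = undefined, one = undefined,
     ring.zero = \<one>\<^bsub>Gal M L\<^esub>, add = monoid.mult (Gal M L),
     module.smult = (\<lambda>a \<sigma>. \<Otimes>\<^bsub>Gal M L\<^esub>g\<in>carrier (Gal L k).
                conj_action k L M g \<sigma> [^]\<^bsub>Gal M L\<^esub> a g)\<rparr>"

end

theory Submission
  imports Defs
begin

text \<open>
  Put \<open>k = \<rat>(\<surd>l)\<close>, \<open>G = Gal(M/\<rat>)\<close> and \<open>V = Gal(M/L)\<close>. The conjugates of \<open>M\<close> have the properties for which \<open>M\<close> is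
  maximal, so \<open>M/\<rat>\<close> is Galois and \<open>G\<close> is an extension of \<open>S\<^sub>3\<close> by the elementary abelian \<open>2\<close>-group \<open>V\<close>, which is
  finite because it has a composition series. A composition factor of dimension \<open>2\<close> over \<open>\<int>/2\<close> is irreducible only
  under a nontrivial action, so an element \<open>c\<close> of order \<open>3\<close> in \<open>G\<close> acts nontrivially on \<open>V\<close>. Let \<open>N \<subseteq> V\<close> be maximal
  among the normal subgroups of \<open>G\<close> such that \<open>c\<close> acts nontrivially on \<open>V/N\<close>. Then \<open>G/N\<close> acts faithfully on the
  four sets \<open>{x, inv x}\<close> where \<open>x\<close> is a conjugate of \<open>c\<close> under \<open>V/N\<close>, whence \<open>G/N \<cong> S\<^sub>4\<close>, and \<open>K\<close> is the fixed field
  of \<open>N\<close>.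

  Since \<open>k\<close> is real and \<open>L/k\<close> and \<open>M/L\<close> are unramified at infinity, \<open>M\<close> is real. At a prime \<open>p \<noteq> l\<close> the theory of
  different and discriminant is avoided: \<open>p\<close> is unramified in a number field iff its ring of integers modulo \<open>p\<close> has
  no nilpotents. This is checked directly for \<open>k\<close>, and it passes from \<open>k\<close> to \<open>L\<close> and from \<open>L\<close> to \<open>M\<close>.
\<close>

section \<open>Subfields of the complex numbers and their embeddings\<close>

text \<open>Until the group of \<open>M\<close> over \<open>L\<close> is known to be finite,
  \<open>M\<close> may have infinite degree. Normality of \<open>M\<close> comes before finiteness,
  so embeddings are extended by Zorn's lemma. The finite part of Galois theory rests on one fact: a
  rational vector space is not a finite union of proper subspaces.

  The ring of integers has no nilpotents modulo \<open>p\<close> iff no place \<open>Q\<close> above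
  \<open>p\<close> has \<open>p\<close> in its square. In this form the passage from
  \<open>E\<close> to \<open>F\<close> is local: up to a factor outside \<open>Q\<close>,
  \<open>p\<close> generates the place of \<open>E\<close> below \<open>Q\<close>, so if
  \<open>p\<close> were in the square of \<open>Q\<close>, that place would be contained in it too,
  against unramifiedness. The tool is pigeonhole in the finite ring of integers modulo
  \<open>p\<close>. The property descends to subfields at once, so \<open>K\<close> inherits it from
  \<open>M\<close>.

  In the group, a lift \<open>d\<close> of a rotation has its cube in \<open>V\<close>, so its sixth
  power is trivial and its fourth power is a lift of order 3. In the quotient by \<open>N\<close>,
  the product of \<open>v\<close> and its two conjugates under powers of \<open>c\<close> is
  trivial, which makes \<open>V/N\<close> a Klein four-group and lets twists by elements of
  \<open>V/N\<close> be absorbed into conjugations.\<close>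

lemma CC_simps [simp]:
  "carrier CC = UNIV" "monoid.mult CC = (*)" "one CC = 1" "ring.zero CC = 0" "add CC = (+)"
  by (auto simp: ring_of_type_algebra_def)

lemma field_CC: "field CC" by (rule field_from_type_algebra)
lemma ring_CC: "ring CC" by (rule ring_from_type_algebra)
lemma domain_CC: "domain CC" using field_CC by (rule field.axioms)

lemma a_inv_CC [simp]: "\<ominus>\<^bsub>CC\<^esub> x = - x"
proof -
  interpret ring CC by (rule ring_CC)
  show ?thesis by (rule minus_equality) auto
qed

lemma m_inv_CC: "x \<noteq> 0 \<Longrightarrow> inv\<^bsub>CC\<^esub> x = inverse x"
proof -
  interpret field CC by (rule field_CC)
  assume "x \<noteq> 0" then show ?thesis by (intro comm_inv_char) auto
qed

lemma subring_CC_iff: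
  "subring S CC \<longleftrightarrow> 1 \<in> S \<and> (\<forall>x\<in>S. \<forall>y\<in>S. x - y \<in> S \<and> x * y \<in> S)"
proof -
  interpret ring CC by (rule ring_CC)
  show ?thesis
  proof
    assume "subring S CC"
    note * = subringE[OF this]
    show "1 \<in> S \<and> (\<forall>x\<in>S. \<forall>y\<in>S. x - y \<in> S \<and> x * y \<in> S)"
      using *(3,5,6,7) by (metis CC_simps(2,3,5) a_inv_CC diff_conv_add_uminus)
  next
    assume *: "1 \<in> S \<and> (\<forall>x\<in>S. \<forall>y\<in>S. x - y \<in> S \<and> x * y \<in> S)"
    then have 0: "0 \<in> S" by (metis diff_self)
    then have m: "- x \<in> S" if "x \<in> S" for x using * that by (metis diff_0)
    show "subring S CC"
      by (rule subringI) (use * m in \<open>auto, metis add_uminus_conv_diff minus_minus diff_minus_eq_add\<close>)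
  qed
qed

lemma subfield_CC_iff:
  "subfield K CC \<longleftrightarrow> subring K CC \<and> (\<forall>x\<in>K. inverse x \<in> K)"
proof -
  interpret field CC by (rule field_CC)
  show ?thesis
  proof
    assume K: "subfield K CC"
    have "inverse x \<in> K" if "x \<in> K" for x
    proof (cases "x = 0")
      case False
      with that subfield_m_inv(1)[OF K, of x] show ?thesis by (simp add: m_inv_CC)
    qed (use that in simp)
    then show "subring K CC \<and> (\<forall>x\<in>K. inverse x \<in> K)"
      using subfieldE(1)[OF K] by (simp add: subcring.axioms)
  next
    assume *: "subring K CC \<and> (\<forall>x\<in>K. inverse x \<in> K)"
    show "subfield K CC"
      by (rule subfieldI') (use * in \<open>auto simp: m_inv_CC\<close>)
  qed
qed

lemma subring_CC_closed:
  assumes "subring S CC"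
  shows "0 \<in> S" "1 \<in> S" "x \<in> S \<Longrightarrow> y \<in> S \<Longrightarrow> x + y \<in> S" "x \<in> S \<Longrightarrow> y \<in> S \<Longrightarrow> x - y \<in> S"
    "x \<in> S \<Longrightarrow> y \<in> S \<Longrightarrow> x * y \<in> S" "x \<in> S \<Longrightarrow> - x \<in> S" "x \<in> S \<Longrightarrow> x ^ n \<in> S"
    "of_nat n \<in> S" "of_int k \<in> S"
proof -
  show 1: "1 \<in> S" and d: "x \<in> S \<Longrightarrow> y \<in> S \<Longrightarrow> x - y \<in> S" and m: "x \<in> S \<Longrightarrow> y \<in> S \<Longrightarrow> x * y \<in> S" for x y
    using assms by (auto simp: subring_CC_iff)
  show 0: "0 \<in> S" using 1 d by (metis diff_self)
  show n: "x \<in> S \<Longrightarrow> - x \<in> S" for x using 0 d by (metis diff_0)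
  show a: "x \<in> S \<Longrightarrow> y \<in> S \<Longrightarrow> x + y \<in> S" for x y using n d by (metis diff_minus_eq_add)
  show "x \<in> S \<Longrightarrow> x ^ n \<in> S" by (induction n) (auto simp: 1 m)
  show nn: "of_nat n \<in> S" for n by (induction n) (auto simp: 0 1 a)
  show "of_int k \<in> S" by (cases k rule: int_cases2) (auto simp: nn n)
qed

lemma subring_CC_sum: "subring S CC \<Longrightarrow> (\<And>i. i \<in> I \<Longrightarrow> f i \<in> S) \<Longrightarrow> sum f I \<in> S"
  by (induction I rule: infinite_finite_induct) (auto simp: subring_CC_closed)

lemma subfield_CC_subring: "subfield K CC \<Longrightarrow> subring K CC"
  by (simp add: subfield_CC_iff)

lemma subfield_CC_closed:
  assumes "subfield K CC"
  shows "x \<in> K \<Longrightarrow> inverse x \<in> K" "x \<in> K \<Longrightarrow> y \<in> K \<Longrightarrow> x / y \<in> K"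
  using assms by (auto simp: subfield_CC_iff field_class.field_divide_inverse subring_CC_closed)

lemma Rats_subset_subfield: "subfield K CC \<Longrightarrow> \<rat> \<subseteq> K"
  by (auto elim!: Rats_cases' intro!: subfield_CC_closed subring_CC_closed subfield_CC_subring)

lemma subfield_Rats: "subfield \<rat> CC"
  by (auto simp: subfield_CC_iff subring_CC_iff)

text \<open>Only the values on \<open>S\<close> and at 1 matter, so an embedding of a field serves
  unchanged as an embedding of every subfield and no extensionality has to be maintained.\<close>

definition field_emb :: "complex set \<Rightarrow> (complex \<Rightarrow> complex) \<Rightarrow> bool"
  where "field_emb S h \<longleftrightarrow>
    h 1 = 1 \<and> (\<forall>x\<in>S. \<forall>y\<in>S. h (x + y) = h x + h y \<and> h (x * y) = h x * h y)"

lemma ring_hom_CC_iff: "h \<in> ring_hom (sub_CC S) CC \<longleftrightarrow> field_emb S h"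
  by (auto simp: ring_hom_def field_emb_def)

lemma field_embD:
  assumes "field_emb S h"
  shows "h 1 = 1" "x \<in> S \<Longrightarrow> y \<in> S \<Longrightarrow> h (x + y) = h x + h y"
    "x \<in> S \<Longrightarrow> y \<in> S \<Longrightarrow> h (x * y) = h x * h y"
  using assms by (auto simp: field_emb_def)

lemma field_emb_mono: "field_emb F h \<Longrightarrow> S \<subseteq> F \<Longrightarrow> field_emb S h"
  unfolding field_emb_def by blast

lemma field_emb_cong: "field_emb S g \<Longrightarrow> subring S CC \<Longrightarrow> (\<And>x. x \<in> S \<Longrightarrow> h x = g x) \<Longrightarrow> field_emb S h"
  unfolding field_emb_def by (auto simp: subring_CC_closed)

lemma field_emb_simps:
  assumes h: "field_emb S h" and S: "subring S CC"
  shows "h 0 = 0" "h 1 = 1" "x \<in> S \<Longrightarrow> h (- x) = - h x" "x \<in> S \<Longrightarrow> y \<in> S \<Longrightarrow> h (x - y) = h x - h y"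
    "x \<in> S \<Longrightarrow> h (x ^ n) = h x ^ n" "h (of_nat n) = of_nat n" "h (of_int k) = of_int k"
proof -
  note * = field_embD[OF h] subring_CC_closed[OF S]
  have "h (0 + 0) = h 0 + h 0" by (intro *)
  then show 0: "h 0 = 0" by simp
  show "h 1 = 1" by (rule *)
  have m: "h (- x) = - h x" if "x \<in> S" for x
  proof -
    have "h (x + - x) = h x + h (- x)" by (intro * that)
    then show ?thesis using 0 by (simp add: eq_neg_iff_add_eq_0 add.commute)
  qed
  then show "x \<in> S \<Longrightarrow> h (- x) = - h x" .
  show d: "h (x - y) = h x - h y" if "x \<in> S" "y \<in> S" for x y
    using *(2)[of x "- y"] that *(9) m by simp
  show "x \<in> S \<Longrightarrow> h (x ^ n) = h x ^ n" by (induction n) (auto simp: *)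
  show n: "h (of_nat n) = of_nat n" for n by (induction n) (auto simp: * 0)
  show "h (of_int k) = of_int k" by (cases k rule: int_cases2) (auto simp: n m *)
qed

lemma field_emb_sum:
  assumes h: "field_emb S h" and S: "subring S CC" and f: "\<And>i. i \<in> I \<Longrightarrow> f i \<in> S"
  shows "h (sum f I) = (\<Sum>i\<in>I. h (f i))"
  using f by (induction I rule: infinite_finite_induct)
    (auto simp: field_emb_simps[OF h S] field_embD[OF h] subring_CC_sum[OF S])

lemma field_emb_inverse:
  assumes h: "field_emb K h" and K: "subfield K CC" and x: "x \<in> K"
  shows "h (inverse x) = inverse (h x)"
proof (cases "x = 0")
  case True
  then show ?thesis using field_emb_simps[OF h subfield_CC_subring[OF K]] by simp
next
  case False
  have "h x * h (inverse x) = h (x * inverse x)"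
    using field_embD[OF h] x subfield_CC_closed[OF K] by simp
  also have "\<dots> = 1" using False field_embD[OF h] by simp
  finally show ?thesis by (metis inverse_unique)
qed

lemma field_emb_eq_0_iff:
  assumes "field_emb K h" "subfield K CC" "x \<in> K"
  shows "h x = 0 \<longleftrightarrow> x = 0"
  by (metis assms field_embD(1,3) field_emb_simps(1) mult_zero_left right_inverse
      subfield_CC_closed(1) subfield_CC_subring zero_neq_one)

lemma field_emb_inj_on:
  assumes h: "field_emb K h" and K: "subfield K CC"
  shows "inj_on h K"
proof (rule inj_onI)
  fix x y assume "x \<in> K" "y \<in> K" "h x = h y"
  moreover have "h (x - y) = h x - h y"
    using calculation field_emb_simps[OF h subfield_CC_subring[OF K]] by simp
  ultimately show "x = y" using field_emb_eq_0_iff[OF h K, of "x - y"]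
    by (simp add: subring_CC_closed subfield_CC_subring[OF K])
qed

lemma field_emb_Rats:
  assumes h: "field_emb K h" and K: "subfield K CC" and x: "x \<in> \<rat>"
  shows "h x = x"
proof -
  have S: "subring K CC" using K by (rule subfield_CC_subring)
  from x obtain a b where x: "x = of_int a / of_int b" by (auto elim: Rats_cases')
  then have "h x = h (of_int a * inverse (of_int b))" by (simp add: field_class.field_divide_inverse)
  also have "\<dots> = h (of_int a) * h (inverse (of_int b))"
    by (intro field_embD[OF h] subfield_CC_closed[OF K] subring_CC_closed[OF S])
  also have "\<dots> = x" using x
    by (simp add: field_emb_inverse[OF h K] field_emb_simps[OF h S] subring_CC_closed[OF S] field_class.field_divide_inverse)
  finally show ?thesis .
qed

lemma field_emb_compose:
  assumes "field_emb S g" "field_emb T h" "g ` S \<subseteq> T"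
  shows "field_emb S (\<lambda>x. h (g x))"
  using assms unfolding field_emb_def by (auto simp: image_subset_iff)

lemma subring_emb_image:
  assumes h: "field_emb S h" and S: "subring S CC"
  shows "subring (h ` S) CC"
  unfolding subring_CC_iff
proof (intro conjI ballI)
  show "1 \<in> h ` S" using field_embD(1)[OF h] subring_CC_closed(2)[OF S] by (metis imageI)
  fix x y assume "x \<in> h ` S" "y \<in> h ` S"
  then obtain a b where "a \<in> S" "b \<in> S" "x = h a" "y = h b" by auto
  then show "x - y \<in> h ` S" "x * y \<in> h ` S"
    using subring_CC_closed[OF S] field_emb_simps(4)[OF h S] field_embD(3)[OF h] by (metis imageI)+
qed

lemma subfield_emb_image:
  assumes h: "field_emb K h" and K: "subfield K CC"
  shows "subfield (h ` K) CC"
  unfolding subfield_CC_iff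
  using subring_emb_image[OF h subfield_CC_subring[OF K]] subfield_CC_closed(1)[OF K]
  by (auto simp: field_emb_inverse[OF h K, symmetric])

lemma field_emb_inv_into:
  assumes h: "field_emb K h" and K: "subfield K CC"
  shows "field_emb (h ` K) (inv_into K h)"
proof -
  note i = inv_into_f_f[OF field_emb_inj_on[OF h K]]
  note S = subring_CC_closed[OF subfield_CC_subring[OF K]]
  have "inv_into K h (h x + h y) = x + y" "inv_into K h (h x * h y) = x * y" if "x \<in> K" "y \<in> K" for x y
    using i[of "x + y"] i[of "x * y"] that S field_embD[OF h] by auto
  moreover have "inv_into K h 1 = 1" using i[of 1] S field_embD[OF h] by auto
  ultimately show ?thesis by (auto simp: field_emb_def i)
qed

section \<open>Polynomials over a subring\<close>

text \<open>Polynomials over \<open>S\<close> stay in the type \<open>complex poly\<close>, where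
  degrees, roots and the fundamental theorem of algebra are at hand; \<open>algebraic_CC_iff\<close>
  links them to the list polynomials behind \<open>ring.algebraic\<close>.\<close>

definition polys_over :: "complex set \<Rightarrow> complex poly set"
  where "polys_over S = {p. \<forall>i. coeff p i \<in> S}"

lemma polys_overD: "p \<in> polys_over S \<Longrightarrow> coeff p i \<in> S"
  by (simp add: polys_over_def)

lemma polys_over_mono: "S \<subseteq> T \<Longrightarrow> polys_over S \<subseteq> polys_over T"
  by (auto simp: polys_over_def)

lemma polys_over_closed:
  assumes S: "subring S CC"
  shows "0 \<in> polys_over S" "1 \<in> polys_over S" "p \<in> polys_over S \<Longrightarrow> q \<in> polys_over S \<Longrightarrow> p + q \<in> polys_over S"
    "p \<in> polys_over S \<Longrightarrow> q \<in> polys_over S \<Longrightarrow> p - q \<in> polys_over S"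
    "p \<in> polys_over S \<Longrightarrow> q \<in> polys_over S \<Longrightarrow> p * q \<in> polys_over S"
    "c \<in> S \<Longrightarrow> Polynomial.monom c n \<in> polys_over S"
    "c \<in> S \<Longrightarrow> p \<in> polys_over S \<Longrightarrow> pCons c p \<in> polys_over S"
    "c \<in> S \<Longrightarrow> p \<in> polys_over S \<Longrightarrow> Polynomial.smult c p \<in> polys_over S"
  using subring_CC_closed[OF S]
  by (auto simp: polys_over_def coeff_mult coeff_pCons intro!: subring_CC_sum[OF S] split: nat.splits)

lemma polys_over_sum: "subring S CC \<Longrightarrow> (\<And>i. i \<in> I \<Longrightarrow> f i \<in> polys_over S) \<Longrightarrow> sum f I \<in> polys_over S"
  by (induction I rule: infinite_finite_induct) (auto simp: polys_over_closed)

lemma polys_over_prod: "subring S CC \<Longrightarrow> (\<And>i. i \<in> I \<Longrightarrow> f i \<in> polys_over S) \<Longrightarrow> prod f I \<in> polys_over S"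
  by (induction I rule: infinite_finite_induct) (auto simp: polys_over_closed)

lemma poly_in_subring: "subring S CC \<Longrightarrow> p \<in> polys_over S \<Longrightarrow> x \<in> S \<Longrightarrow> poly p x \<in> S"
  unfolding poly_altdef by (intro subring_CC_sum) (auto simp: subring_CC_closed polys_overD)

lemma map_poly_emb:
  assumes h: "field_emb S h" and S: "subring S CC"
  shows "p \<in> polys_over S \<Longrightarrow> q \<in> polys_over S \<Longrightarrow> map_poly h (p + q) = map_poly h p + map_poly h q"
    "p \<in> polys_over S \<Longrightarrow> q \<in> polys_over S \<Longrightarrow> map_poly h (p - q) = map_poly h p - map_poly h q"
    "p \<in> polys_over S \<Longrightarrow> q \<in> polys_over S \<Longrightarrow> map_poly h (p * q) = map_poly h p * map_poly h q"
    "map_poly h 1 = 1"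
    "map_poly h (Polynomial.monom c n) = Polynomial.monom (h c) n"
    "map_poly h (pCons c p) = pCons (h c) (map_poly h p)"
  using field_emb_simps[OF h S] field_embD[OF h] subring_CC_closed[OF S]
  by (auto intro!: poly_eqI sum.cong simp: coeff_map_poly polys_overD coeff_mult field_emb_sum[OF h S] coeff_pCons split: nat.splits)

lemma map_poly_emb_prod:
  assumes h: "field_emb S h" and S: "subring S CC" and "\<And>i. i \<in> I \<Longrightarrow> f i \<in> polys_over S"
  shows "map_poly h (prod f I) = (\<Prod>i\<in>I. map_poly h (f i))"
  using assms(3) by (induction I rule: infinite_finite_induct)
    (auto simp: map_poly_emb[OF h S] polys_over_prod[OF S])

lemma map_poly_emb_sum:
  assumes h: "field_emb S h" and S: "subring S CC" and "\<And>i. i \<in> I \<Longrightarrow> f i \<in> polys_over S"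
  shows "map_poly h (sum f I) = (\<Sum>i\<in>I. map_poly h (f i))"
  using assms(3) by (induction I rule: infinite_finite_induct)
    (auto simp: map_poly_emb[OF h S] polys_over_sum[OF S])

lemma emb_poly:
  assumes h: "field_emb S h" and S: "subring S CC" and p: "p \<in> polys_over S" and x: "x \<in> S"
  shows "h (poly p x) = poly (map_poly h p) (h x)"
  using p
proof (induction p)
  case 0
  then show ?case using field_emb_simps[OF h S] by simp
next
  case (pCons c p)
  then have c: "c \<in> S" and p: "p \<in> polys_over S"
    unfolding polys_over_def by (auto simp: coeff_pCons split: nat.splits)
  then have "h (poly (pCons c p) x) = h c + h x * h (poly p x)"
    using x field_embD[OF h] subring_CC_closed[OF S] poly_in_subring[OF S] by simp
  then show ?case using pCons.IH[OF p] by (simp add: map_poly_emb[OF h S])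
qed

section \<open>Extension of embeddings\<close>

definition alg_over :: "complex set \<Rightarrow> complex \<Rightarrow> bool"
  where "alg_over E x \<longleftrightarrow> (\<exists>p\<in>polys_over E. p \<noteq> 0 \<and> poly p x = 0)"

lemma alg_over_mono: "alg_over E x \<Longrightarrow> E \<subseteq> F \<Longrightarrow> alg_over F x"
  using polys_over_mono unfolding alg_over_def by blast

text \<open>A polynomial of least degree vanishing at \<open>x \<noteq> 0\<close> has a nonzero
  constant term \<open>c\<close>; solving \<open>c + x * poly q x = 0\<close> gives the inverse of
  \<open>x\<close>.\<close>

lemma subring_of_algebraic_is_subfield:
  assumes E: "subfield E CC" and S: "subring S CC" and "E \<subseteq> S" and alg: "\<And>x. x \<in> S \<Longrightarrow> alg_over E x"
  shows "subfield S CC"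
proof -
  have "inverse x \<in> S" if x: "x \<in> S" "x \<noteq> 0" for x
  proof -
    define P where "P = (\<lambda>p. p \<in> polys_over E \<and> p \<noteq> 0 \<and> poly p x = 0)"
    have "\<exists>p. P p" using alg[OF x(1)] by (auto simp: P_def alg_over_def)
    then obtain p where p: "P p" and min: "\<And>q. P q \<Longrightarrow> degree p \<le> degree q"
      using ex_has_least_nat[of P _ degree] by blast
    obtain c q where pq: "p = pCons c q" by (cases p) auto
    have cE: "c \<in> E" and q: "q \<in> polys_over E"
      using p unfolding P_def pq polys_over_def by (auto simp: coeff_pCons split: nat.splits)
    have "c \<noteq> 0"
    proof
      assume "c = 0"
      then have "P q" using p q x by (auto simp: P_def pq)
      from min[OF this] show False using p by (auto simp: pq P_def \<open>c = 0\<close>)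
    qed
    have "c + x * poly q x = 0" using p by (simp add: P_def pq)
    then have "x * (- poly q x / c) = 1" using \<open>c \<noteq> 0\<close>
      by (simp add: field_simps add_eq_0_iff2)
    then have "inverse x = - poly q x * inverse c"
      by (simp add: inverse_unique field_class.field_divide_inverse)
    moreover have "q \<in> polys_over S" using q polys_over_mono[OF \<open>E \<subseteq> S\<close>] by blast
    moreover have "inverse c \<in> S" using subfield_CC_closed(1)[OF E cE] \<open>E \<subseteq> S\<close> by blast
    ultimately show ?thesis
      using x by (simp add: subring_CC_closed[OF S] poly_in_subring[OF S])
  qed
  then show ?thesis using S subring_CC_closed(1)[OF S] unfolding subfield_CC_iff
    by (metis inverse_zero)
qed

text \<open>Here \<open>f\<close> is the minimal polynomial of \<open>a\<close>. Each step of the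
  division of \<open>p\<close> by \<open>f\<close> subtracts a multiple of \<open>f\<close>, whose
  image under \<open>h\<close> vanishes at \<open>b\<close>; by minimality the division ends with
  0.\<close>

lemma emb_root_transfer:
  assumes D: "subfield D CC" and h: "field_emb D h"
    and f: "f \<in> polys_over D" "lead_coeff f = 1" "poly f a = 0"
    and min: "\<And>q. q \<in> polys_over D \<Longrightarrow> q \<noteq> 0 \<Longrightarrow> poly q a = 0 \<Longrightarrow> degree f \<le> degree q"
    and b: "poly (map_poly h f) b = 0"
    and p: "p \<in> polys_over D" "poly p a = 0"
  shows "poly (map_poly h p) b = 0"
  using p
proof (induction "degree p" arbitrary: p rule: less_induct)
  case less
  have S: "subring D CC" using D by (rule subfield_CC_subring)
  show ?case
  proof (cases "p = 0")
    case False
    define m where "m = Polynomial.monom (lead_coeff p) (degree p - degree f)"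
    define q where "q = p - m * f"
    have m: "m \<in> polys_over D" using less.prems by (auto simp: m_def polys_over_closed[OF S] polys_overD)
    have q: "q \<in> polys_over D" "poly q a = 0"
      using less.prems m f by (auto simp: q_def polys_over_closed[OF S])
    have deg: "degree f \<le> degree p" using min less.prems False by blast
    have "degree (m * f) \<le> degree p"
      using deg degree_mult_le[of m f] degree_monom_le[of "lead_coeff p" "degree p - degree f"]
      unfolding m_def by linarith
    then have "degree q \<le> degree p" unfolding q_def by (simp add: degree_diff_le)
    moreover have "coeff q (degree p) = 0"
      using deg f(2) by (simp add: q_def m_def coeff_monom_mult)
    ultimately have "q = 0 \<or> degree q < degree p" by (rule eq_zero_or_degree_less)
    then have "poly (map_poly h q) b = 0" using less.hyps q by auto
    moreover have "map_poly h p = map_poly h q + map_poly h m * map_poly h f"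
      unfolding q_def using less.prems m f
      by (simp add: map_poly_emb[OF h S] polys_over_closed[OF S])
    ultimately show ?thesis using b by simp
  qed simp
qed

text \<open>Zorn's lemma is applied to the graphs of embeddings of intermediate rings.\<close>

theorem extend_field_emb:
  assumes E: "subfield E CC" and F: "subfield F CC" and EF: "E \<subseteq> F"
    and alg: "\<And>x. x \<in> F \<Longrightarrow> alg_over E x" and g: "field_emb E g"
  obtains h where "field_emb F h" "\<And>x. x \<in> E \<Longrightarrow> h x = g x"
proof -
  have SE: "subring E CC" and SF: "subring F CC" using E F by (auto intro: subfield_CC_subring)
  \<comment> \<open>Given closure under differences, the last condition says that \<open>R\<close>
    is single-valued.\<close>
  define \<A> where "\<A> = {R. R \<subseteq> F \<times> UNIV \<and> (\<lambda>x. (x, g x)) ` E \<subseteq> R \<and>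
      (\<forall>x u y v. (x, u) \<in> R \<and> (y, v) \<in> R \<longrightarrow> (x - y, u - v) \<in> R \<and> (x * y, u * v) \<in> R) \<and>
      (\<forall>u. (0, u) \<in> R \<longrightarrow> u = 0)}"
  have "(\<lambda>x. (x, g x)) ` E \<in> \<A>"
    unfolding \<A>_def using EF field_emb_simps[OF g SE] field_embD[OF g] subring_CC_closed[OF SE]
    by (auto simp: image_iff)
  then have "\<A> \<noteq> {}" by blast
  moreover have "\<Union>\<C> \<in> \<A>" if C: "\<C> \<noteq> {}" "subset.chain \<A> \<C>" for \<C>
  proof -
    have sub: "\<C> \<subseteq> \<A>" and lin: "\<And>A B. A \<in> \<C> \<Longrightarrow> B \<in> \<C> \<Longrightarrow> A \<subseteq> B \<or> B \<subseteq> A"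
      using C(2) by (auto simp: subset.chain_def)
    have "(x - y, u - v) \<in> \<Union>\<C> \<and> (x * y, u * v) \<in> \<Union>\<C>"
      if xy: "(x, u) \<in> \<Union>\<C>" "(y, v) \<in> \<Union>\<C>" for x u y v
    proof -
      obtain A B where AB: "A \<in> \<C>" "B \<in> \<C>" "(x, u) \<in> A" "(y, v) \<in> B" using xy by blast
      then obtain Z where "Z \<in> \<C>" "(x, u) \<in> Z" "(y, v) \<in> Z" using lin by blast
      then show ?thesis using sub unfolding \<A>_def by blast
    qed
    moreover obtain A where A: "A \<in> \<C>" using C(1) by blast
    have "\<Union>\<C> \<subseteq> F \<times> UNIV" using sub unfolding \<A>_def by (intro Union_least) blast
    moreover have "(\<lambda>x. (x, g x)) ` E \<subseteq> \<Union>\<C>"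
      using sub A unfolding \<A>_def by (intro order.trans[OF _ Union_upper[OF A]]) blast
    moreover have "\<forall>u. (0, u) \<in> \<Union>\<C> \<longrightarrow> u = 0" using sub unfolding \<A>_def by auto
    ultimately show ?thesis unfolding \<A>_def by simp
  qed
  ultimately obtain R where R: "R \<in> \<A>" and max: "\<And>A. A \<in> \<A> \<Longrightarrow> R \<subseteq> A \<Longrightarrow> A = R"
    using subset_Zorn_nonempty[of \<A>] by blast
  have RF: "R \<subseteq> F \<times> UNIV" and Rg: "\<And>x. x \<in> E \<Longrightarrow> (x, g x) \<in> R"
    and Rd: "\<And>x u y v. (x, u) \<in> R \<Longrightarrow> (y, v) \<in> R \<Longrightarrow> (x - y, u - v) \<in> R"
    and Rm: "\<And>x u y v. (x, u) \<in> R \<Longrightarrow> (y, v) \<in> R \<Longrightarrow> (x * y, u * v) \<in> R"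
    and R0: "\<And>u. (0, u) \<in> R \<Longrightarrow> u = 0"
    using R unfolding \<A>_def by blast+
  have Ra: "(x + y, u + v) \<in> R" if "(x, u) \<in> R" "(y, v) \<in> R" for x u y v
    using Rd[OF that(1) Rd[OF Rd[OF that(2,2)] that(2)]] by simp
  have uniq: "u = v" if "(x, u) \<in> R" "(x, v) \<in> R" for x u v
    using R0[of "u - v"] Rd[OF that] by simp
  define D where "D = fst ` R"
  define h where "h = (\<lambda>x. SOME u. (x, u) \<in> R)"
  have hR: "(x, h x) \<in> R" if "x \<in> D" for x
    using that unfolding D_def h_def by (force intro: someI)
  have hI: "h x = u" "x \<in> D" if "(x, u) \<in> R" for x u
  proof -
    show x: "x \<in> D" using that unfolding D_def by force
    show "h x = u" using uniq[OF hR[OF x] that] .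
  qed
  have 1: "(1, 1) \<in> R" using Rg[of 1] field_embD(1)[OF g] subring_CC_closed(2)[OF SE] by simp
  have SD: "subring D CC" unfolding subring_CC_iff
    using hI(2)[OF 1] hI(2)[OF Rd[OF hR hR]] hI(2)[OF Rm[OF hR hR]] by simp
  have ED: "E \<subseteq> D" using Rg hI(2) by blast
  have DF: "D \<subseteq> F" using RF by (auto simp: D_def)
  have D: "subfield D CC" by (rule subring_of_algebraic_is_subfield[OF E SD ED]) (use alg DF in blast)
  have h: "field_emb D h" unfolding field_emb_def
    using hI(1)[OF 1] hI(1)[OF Ra[OF hR hR]] hI(1)[OF Rm[OF hR hR]] by simp
  have "a \<in> D" if a: "a \<in> F" for a
  proof -
    define P where "P = (\<lambda>p. p \<in> polys_over D \<and> p \<noteq> 0 \<and> poly p a = 0)"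
    have "\<exists>p. P p" using alg_over_mono[OF alg[OF a] ED] by (auto simp: P_def alg_over_def)
    then obtain f0 where f0: "P f0" and min: "\<And>q. P q \<Longrightarrow> degree f0 \<le> degree q"
      using ex_has_least_nat[of P _ degree] by blast
    define f where "f = Polynomial.smult (inverse (lead_coeff f0)) f0"
    have f: "f \<in> polys_over D" "lead_coeff f = 1" "poly f a = 0" "degree f = degree f0"
      using f0 by (auto simp: f_def P_def polys_over_closed[OF SD] subfield_CC_closed[OF D] polys_overD)
    have "degree f > 0"
    proof (rule ccontr)
      assume "\<not> degree f > 0"
      then obtain c where "f = [:c:]" by (metis degree_eq_zeroE neq0_conv)
      with f(2,3) show False by simp
    qed
    moreover have "coeff (map_poly h f) (degree f) = 1"
      using f(2) by (simp add: coeff_map_poly field_emb_simps[OF h SD])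
    ultimately have "degree (map_poly h f) > 0"
      by (metis le_degree less_le_trans one_neq_zero)
    then have "\<not> constant (poly (map_poly h f))" by (simp add: constant_degree)
    then obtain b where b: "poly (map_poly h f) b = 0"
      using fundamental_theorem_of_algebra by blast
    have van: "poly (map_poly h p) b = 0" if "p \<in> polys_over D" "poly p a = 0" for p
      by (rule emb_root_transfer[OF D h f(1-3) _ b that]) (use min f(4) in \<open>auto simp: P_def\<close>)
    \<comment> \<open>The graph of the extension of \<open>h\<close> to \<open>D[a]\<close> that
      sends \<open>a\<close> to the root \<open>b\<close>; \<open>van\<close> makes it
      single-valued. Maximality of \<open>R\<close> then puts \<open>a\<close> into
      \<open>D\<close>.\<close>
    define R' where "R' = (\<lambda>p. (poly p a, poly (map_poly h p) b)) ` polys_over D"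
    have const: "(x, h x) \<in> R'" if "x \<in> D" for x
    proof -
      have "(x, h x) = (poly [:x:] a, poly (map_poly h [:x:]) b)"
        by (simp add: map_poly_emb[OF h SD])
      moreover have "[:x:] \<in> polys_over D" using that by (simp add: polys_over_closed[OF SD])
      ultimately show ?thesis unfolding R'_def by blast
    qed
    have "R' \<in> \<A>"
      unfolding \<A>_def
    proof (intro CollectI conjI allI impI)
      show "R' \<subseteq> F \<times> UNIV"
        using polys_over_mono[OF DF] a by (auto simp: R'_def intro!: poly_in_subring[OF SF])
      show "(\<lambda>x. (x, g x)) ` E \<subseteq> R'" using const ED hI(1) Rg by fastforce
    next
      fix x u y v assume "(x, u) \<in> R' \<and> (y, v) \<in> R'"
      then obtain p q where pq: "p \<in> polys_over D" "q \<in> polys_over D"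
        "x = poly p a" "u = poly (map_poly h p) b" "y = poly q a" "v = poly (map_poly h q) b"
        by (auto simp: R'_def)
      then have "(x - y, u - v) = (poly (p - q) a, poly (map_poly h (p - q)) b)"
        "(x * y, u * v) = (poly (p * q) a, poly (map_poly h (p * q)) b)"
        by (auto simp: map_poly_emb[OF h SD])
      moreover have "p - q \<in> polys_over D" "p * q \<in> polys_over D"
        using pq by (auto simp: polys_over_closed[OF SD])
      ultimately show "(x - y, u - v) \<in> R'" "(x * y, u * v) \<in> R'" unfolding R'_def by blast+
    next
      fix u assume "(0, u) \<in> R'"
      then show "u = 0" using van by (auto simp: R'_def)
    qed
    moreover have "R \<subseteq> R'" using const hI by (metis subrelI)
    ultimately have "R' = R" by (rule max)
    moreover have "(a, b) \<in> R'"
    proof -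
      have "(a, b) = (poly [:0, 1:] a, poly (map_poly h [:0, 1:]) b)"
        using field_emb_simps[OF h SD] by (simp add: map_poly_emb[OF h SD])
      moreover have "[:0, 1:] \<in> polys_over D" by (intro polys_over_closed[OF SD] subring_CC_closed[OF SD])
      ultimately show ?thesis unfolding R'_def by blast
    qed
    ultimately show ?thesis using hI by blast
  qed
  then have "D = F" using DF by blast
  with h show ?thesis using that[of h] hI(1)[OF Rg] by blast
qed

lemma field_emb_of_nat_mult:
  assumes "field_emb S h" "subring S CC" "x \<in> S"
  shows "h (of_nat n * x) = of_nat n * h x"
  using field_embD(3)[OF assms(1) subring_CC_closed(8)[OF assms(2)] assms(3)] field_emb_simps(6)[OF assms(1,2)]
  by simp

section \<open>Galois groups\<close>

text \<open>The sets play the part of rational subspaces. Take \<open>y\<close> outside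
  \<open>S j\<close> and, by induction, \<open>x\<close> outside all the others; then
  \<open>x\<close> lies in \<open>S j\<close>, so no \<open>y + n * x\<close> does. Two of these
  points share some other \<open>S i\<close>, and their difference is a positive multiple of
  \<open>x\<close>.\<close>

lemma subspace_union:
  fixes S :: "'i \<Rightarrow> complex set"
  assumes "finite I" and F: "subring F CC" and cover: "F \<subseteq> (\<Union>i\<in>I. S i)"
    and diff: "\<And>i x y. i \<in> I \<Longrightarrow> x \<in> F \<Longrightarrow> y \<in> F \<Longrightarrow> x \<in> S i \<Longrightarrow> y \<in> S i \<Longrightarrow> x - y \<in> S i"
    and mult: "\<And>i x (n::nat). i \<in> I \<Longrightarrow> x \<in> F \<Longrightarrow> n > 0 \<Longrightarrow> of_nat n * x \<in> S i \<longleftrightarrow> x \<in> S i"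
  shows "\<exists>i\<in>I. F \<subseteq> S i"
  using assms(1) cover diff mult
proof (induction I rule: finite_induct)
  case empty
  then show ?case using subring_CC_closed[OF F] by auto
next
  case (insert j I)
  show ?case
  proof (rule ccontr)
    assume no: "\<not> ?thesis"
    then obtain y where y: "y \<in> F" "y \<notin> S j" by blast
    have "\<not> F \<subseteq> (\<Union>i\<in>I. S i)"
      using insert.IH insert.prems(2,3) no by blast
    then obtain x where x: "x \<in> F" "\<And>i. i \<in> I \<Longrightarrow> x \<notin> S i" by blast
    then have xj: "x \<in> S j" using insert.prems(1) by blast
    have yn: "y + of_nat n * x \<in> F" for n using x y by (auto simp: subring_CC_closed[OF F])
    have "y + of_nat n * x \<notin> S j" for n
    proof
      assume a: "y + of_nat n * x \<in> S j"
      have "of_nat n * x \<in> S j"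
      proof (cases n)
        case 0
        then show ?thesis using insert.prems(2)[of j x x] x xj by auto
      next
        case (Suc m)
        then show ?thesis using insert.prems(3)[of j x n] x xj by auto
      qed
      then have "y + of_nat n * x - of_nat n * x \<in> S j"
        using insert.prems(2)[of j "y + of_nat n * x" "of_nat n * x"] a yn x
        by (simp add: subring_CC_closed[OF F])
      with y show False by simp
    qed
    then have "\<forall>n::nat. \<exists>i\<in>I. y + of_nat n * x \<in> S i" using yn insert.prems(1) by blast
    then obtain k where k: "\<And>n::nat. k n \<in> I" "\<And>n. y + of_nat n * x \<in> S (k n)" by metis
    have "\<not> inj k" using k(1) insert.hyps(1)
      by (metis finite_subset finite_imageD image_subsetI infinite_UNIV_nat)
    then obtain m n where mn: "m < n" "k m = k n" by (metis injI linorder_neqE_nat)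
    have "(y + of_nat n * x) - (y + of_nat m * x) \<in> S (k n)"
      using insert.prems(2) k yn mn by (metis insertI2)
    moreover have "(y + of_nat n * x) - (y + of_nat m * x) = of_nat (n - m) * x"
      using mn by (simp add: of_nat_diff algebra_simps)
    ultimately have "x \<in> S (k n)" using insert.prems(3)[of "k n" x "n - m"] k(1) x(1) mn(1) by simp
    then show False using x(2)[OF k(1)] by simp
  qed
qed

text \<open>Bijectivity reduces to surjectivity because an embedding of a field is
  injective.\<close>

lemma carrier_Gal:
  assumes F: "subfield F CC"
  shows "\<sigma> \<in> carrier (Gal F E) \<longleftrightarrow> \<sigma> \<in> extensional F \<and> \<sigma> ` F = F \<and> field_emb F \<sigma> \<and> (\<forall>x\<in>E. \<sigma> x = x)"
proof -
  have "\<sigma> \<in> ring_hom (sub_CC F) (sub_CC F) \<longleftrightarrow> field_emb F \<sigma> \<and> \<sigma> ` F \<subseteq> F"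
    by (auto simp: ring_hom_def field_emb_def)
  then show ?thesis
    using field_emb_inj_on[OF _ F] by (auto simp: Gal_def Bij_def bij_betw_def)
qed

text \<open>The operation does not depend on the fixed field, hence the separate variable
  \<open>E'\<close>: elements of \<open>Gal M L\<close> multiply alike in \<open>Gal M L\<close> and
  in \<open>Gal M \<rat>\<close>.\<close>

lemma Gal_mult:
  assumes "subfield F CC" "\<sigma> \<in> carrier (Gal F E)" "\<tau> \<in> carrier (Gal F E)"
  shows "\<sigma> \<otimes>\<^bsub>Gal F E'\<^esub> \<tau> = compose F \<sigma> \<tau>"
  using assms by (auto simp: Gal_def BijGroup_def)

lemma Gal_one: "\<one>\<^bsub>Gal F E\<^esub> = (\<lambda>x\<in>F. x)"
  by (simp add: Gal_def BijGroup_def)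

lemma Gal_restrict_mem:
  assumes F: "subfield F CC" and "field_emb F h" "h ` F = F" "E \<subseteq> F" "\<And>x. x \<in> E \<Longrightarrow> h x = x"
  shows "restrict h F \<in> carrier (Gal F E)"
  using assms field_emb_cong[OF assms(2) subfield_CC_subring[OF F], of "restrict h F"]
  by (auto simp: carrier_Gal[OF F])

lemma Gal_subgroup:
  assumes F: "subfield F CC" and "E \<subseteq> F"
  shows "subgroup (carrier (Gal F E)) (BijGroup F)"
proof (rule group.subgroupI[OF group_BijGroup])
  show "carrier (Gal F E) \<subseteq> carrier (BijGroup F)" by (auto simp: Gal_def BijGroup_def)
  have "restrict (\<lambda>x. x) F \<in> carrier (Gal F E)"
    by (rule Gal_restrict_mem) (use assms in \<open>auto simp: field_emb_def\<close>)
  then show "carrier (Gal F E) \<noteq> {}" by blast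
next
  fix \<sigma> assume s: "\<sigma> \<in> carrier (Gal F E)"
  then have B: "\<sigma> \<in> Bij F" by (simp add: Gal_def)
  note * = s[unfolded carrier_Gal[OF F]]
  have inv: "inv\<^bsub>BijGroup F\<^esub> \<sigma> = restrict (inv_into F \<sigma>) F" using inv_BijGroup[OF B] .
  have "field_emb F (inv_into F \<sigma>)" using field_emb_inv_into[of F \<sigma>] * F by metis
  moreover have "inv_into F \<sigma> x = x" if "x \<in> E" for x
    using inv_into_f_f[OF field_emb_inj_on, of F \<sigma> x] * F that \<open>E \<subseteq> F\<close> by auto
  moreover have "inv_into F \<sigma> ` F = F"
    using * field_emb_inj_on[OF _ F] by (metis bij_betw_def bij_betw_inv_into)
  ultimately show "inv\<^bsub>BijGroup F\<^esub> \<sigma> \<in> carrier (Gal F E)"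
    unfolding inv by (intro Gal_restrict_mem) (use F \<open>E \<subseteq> F\<close> in auto)
next
  fix \<sigma> \<tau> assume s: "\<sigma> \<in> carrier (Gal F E)" and t: "\<tau> \<in> carrier (Gal F E)"
  then have B: "\<sigma> \<in> Bij F" "\<tau> \<in> Bij F" by (auto simp: Gal_def)
  note * = s[unfolded carrier_Gal[OF F]] t[unfolded carrier_Gal[OF F]]
  have "restrict (\<lambda>x. \<sigma> (\<tau> x)) F \<in> carrier (Gal F E)"
  proof (rule Gal_restrict_mem[OF F])
    show "field_emb F (\<lambda>x. \<sigma> (\<tau> x))" using field_emb_compose[of F \<tau> F \<sigma>] * by simp
    show "(\<lambda>x. \<sigma> (\<tau> x)) ` F = F" using * image_image[of \<sigma> \<tau> F] by simp
  qed (use * \<open>E \<subseteq> F\<close> in auto)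
  then show "\<sigma> \<otimes>\<^bsub>BijGroup F\<^esub> \<tau> \<in> carrier (Gal F E)"
    using B by (simp add: BijGroup_def compose_def)
qed

lemma group_Gal:
  assumes "subfield F CC" "E \<subseteq> F"
  shows "group (Gal F E)"
proof -
  have "Gal F E = BijGroup F\<lparr>carrier := carrier (Gal F E)\<rparr>" by (simp add: Gal_def)
  then show ?thesis
    using subgroup.subgroup_is_group[OF Gal_subgroup[OF assms] group_BijGroup] by simp
qed

lemma Gal_apply:
  assumes F: "subfield F CC" and "\<sigma> \<in> carrier (Gal F E)"
  shows "x \<in> F \<Longrightarrow> \<sigma> x \<in> F" "field_emb F \<sigma>" "\<sigma> ` F = F" "x \<in> E \<Longrightarrow> \<sigma> x = x"
    "\<tau> \<in> carrier (Gal F E) \<Longrightarrow> x \<in> F \<Longrightarrow> (\<sigma> \<otimes>\<^bsub>Gal F E'\<^esub> \<tau>) x = \<sigma> (\<tau> x)"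
  using assms(2) Gal_mult[OF F assms(2)] by (auto simp: carrier_Gal[OF F] compose_def)

lemma Gal_eqI:
  assumes F: "subfield F CC" and "\<sigma> \<in> carrier (Gal F E)" "\<tau> \<in> carrier (Gal F E')" "\<And>x. x \<in> F \<Longrightarrow> \<sigma> x = \<tau> x"
  shows "\<sigma> = \<tau>"
  using assms by (metis carrier_Gal extensionalityI)

lemma Gal_mono: "subfield F CC \<Longrightarrow> E \<subseteq> E' \<Longrightarrow> carrier (Gal F E') \<subseteq> carrier (Gal F E)"
  by (auto simp: carrier_Gal subset_iff)

text \<open>Every element is moved by \<open>\<tau>\<close> as by some element of \<open>H\<close>, since it is a root of a polynomial
  with \<open>H\<close>-invariant coefficients; a rational vector space is not a finite union of proper subspaces.\<close>

theorem emb_fixing_fixed_field_in_group: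
  assumes F: "subfield F CC" and "E \<subseteq> F" and H: "subgroup H (Gal F E)" "finite H" and \<tau>: "field_emb F \<tau>"
    and fixed: "\<And>x. x \<in> F \<Longrightarrow> (\<And>\<sigma>. \<sigma> \<in> H \<Longrightarrow> \<sigma> x = x) \<Longrightarrow> \<tau> x = x"
  shows "\<exists>\<sigma>\<in>H. \<forall>x\<in>F. \<tau> x = \<sigma> x"
proof -
  interpret G: group "Gal F E" by (rule group_Gal) fact+
  have S: "subring F CC" by (rule subfield_CC_subring[OF F])
  have HG: "H \<subseteq> carrier (Gal F E)" using H subgroup.subset by blast
  note ap = Gal_apply[OF F HG[THEN subsetD]]
  have root: "\<exists>\<sigma>\<in>H. \<tau> a = \<sigma> a" if a: "a \<in> F" for a
  proof -
    define P where "P = (\<Prod>\<sigma>\<in>H. [:- \<sigma> a, 1:])"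
    have lin: "[:- \<sigma> a, 1:] \<in> polys_over F" if "\<sigma> \<in> H" for \<sigma>
      using ap(1)[OF that a] by (auto intro!: polys_over_closed[OF S] subring_CC_closed[OF S])
    have PF: "P \<in> polys_over F" unfolding P_def by (intro polys_over_prod[OF S] lin)
    have inv: "map_poly \<rho> P = P" if r: "\<rho> \<in> H" for \<rho>
    proof -
      have "map_poly \<rho> P = (\<Prod>\<sigma>\<in>H. map_poly \<rho> [:- \<sigma> a, 1:])"
        unfolding P_def by (rule map_poly_emb_prod[OF ap(2)[OF r] S lin])
      also have "\<dots> = (\<Prod>\<sigma>\<in>H. [:- (\<rho> \<otimes>\<^bsub>Gal F E\<^esub> \<sigma>) a, 1:])"
        using r ap a HG field_emb_simps[OF ap(2)[OF r] S]
        by (intro prod.cong) (auto simp: map_poly_emb[OF ap(2)[OF r] S])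
      also have "\<dots> = P" unfolding P_def
      proof (rule prod.reindex_bij_betw)
        show "bij_betw (\<lambda>\<sigma>. \<rho> \<otimes>\<^bsub>Gal F E\<^esub> \<sigma>) H H"
        proof (rule bij_betwI[where g = "\<lambda>\<sigma>. inv\<^bsub>Gal F E\<^esub> \<rho> \<otimes>\<^bsub>Gal F E\<^esub> \<sigma>"])
          show "(\<lambda>\<sigma>. \<rho> \<otimes>\<^bsub>Gal F E\<^esub> \<sigma>) \<in> H \<rightarrow> H" "(\<lambda>\<sigma>. inv\<^bsub>Gal F E\<^esub> \<rho> \<otimes>\<^bsub>Gal F E\<^esub> \<sigma>) \<in> H \<rightarrow> H"
            using r H(1) by (auto intro: subgroup.m_closed subgroup.m_inv_closed)
        qed (use r HG in \<open>auto simp: G.m_assoc[symmetric] subset_iff\<close>)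
      qed
      finally show ?thesis .
    qed
    have "map_poly \<tau> P = P"
    proof (rule poly_eqI)
      fix i
      have "\<rho> (coeff P i) = coeff P i" if "\<rho> \<in> H" for \<rho>
        using arg_cong[OF inv[OF that], of "\<lambda>p. coeff p i"] field_emb_simps(1)[OF ap(2)[OF that] S]
        by (simp add: coeff_map_poly)
      then show "coeff (map_poly \<tau> P) i = coeff P i"
        using fixed[of "coeff P i"] PF field_emb_simps(1)[OF \<tau> S] by (simp add: coeff_map_poly polys_overD)
    qed
    moreover have "poly P a = 0"
    proof -
      have "\<one>\<^bsub>Gal F E\<^esub> \<in> H" "\<one>\<^bsub>Gal F E\<^esub> a = a"
        using subgroup.one_closed[OF H(1)] a by (auto simp: Gal_one)
      then show ?thesis unfolding P_def poly_prod using H(2) by (intro prod_zero) (auto intro!: bexI[of _ "\<one>\<^bsub>Gal F E\<^esub>"])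
    qed
    ultimately have "poly P (\<tau> a) = 0"
      using emb_poly[OF \<tau> S PF a] field_emb_simps(1)[OF \<tau> S] by simp
    then show ?thesis unfolding P_def poly_prod using H(2) by (auto simp: prod_zero_iff)
  qed
  have "\<exists>\<sigma>\<in>H. F \<subseteq> {x. \<tau> x = \<sigma> x}"
  proof (rule subspace_union[OF H(2) S])
    show "F \<subseteq> (\<Union>\<sigma>\<in>H. {x. \<tau> x = \<sigma> x})" using root by blast
    fix \<sigma> x y assume "\<sigma> \<in> H" "x \<in> F" "y \<in> F" "x \<in> {x. \<tau> x = \<sigma> x}" "y \<in> {x. \<tau> x = \<sigma> x}"
    then show "x - y \<in> {x. \<tau> x = \<sigma> x}" using field_emb_simps(4)[OF \<tau> S] field_emb_simps(4)[OF ap(2) S] by auto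
  next
    fix \<sigma> x and n :: nat assume "\<sigma> \<in> H" "x \<in> F" "n > 0"
    moreover have "\<tau> (of_nat n * x) = of_nat n * \<tau> x" "\<sigma> (of_nat n * x) = of_nat n * \<sigma> x"
      using calculation by (auto intro!: field_emb_of_nat_mult[OF _ S] \<tau> ap(2))
    ultimately show "of_nat n * x \<in> {x. \<tau> x = \<sigma> x} \<longleftrightarrow> x \<in> {x. \<tau> x = \<sigma> x}" by simp
  qed
  then show ?thesis by blast
qed

section \<open>Algebraic integers\<close>

lemma subring_Ints: "subring \<int> CC"
  by (simp add: subring_CC_iff)

lemma Ints_subset_subring: "subring S CC \<Longrightarrow> \<int> \<subseteq> S"
  by (auto elim!: Ints_cases simp: subring_CC_closed)

lemma coeffs_bound_mult:
  fixes p q :: "complex poly"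
  assumes "p = 0 \<or> degree p < d" "q = 0 \<or> degree q \<le> e"
  shows "p * q = 0 \<or> degree (p * q) < d + e"
  using assms degree_mult_le[of p q] by auto

text \<open>Gaussian elimination in place of the characteristic polynomial.\<close>

lemma algebraic_int_of_monic_system:
  fixes p :: "nat \<Rightarrow> nat \<Rightarrow> complex poly" and v :: "nat \<Rightarrow> complex"
  assumes "\<And>i j. i < n \<Longrightarrow> j < n \<Longrightarrow> p i j \<in> polys_over \<int>"
    and "\<And>i. i < n \<Longrightarrow> degree (p i i) = d i \<and> lead_coeff (p i i) = 1"
    and "\<And>i j. i < n \<Longrightarrow> j < n \<Longrightarrow> i \<noteq> j \<Longrightarrow> p i j = 0 \<or> degree (p i j) < d i"
    and "\<And>i. i < n \<Longrightarrow> (\<Sum>j<n. poly (p i j) z * v j) = 0"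
    and "\<exists>i<n. v i \<noteq> 0"
  shows "algebraic_int z"
  using assms
proof (induction n arbitrary: p d)
  case 0
  then show ?case by simp
next
  case (Suc n)
  note Z = Suc.prems(1) and mon = Suc.prems(2) and small = Suc.prems(3) and sys = Suc.prems(4)
  have root: "algebraic_int z" if "poly (p n n) z = 0"
    by (rule algebraic_int.intros[of "p n n"]) (use Z[of n n] mon[of n] that in \<open>auto simp: polys_over_def\<close>)
  show ?case
  \<comment> \<open>If \<open>v n\<close> is the only nonzero entry, the last equation says that
    \<open>z\<close> is a root of the monic integral polynomial \<open>p n n\<close>.\<close>
  proof (cases "\<exists>i<n. v i \<noteq> 0")
    case False
    then have "v n \<noteq> 0" using Suc.prems(5) less_Suc_eq by auto
    moreover have "poly (p n n) z * v n = 0" using sys[of n] False by simp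
    ultimately show ?thesis using root by simp
  next
    case True
    \<comment> \<open>Elimination of \<open>v n\<close> from row \<open>i\<close> by row
      \<open>n\<close>. The product of the two diagonal entries dominates, so the diagonal stays
      monic, now of degree \<open>d i + d n\<close>, and the other entries stay below it.\<close>
    define q where "q = (\<lambda>i j. p n n * p i j - p i n * p n j)"
    show ?thesis
    proof (rule Suc.IH[of q "\<lambda>i. d i + d n"])
      fix i j assume ij: "i < n" "j < n"
      show "q i j \<in> polys_over \<int>" unfolding q_def
        using Z ij by (intro polys_over_closed[OF subring_Ints]) auto
      have off: "p i n * p n j = 0 \<or> degree (p i n * p n j) < d i + d n"
        by (rule coeffs_bound_mult) (use small[of i n] small[of n j] ij in auto)
      show "q i j = 0 \<or> degree (q i j) < d i + d n" if "i \<noteq> j"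
      proof -
        have "p i j * p n n = 0 \<or> degree (p i j * p n n) < d i + d n"
          by (rule coeffs_bound_mult) (use small[of i j] mon[of n] ij that in auto)
        then have "p n n * p i j = 0 \<or> degree (p n n * p i j) < d i + d n" by (simp only: mult.commute)
        then show ?thesis unfolding q_def using off
          by (metis add.right_neutral diff_0 diff_zero degree_diff_less degree_minus)
      qed
    next
      fix i assume i: "i < n"
      have nz: "p n n \<noteq> 0" "p i i \<noteq> 0" using mon[of n] mon[of i] i by force+
      have deg: "degree (p n n * p i i) = d i + d n" "lead_coeff (p n n * p i i) = 1"
        using nz mon[of n] mon[of i] i lead_coeff_mult[of "p n n" "p i i"] by (auto simp: degree_mult_eq)
      have "p i n * p n i = 0 \<or> degree (p i n * p n i) < d i + d n"
        by (rule coeffs_bound_mult) (use small[of i n] small[of n i] i in auto)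
      then show "degree (q i i) = d i + d n \<and> lead_coeff (q i i) = 1"
      proof
        assume "degree (p i n * p n i) < d i + d n"
        then have "degree (- (p i n * p n i)) < degree (p n n * p i i)" using deg by simp
        from degree_add_eq_left[OF this] lead_coeff_add_le[OF this]
        show ?thesis unfolding q_def using deg by (simp add: coeff_eq_0)
      next
        assume "p i n * p n i = 0"
        then have "q i i = p n n * p i i" by (simp only: q_def diff_zero)
        then show ?thesis using deg by simp
      qed
    next
      fix i assume i: "i < n"
      have 1: "(\<Sum>j<n. poly (p i j) z * v j) = - (poly (p i n) z * v n)"
        using sys[of i] i by (simp add: eq_neg_iff_add_eq_0)
      have 2: "(\<Sum>j<n. poly (p n j) z * v j) = - (poly (p n n) z * v n)"
        using sys[of n] by (simp add: eq_neg_iff_add_eq_0)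
      have "(\<Sum>j<n. poly (q i j) z * v j) =
          poly (p n n) z * (\<Sum>j<n. poly (p i j) z * v j) - poly (p i n) z * (\<Sum>j<n. poly (p n j) z * v j)"
        by (simp add: q_def algebra_simps sum_subtractf sum_distrib_left)
      also have "\<dots> = 0" unfolding 1 2 by simp
      finally show "(\<Sum>j<n. poly (q i j) z * v j) = 0" .
    qed (rule True)
  qed
qed

section \<open>Finitely generated additive groups, and sums and products of algebraic
  integers\<close>

definition int_span :: "'i set \<Rightarrow> ('i \<Rightarrow> complex) \<Rightarrow> complex set"
  where "int_span I v = {\<Sum>j\<in>I. c j * v j | c. \<forall>j. c j \<in> \<int>}"

lemma int_spanI: "(\<And>j. c j \<in> \<int>) \<Longrightarrow> (\<Sum>j\<in>I. c j * v j) \<in> int_span I v"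
  by (auto simp: int_span_def)

lemma int_span_closed:
  shows "0 \<in> int_span I v" "x \<in> int_span I v \<Longrightarrow> y \<in> int_span I v \<Longrightarrow> x + y \<in> int_span I v"
    "a \<in> \<int> \<Longrightarrow> x \<in> int_span I v \<Longrightarrow> a * x \<in> int_span I v"
proof -
  show "0 \<in> int_span I v" using int_spanI[of "\<lambda>_. 0" v I] by simp
next
  assume "x \<in> int_span I v" "y \<in> int_span I v"
  then obtain b c where b: "x = (\<Sum>j\<in>I. b j * v j)" "\<And>j. b j \<in> \<int>"
    and c: "y = (\<Sum>j\<in>I. c j * v j)" "\<And>j. c j \<in> \<int>" unfolding int_span_def by blast
  then have "x + y = (\<Sum>j\<in>I. (b j + c j) * v j)" by (simp add: distrib_right sum.distrib)
  then show "x + y \<in> int_span I v" using int_spanI[of "\<lambda>j. b j + c j" v I] b(2) c(2) by simp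
next
  assume a: "a \<in> \<int>" and "x \<in> int_span I v"
  then obtain b where b: "x = (\<Sum>j\<in>I. b j * v j)" "\<And>j. b j \<in> \<int>" unfolding int_span_def by blast
  then have "a * x = (\<Sum>j\<in>I. (a * b j) * v j)" by (simp add: sum_distrib_left mult.assoc)
  then show "a * x \<in> int_span I v" using int_spanI[of "\<lambda>j. a * b j" v I] b(2) a by simp
qed

lemma int_span_sum: "(\<And>k. k \<in> K \<Longrightarrow> f k \<in> int_span I v) \<Longrightarrow> sum f K \<in> int_span I v"
  by (induction K rule: infinite_finite_induct) (auto simp: int_span_closed)

lemma int_span_base:
  assumes "finite I" "i \<in> I"
  shows "v i \<in> int_span I v"
proof -
  have "(\<Sum>j\<in>I. (if j = i then 1 else 0) * v j) = v i"
    using assms by (simp add: if_distrib[of "\<lambda>x. x * _"] sum.delta cong: if_cong)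
  then show ?thesis using int_spanI[of "\<lambda>j. if j = i then 1 else 0" v I] by simp
qed

lemma int_span_mult:
  assumes "\<And>i. i \<in> I \<Longrightarrow> z * v i \<in> int_span I v" "w \<in> int_span I v"
  shows "z * w \<in> int_span I v"
proof -
  obtain c where c: "w = (\<Sum>j\<in>I. c j * v j)" "\<And>j. c j \<in> \<int>"
    using assms(2) unfolding int_span_def by blast
  have "z * w = (\<Sum>j\<in>I. c j * (z * v j))" unfolding c sum_distrib_left by (simp add: mult_ac)
  also have "\<dots> \<in> int_span I v" by (intro int_span_sum int_span_closed(3) c(2) assms(1))
  finally show ?thesis .
qed

text \<open>Multiplication by \<open>z\<close> on the generators is given by an integer matrix.
  Subtracting it from \<open>z\<close> times the identity gives a system with monic linear diagonal
  and constant other entries that annihilates the vector of generators.\<close>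

lemma algebraic_int_of_int_span:
  assumes I: "finite I" and z: "\<And>i. i \<in> I \<Longrightarrow> z * v i \<in> int_span I v" and nz: "\<exists>i\<in>I. v i \<noteq> 0"
  shows "algebraic_int z"
proof -
  obtain f n where f: "bij_betw f {..<n::nat} I"
    using ex_bij_betw_nat_finite[OF I] by (auto simp: atLeast0LessThan)
  have "\<forall>i\<in>I. \<exists>c. (\<forall>j. c j \<in> \<int>) \<and> z * v i = (\<Sum>j\<in>I. c j * v j)"
    using z unfolding int_span_def by blast
  then obtain c where c: "\<And>i j. i \<in> I \<Longrightarrow> c i j \<in> \<int>" "\<And>i. i \<in> I \<Longrightarrow> z * v i = (\<Sum>j\<in>I. c i j * v j)"
    by metis
  have fI: "f i \<in> I" if "i < n" for i using f that by (auto simp: bij_betw_def)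
  define p where "p = (\<lambda>i j. (if i = j then [:0, 1:] else 0) - [:c (f i) (f j):])"
  show ?thesis
  proof (rule algebraic_int_of_monic_system[of n p "\<lambda>_. 1" z "\<lambda>i. v (f i)"])
    fix i j assume ij: "i < n" "j < n"
    show "p i j \<in> polys_over \<int>"
      using c(1)[OF fI[OF ij(1)]] by (auto simp: p_def polys_over_def coeff_pCons split: nat.splits)
    show "p i j = 0 \<or> degree (p i j) < 1" if "i \<noteq> j" using that by (simp add: p_def)
  next
    fix i assume "i < n"
    show "degree (p i i) = 1 \<and> lead_coeff (p i i) = 1" by (simp add: p_def)
  next
    fix i assume i: "i < n"
    have "(\<Sum>j<n. poly (p i j) z * v (f j)) =
        (\<Sum>j<n. (if i = j then z * v (f j) else 0)) - (\<Sum>j<n. c (f i) (f j) * v (f j))"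
      unfolding sum_subtractf[symmetric] by (rule sum.cong) (auto simp: p_def algebra_simps)
    also have "(\<Sum>j<n. c (f i) (f j) * v (f j)) = (\<Sum>j\<in>I. c (f i) j * v j)"
      by (rule sum.reindex_bij_betw[OF f])
    finally show "(\<Sum>j<n. poly (p i j) z * v (f j)) = 0" using i c(2)[OF fI[OF i]] by (simp add: sum.delta')
  next
    show "\<exists>i<n. v (f i) \<noteq> 0" using nz f by (auto simp: bij_betw_def)
  qed
qed

lemma monic_power_in_int_span:
  fixes x :: complex
  assumes "algebraic_int x"
  obtains m where "m > 0" "x ^ m \<in> int_span {..<m} (\<lambda>i. x ^ i)"
proof -
  obtain p where p: "lead_coeff p = 1" "\<And>i. coeff p i \<in> \<int>" "poly p x = 0"
    using assms by (auto elim: algebraic_int.cases)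
  define m where "m = degree p"
  have "m > 0" using p by (intro Nat.gr0I) (auto simp: m_def elim!: degree_eq_zeroE)
  have "(\<Sum>i<m. coeff p i * x ^ i) + x ^ m = 0"
    using p(1,3) by (simp add: poly_altdef m_def lessThan_Suc_atMost[symmetric])
  then have "x ^ m = (\<Sum>i<m. (- coeff p i) * x ^ i)"
    by (simp add: sum_negf add_eq_0_iff2)
  then show ?thesis using that[OF \<open>m > 0\<close>] p(2) int_spanI[of "\<lambda>i. - coeff p i" "\<lambda>i. x ^ i" "{..<m}"]
    by simp
qed

lemma int_span_pairs:
  assumes "w \<in> int_span I f" "finite I" "finite J" "j \<in> J"
  shows "w * g j \<in> int_span (I \<times> J) (\<lambda>(i, j). f i * g j)"
proof -
  obtain c where c: "w = (\<Sum>i\<in>I. c i * f i)" "\<And>i. c i \<in> \<int>"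
    using assms(1) unfolding int_span_def by blast
  have "w * g j = (\<Sum>i\<in>I. c i * (f i * g j))" unfolding c sum_distrib_right by (simp add: mult_ac)
  moreover have "f i * g j \<in> int_span (I \<times> J) (\<lambda>(i, j). f i * g j)" if "i \<in> I" for i
    using int_span_base[of "I \<times> J" "(i, j)" "\<lambda>(i, j). f i * g j"] that assms by simp
  moreover have "(\<Sum>i\<in>I. c i * (f i * g j)) \<in> int_span (I \<times> J) (\<lambda>(i, j). f i * g j)"
    by (intro int_span_sum int_span_closed(3) c(2) calculation(2))
  ultimately show ?thesis by simp
qed

text \<open>Allows \<open>int_span_pairs\<close> to be applied with the roles of the two factors
  exchanged.\<close>

lemma int_span_swap: "int_span (I \<times> J) (\<lambda>(i, j). f i * g j) = int_span (J \<times> I) (\<lambda>(j, i). g j * f i)"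
proof -
  have sub: "int_span (I \<times> J) (\<lambda>(i, j). f i * g j) \<subseteq> int_span (J \<times> I) (\<lambda>(j, i). g j * f i)"
    for I :: "'x set" and J :: "'y set" and f g
  proof
    fix w assume "w \<in> int_span (I \<times> J) (\<lambda>(i, j). f i * g j)"
    then obtain c where c: "w = (\<Sum>x\<in>I \<times> J. c x * (case x of (i, j) \<Rightarrow> f i * g j))" "\<And>j. c j \<in> \<int>"
      unfolding int_span_def by blast
    have "w = (\<Sum>x\<in>J \<times> I. c (prod.swap x) * (case x of (j, i) \<Rightarrow> g j * f i))"
      unfolding c(1) by (rule sum.reindex_bij_witness[of _ prod.swap prod.swap]) (auto simp: mult_ac)
    then show "w \<in> int_span (J \<times> I) (\<lambda>(j, i). g j * f i)"
      using int_spanI[of "\<lambda>x. c (prod.swap x)" "\<lambda>(j, i). g j * f i" "J \<times> I"] c(2) by simp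
  qed
  show ?thesis by (intro equalityI sub)
qed

text \<open>The products \<open>x ^ i * y ^ j\<close> with \<open>i < m\<close> and
  \<open>j < n\<close> span an additive group that multiplication by \<open>x\<close> and by
  \<open>y\<close> maps into itself.\<close>

lemma algebraic_int_add_mult:
  fixes x y :: complex
  assumes "algebraic_int x" "algebraic_int y"
  shows "algebraic_int (x + y)" "algebraic_int (x * y)"
proof -
  obtain m where m: "m > 0" "x ^ m \<in> int_span {..<m} (\<lambda>i. x ^ i)"
    using monic_power_in_int_span[OF assms(1)] .
  obtain n where n: "n > 0" "y ^ n \<in> int_span {..<n} (\<lambda>i. y ^ i)"
    using monic_power_in_int_span[OF assms(2)] .
  define I where "I = {..<m} \<times> {..<n}"
  define v where "v = (\<lambda>(i, j). x ^ i * y ^ j)"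
  have fin: "finite I" by (simp add: I_def)
  have pow: "x ^ Suc i \<in> int_span {..<m} (\<lambda>i. x ^ i)" if "i < m" for i
    using that m int_span_base[of "{..<m}" "Suc i" "\<lambda>i. x ^ i"] by (cases "Suc i = m") auto
  have pow': "y ^ Suc i \<in> int_span {..<n} (\<lambda>i. y ^ i)" if "i < n" for i
    using that n int_span_base[of "{..<n}" "Suc i" "\<lambda>i. y ^ i"] by (cases "Suc i = n") auto
  have X: "x * v k \<in> int_span I v" if kI: "k \<in> I" for k
  proof -
    obtain i j where k: "k = (i, j)" "i < m" "j < n" using kI by (auto simp: I_def)
    show ?thesis using int_span_pairs[OF pow[OF k(2)], of "{..<n}" j "\<lambda>j. y ^ j"] k
      by (simp add: v_def I_def mult_ac)
  qed
  have Y: "y * v k \<in> int_span I v" if kI: "k \<in> I" for k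
  proof -
    obtain i j where k: "k = (i, j)" "i < m" "j < n" using kI by (auto simp: I_def)
    show ?thesis
      using int_span_pairs[OF pow'[OF k(3)], of "{..<m}" i "\<lambda>j. x ^ j"] k
      unfolding int_span_swap[of "{..<n}" "{..<m}" "\<lambda>i. y ^ i" "\<lambda>j. x ^ j"]
      by (simp add: v_def I_def mult_ac)
  qed
  have "(0, 0) \<in> I" "v (0, 0) = 1" using m n by (auto simp: I_def v_def)
  then have nz: "\<exists>i\<in>I. v i \<noteq> 0" by (metis one_neq_zero)
  show "algebraic_int (x + y)"
    by (rule algebraic_int_of_int_span[OF fin _ nz]) (simp add: distrib_right int_span_closed X Y)
  show "algebraic_int (x * y)"
  proof (rule algebraic_int_of_int_span[OF fin _ nz])
    fix i assume "i \<in> I"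
    then show "x * y * v i \<in> int_span I v" using int_span_mult[OF X Y] by (simp add: mult.assoc)
  qed
qed

lemma subring_algebraic_ints: "subring {x. algebraic_int x} CC"
  by (auto simp: subring_CC_iff algebraic_int_add_mult(2)
      intro: algebraic_int_add_mult(1)[of _ "- _", simplified])

text \<open>\<open>w\<close> is a root of the monic polynomial \<open>X^j - X^i - a\<close> (for
  \<open>i < j\<close>) whose constant coefficient involves an algebraic integer \<open>a\<close>.
  This gives integrality of an element once two of its powers, multiplied by \<open>p\<close>, are
  congruent modulo \<open>p\<close>.\<close>

lemma algebraic_int_if_powers_congruent:
  fixes w :: complex
  assumes "algebraic_int (w ^ i - w ^ j)" "i \<noteq> j"
  shows "algebraic_int w"
proof -
  have *: "algebraic_int w" if "i < j" "algebraic_int (w ^ j - w ^ i)" for i j :: nat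
  proof (rule algebraic_int_root[OF that(2)])
    let ?p = "Polynomial.monom 1 j - Polynomial.monom 1 i :: complex poly"
    show "poly ?p w = w ^ j - w ^ i" by (simp add: poly_monom)
    show "\<forall>k. coeff ?p k \<in> \<int>" by auto
    have "degree (- Polynomial.monom (1::complex) i) < degree (Polynomial.monom (1::complex) j)"
      using that by (simp add: degree_monom_eq)
    from degree_add_eq_left[OF this] lead_coeff_add_le[OF this]
    show "degree ?p > 0" "lead_coeff ?p = 1" using that by (auto simp: degree_monom_eq)
  qed
  show ?thesis
    using assms *[of i j] *[of j i] algebraic_int_minus[OF assms(1)] by (cases i j rule: linorder_cases) auto
qed

lemma emb_algebraic_int:
  assumes h: "field_emb S h" and S: "subring S CC" and x: "x \<in> S" "algebraic_int x"
  shows "algebraic_int (h x)"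
proof -
  obtain p where p: "lead_coeff p = 1" "\<And>i. coeff p i \<in> \<int>" "poly p x = 0"
    using x(2) by (auto elim: algebraic_int.cases)
  have "h (coeff p i) = coeff p i" for i
    using p(2)[of i] by (auto elim!: Ints_cases simp: field_emb_simps[OF h S])
  then have "map_poly h p = p" by (intro poly_eqI) (simp add: coeff_map_poly field_emb_simps[OF h S])
  moreover have "p \<in> polys_over S"
    using p(2) Ints_subset_subring[OF S] by (auto simp: polys_over_def)
  ultimately have "poly p (h x) = 0"
    using emb_poly[OF h S, of p x] x(1) p(3) field_emb_simps(1)[OF h S] by simp
  then show ?thesis using p by (intro algebraic_int.intros[of p]) auto
qed

section \<open>Reduction modulo a rational prime\<close>

definition ints_of :: "complex set \<Rightarrow> complex set"
  where "ints_of F = {x \<in> F. algebraic_int x}"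

lemma ints_of_mono: "E \<subseteq> F \<Longrightarrow> ints_of E \<subseteq> ints_of F"
  by (auto simp: ints_of_def)

lemma subring_ints_of: "subring F CC \<Longrightarrow> subring (ints_of F) CC"
  using subring_algebraic_ints by (auto simp: subring_CC_iff ints_of_def)

lemmas algebraic_int_closed = subring_CC_closed[OF subring_algebraic_ints, simplified]

section \<open>Independence modulo a prime and finiteness of the residue ring\<close>

lemma vector_space_rat: "vector_space (\<lambda>(q::rat) (z::complex). of_rat q * z)"
  by unfold_locales (auto simp: algebra_simps of_rat_add of_rat_mult)

lemma common_denominator:
  assumes "finite B"
  shows "\<exists>D>0. \<exists>c. \<forall>b\<in>B. of_int D * (u b :: rat) = of_int (c b)"
  using assms
proof (induction B)
  case (insert b B)
  then obtain D c where D: "D > 0" "\<And>b. b \<in> B \<Longrightarrow> of_int D * u b = of_int (c b)" by blast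
  obtain n d where nd: "u b = of_int n / of_int d" "d > 0" by (cases "u b" rule: Rat_cases) (auto simp: Fract_of_int_quotient)
  show ?case
  proof (intro exI[of _ "D * d"] conjI exI[of _ "\<lambda>a. if a = b then D * n else d * c a"] ballI)
    show "D * d > 0" using D nd by simp
    fix a assume "a \<in> insert b B"
    then show "of_int (D * d) * u a = of_int (if a = b then D * n else d * c a)"
      using D(2)[of a] nd by (auto simp: mult.assoc mult.left_commute)
  qed
qed (auto intro: exI[of _ 1])

text \<open>Linear independence over \<open>\<int>/p\<close> of the classes of \<open>B\<close>
  modulo \<open>p\<close>. Divisibility by \<open>p\<close> is tested among all algebraic integers,
  so no field enters.\<close>

definition indep_mod :: "nat \<Rightarrow> complex set \<Rightarrow> bool"
  where "indep_mod p B \<longleftrightarrow> finite B \<and> (\<forall>b\<in>B. algebraic_int b) \<and>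
    (\<forall>c. algebraic_int ((\<Sum>b\<in>B. of_int (c b) * b) / of_nat p) \<longrightarrow> (\<forall>b\<in>B. int p dvd c b))"

text \<open>Denominators in a rational relation can be cleared. In the integral relation all
  coefficients are divisible by \<open>p\<close>; dividing by \<open>p\<close> and repeating makes
  them divisible by every power of \<open>p\<close>.\<close>

lemma indep_mod_imp_rat_independent:
  assumes p: "p > 1" and B: "indep_mod p B"
  shows "\<not> module.dependent (\<lambda>(q::rat) (z::complex). of_rat q * z) B"
proof
  interpret V: vector_space "\<lambda>(q::rat) (z::complex). of_rat q * z" by (rule vector_space_rat)
  have fin: "finite B" using B by (simp add: indep_mod_def)
  assume "V.dependent B"
  then obtain u v where u: "v \<in> B" "u v \<noteq> 0" "(\<Sum>b\<in>B. of_rat (u b) * b) = 0"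
    by (auto simp: V.dependent_finite[OF fin])
  obtain D c where D: "D > 0" "\<And>b. b \<in> B \<Longrightarrow> of_int D * u b = of_int (c b)"
    using common_denominator[OF fin, of u] by blast
  have c0: "(\<Sum>b\<in>B. of_int (c b) * b) = (0 :: complex)"
  proof -
    have "of_int (c b) = (of_int D * of_rat (u b) :: complex)" if "b \<in> B" for b
      using arg_cong[OF D(2)[OF that], of "of_rat :: rat \<Rightarrow> complex"] by (simp add: of_rat_mult)
    then have "(\<Sum>b\<in>B. of_int (c b) * b) = of_int D * (\<Sum>b\<in>B. of_rat (u b) * b)"
      by (simp add: sum_distrib_left mult.assoc)
    then show ?thesis using u by simp
  qed
  have "\<forall>c. (\<Sum>b\<in>B. of_int (c b) * b) = (0 :: complex) \<longrightarrow> (\<forall>b\<in>B. int p ^ N dvd c b)" for N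
  proof (induction N)
    case (Suc N)
    show ?case
    proof (intro allI impI)
      fix c :: "complex \<Rightarrow> int" assume 0: "(\<Sum>b\<in>B. of_int (c b) * b) = 0"
      then have dv: "\<forall>b\<in>B. int p dvd c b" using B by (simp add: indep_mod_def)
      define c' where "c' = (\<lambda>b. c b div int p)"
      have c: "c b = int p * c' b" if "b \<in> B" for b using dv that by (simp add: c'_def)
      have "of_nat p * (\<Sum>b\<in>B. of_int (c' b) * b) = (\<Sum>b\<in>B. of_int (c b) * b)"
        unfolding sum_distrib_left by (intro sum.cong) (auto simp: c mult.assoc)
      then have "(\<Sum>b\<in>B. of_int (c' b) * b) = 0" using 0 p by simp
      then show "\<forall>b\<in>B. int p ^ Suc N dvd c b" using Suc.IH c by simp
    qed
  qed simp
  then have dv: "int p ^ N dvd c v" for N using c0 u(1) by blast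
  have "c v \<noteq> 0" using D(2)[OF u(1)] D(1) u(2) by auto
  define N where "N = nat \<bar>c v\<bar>"
  have "int (p ^ N) \<le> int N"
    using dvd_imp_le_int[OF \<open>c v \<noteq> 0\<close> dv[of N]] by (simp add: N_def)
  moreover have "N < p ^ N" using p by (simp add: power_gt_expt)
  ultimately show False by simp
qed

text \<open>Translates the inductive \<open>dimension\<close> into a span in the sense of
  \<open>vector_space\<close>, whose exchange lemma bounds the size of independent sets.\<close>

lemma number_field_finite_span:
  assumes "number_field F"
  obtains T where "finite T" "F \<subseteq> module.span (\<lambda>(q::rat) (z::complex). of_rat q * z) T"
proof -
  interpret R: ring CC by (rule ring_CC)
  interpret V: vector_space "\<lambda>(q::rat) (z::complex). of_rat q * z" by (rule vector_space_rat)
  have "\<exists>T. finite T \<and> E \<subseteq> V.span T" if "R.dimension n K E" "K = \<rat>" for n K E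
    using that
  proof (induction rule: R.dimension.induct)
    case (zero_dim K)
    then show ?case using V.span_zero[of "{}"] by (intro exI[of _ "{}"]) auto
  next
    case (Suc_dim v E n K)
    then obtain T where T: "finite T" "E \<subseteq> V.span T" by blast
    have "R.line_extension K v E \<subseteq> V.span (insert v T)"
    proof
      fix x assume "x \<in> R.line_extension K v E"
      then obtain k u where x: "k \<in> \<rat>" "u \<in> E" "x = k * v + u"
        using Suc_dim.prems by (auto simp: R.line_extension_mem_iff)
      obtain q where q: "k = of_rat q" using x(1) by (auto elim: Rats_cases)
      have "u \<in> V.span (insert v T)" using T(2) x(2) V.span_mono[of T "insert v T"] by blast
      moreover have "of_rat q * v \<in> V.span (insert v T)" by (intro V.span_scale V.span_base) simp
      ultimately show "x \<in> V.span (insert v T)" unfolding x(3) q by (rule V.span_add[rotated])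
    qed
    then show ?case using T(1) by (intro exI[of _ "insert v T"]) simp
  qed
  moreover obtain n where "R.dimension n \<rat> F"
    using assms unfolding number_field_def R.finite_dimension_def by blast
  ultimately show ?thesis using that by blast
qed

text \<open>A set of integers of \<open>F\<close> independent modulo \<open>p\<close> is independent
  over \<rat>, so its size is bounded. A largest such set is a basis modulo \<open>p\<close>, and
  its combinations with coefficients below \<open>p\<close> represent all residues.\<close>

theorem finite_residues:
  assumes F: "number_field F" and p: "Factorial_Ring.prime p"
  obtains T where "finite T" "T \<subseteq> ints_of F"
    "\<And>x. x \<in> ints_of F \<Longrightarrow> \<exists>t\<in>T. algebraic_int ((x - t) / of_nat p)"
proof -
  interpret V: vector_space "\<lambda>(q::rat) (z::complex). of_rat q * z" by (rule vector_space_rat)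
  have p1: "p > 1" using p by (rule prime_gt_1_nat)
  have S: "subring (ints_of F) CC"
    using F by (intro subring_ints_of subfield_CC_subring) (simp add: number_field_def)
  obtain T where T: "finite T" "F \<subseteq> V.span T" using number_field_finite_span[OF F] .
  define P where "P = (\<lambda>B. B \<subseteq> ints_of F \<and> indep_mod p B)"
  have bound: "card B \<le> card T" if "P B" for B
    using V.independent_span_bound[OF T(1), of B] indep_mod_imp_rat_independent[OF p1, of B] that T(2)
    by (auto simp: P_def ints_of_def)
  have "P {}" by (simp add: P_def indep_mod_def)
  have "\<exists>B. P B \<and> (\<forall>B'. P B' \<longrightarrow> card B' \<le> card B)"
    by (rule ex_has_greatest_nat[of P "{}" card "Suc (card T)"])
      (use \<open>P {}\<close> bound in \<open>auto intro: le_SucI simp: less_Suc_eq_le\<close>)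
  then obtain B where PB: "P B" and max: "\<And>B'. P B' \<Longrightarrow> card B' \<le> card B"
    by blast
  have fin: "finite B" and BO: "B \<subseteq> ints_of F" and indep: "indep_mod p B"
    using PB by (auto simp: P_def indep_mod_def)
  \<comment> \<open>\<open>B\<close> is added for the case \<open>x \<in> B\<close>, in which
    \<open>insert x B\<close> is not larger than \<open>B\<close> and maximality yields
    nothing.\<close>
  define R where "R = (\<lambda>c. \<Sum>b\<in>B. of_int (c b) * b) ` (B \<rightarrow>\<^sub>E {0..<int p}) \<union> B"
  show ?thesis
  proof (rule that[of R])
    show "finite R" unfolding R_def using fin by (intro finite_UnI finite_imageI finite_PiE) auto
    show "R \<subseteq> ints_of F" unfolding R_def using BO
      by (auto intro!: subring_CC_sum[OF S] subring_CC_closed(5)[OF S] subring_CC_closed(9)[OF S])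
    fix x assume x: "x \<in> ints_of F"
    show "\<exists>t\<in>R. algebraic_int ((x - t) / of_nat p)"
    proof (cases "x \<in> B")
      case True
      then show ?thesis by (intro bexI[of _ x]) (auto simp: R_def)
    next
      case False
      have "\<not> indep_mod p (insert x B)"
      proof
        assume "indep_mod p (insert x B)"
        then have "P (insert x B)" using x BO by (simp add: P_def)
        from max[OF this] False fin show False by simp
      qed
      then obtain c a where c: "algebraic_int ((\<Sum>b\<in>insert x B. of_int (c b) * b) / of_nat p)"
          and a: "a \<in> insert x B" "\<not> int p dvd c a"
        using fin x BO unfolding indep_mod_def ints_of_def by blast
      have sum: "(\<Sum>b\<in>insert x B. of_int (c b) * b) = of_int (c x) * x + (\<Sum>b\<in>B. of_int (c b) * b)"
        using fin False by simp
      have xi: "algebraic_int x" using x by (simp add: ints_of_def)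
      \<comment> \<open>Otherwise the term in \<open>x\<close> could be dropped, and the relation
        would contradict the independence of \<open>B\<close>.\<close>
      have ndv: "\<not> int p dvd c x"
      proof
        assume "int p dvd c x"
        then obtain k where k: "c x = int p * k" by blast
        have "(\<Sum>b\<in>B. of_int (c b) * b) / of_nat p =
            (\<Sum>b\<in>insert x B. of_int (c b) * b) / of_nat p - of_int k * x"
          unfolding sum k using p1 by (simp add: field_simps)
        then have "algebraic_int ((\<Sum>b\<in>B. of_int (c b) * b) / of_nat p)"
          using algebraic_int_closed(4)[OF c algebraic_int_closed(5)[OF algebraic_int_of_int xi]] by simp
        then have "\<forall>b\<in>B. int p dvd c b" using indep by (simp add: indep_mod_def)
        then show False using a \<open>int p dvd c x\<close> by auto
      qed
      have "Rings.coprime (int p) (c x)"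
        using p ndv by (intro prime_imp_coprime) auto
      then have "\<exists>e. [c x * e = 1] (mod int p)" by (intro cong_solve_coprime_int) (simp add: coprime_commute)
      then obtain e k where ek: "c x * e - 1 = int p * k" by (auto simp: cong_iff_dvd_diff)
      \<comment> \<open>The relation is solved for \<open>x\<close> modulo \<open>p\<close>:
        multiply by the inverse \<open>e\<close> of \<open>c x\<close> and reduce the coefficients
        to the range of representatives.\<close>
      define c' where "c' = (\<lambda>b\<in>B. (- e * c b) mod int p)"
      define t where "t = (\<Sum>b\<in>B. of_int (c' b) * b)"
      have "t \<in> R" unfolding R_def t_def c'_def using p1 by (intro UnI1 imageI) auto
      moreover have "algebraic_int ((x - t) / of_nat p)"
      proof -
        define m where "m = (\<lambda>b. (- e * c b) div int p)"
        have t: "t = (\<Sum>b\<in>B. of_int (- e * c b - int p * m b) * b)"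
          unfolding t_def by (intro sum.cong) (auto simp: c'_def m_def minus_mult_div_eq_mod)
        have t2: "t = - of_int e * (\<Sum>b\<in>B. of_int (c b) * b) - of_nat p * (\<Sum>b\<in>B. of_int (m b) * b)"
          unfolding t by (simp add: sum_subtractf algebra_simps sum_distrib_left sum_negf)
        have 1: "x = of_int (c x * e - int p * k) * x" using ek by (simp add: algebra_simps)
        have x2: "x = of_int e * (of_int (c x) * x) - of_nat p * (of_int k * x)"
          by (subst 1) (simp add: algebra_simps)
        have "(x - t) / of_nat p = of_int e * ((\<Sum>b\<in>insert x B. of_int (c b) * b) / of_nat p)
            - of_int k * x + (\<Sum>b\<in>B. of_int (m b) * b)"
          unfolding sum t2 by (subst x2) (use p1 in \<open>simp add: field_simps\<close>)
        moreover have "algebraic_int (\<Sum>b\<in>B. of_int (m b) * b)"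
          using subring_CC_sum[OF subring_algebraic_ints, of B "\<lambda>b. of_int (m b) * b"] BO
          by (auto simp: ints_of_def intro!: algebraic_int_closed(5))
        moreover have "algebraic_int (of_int e * ((\<Sum>b\<in>insert x B. of_int (c b) * b) / of_nat p) - of_int k * x)"
          by (rule algebraic_int_closed(4)[OF algebraic_int_closed(5)[OF algebraic_int_of_int c]
                algebraic_int_closed(5)[OF algebraic_int_of_int xi]])
        ultimately show ?thesis using algebraic_int_closed(3) by metis
      qed
      ultimately show ?thesis by blast
    qed
  qed
qed

text \<open>Pigeonhole in the finite set of residues. The sequence is arbitrary because it is
  applied to powers as well as to \<open>p\<close> times powers of a non-integral element.\<close>

lemma powers_congruent:
  assumes F: "number_field F" and p: "Factorial_Ring.prime p" and f: "\<And>n. f n \<in> ints_of F"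
  obtains i j :: nat where "i < j" "algebraic_int ((f i - f j) / of_nat p)"
proof -
  obtain T where T: "finite T" "\<And>x. x \<in> ints_of F \<Longrightarrow> \<exists>t\<in>T. algebraic_int ((x - t) / of_nat p)"
    using finite_residues[OF F p] by metis
  then obtain k where k: "\<And>n. k n \<in> T" "\<And>n. algebraic_int ((f n - k n) / of_nat p)"
    using T(2)[OF f] by metis
  have "\<not> inj k" using k(1) T(1)
    by (metis finite_subset finite_imageD image_subsetI infinite_UNIV_nat)
  then obtain i j where ij: "i < j" "k i = k j" by (metis injI linorder_neqE_nat)
  have "(f i - f j) / of_nat p = (f i - k i) / of_nat p - (f j - k j) / of_nat p"
    using ij by (simp add: diff_divide_distrib)
  then have "algebraic_int ((f i - f j) / of_nat p)" using algebraic_int_closed(4)[OF k(2) k(2)] by metis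
  with ij show ?thesis using that by blast
qed

section \<open>Ramification\<close>

lemma ring_of_integers_eq: "ring_of_integers F = sub_CC (ints_of F)"
  by (simp add: ring_of_integers_def ints_of_def)

lemma domain_sub_CC: "subring S CC \<Longrightarrow> domain (sub_CC S)"
  using domain.subring_is_domain[OF domain_CC] .

lemma a_inv_sub_CC:
  assumes S: "subring S CC" and x: "x \<in> S"
  shows "\<ominus>\<^bsub>sub_CC S\<^esub> x = - x"
proof -
  interpret domain "sub_CC S" by (rule domain_sub_CC[OF S])
  show ?thesis by (rule minus_equality) (use x subring_CC_closed(6)[OF S] in auto)
qed

lemma ideal_sub_CC_iff:
  assumes S: "subring S CC"
  shows "ideal I (sub_CC S) \<longleftrightarrow> I \<subseteq> S \<and> 0 \<in> I \<and> (\<forall>x\<in>I. \<forall>y\<in>I. x + y \<in> I) \<and> (\<forall>a\<in>S. \<forall>x\<in>I. a * x \<in> I)"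
proof -
  interpret domain "sub_CC S" by (rule domain_sub_CC[OF S])
  show ?thesis
  proof
    assume "ideal I (sub_CC S)"
    then interpret I: ideal I "sub_CC S" .
    show "I \<subseteq> S \<and> 0 \<in> I \<and> (\<forall>x\<in>I. \<forall>y\<in>I. x + y \<in> I) \<and> (\<forall>a\<in>S. \<forall>x\<in>I. a * x \<in> I)"
    proof (intro conjI ballI)
      fix x y assume "x \<in> I" "y \<in> I"
      then show "x + y \<in> I" using I.a_closed[of x y] by simp
    next
      fix a x assume "a \<in> S" "x \<in> I"
      then show "a * x \<in> I" using I.I_l_closed[of x a] by simp
    qed (use I.a_subset I.zero_closed in simp_all)
  next
    assume *: "I \<subseteq> S \<and> 0 \<in> I \<and> (\<forall>x\<in>I. \<forall>y\<in>I. x + y \<in> I) \<and> (\<forall>a\<in>S. \<forall>x\<in>I. a * x \<in> I)"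
    have neg: "- x \<in> I" if "x \<in> I" for x
    proof -
      have "- 1 \<in> S" by (intro subring_CC_closed(2,6)[OF S])
      then have "- 1 * x \<in> I" using * that by blast
      then show ?thesis by simp
    qed
    show "ideal I (sub_CC S)"
    proof (rule idealI)
      show "subgroup I (add_monoid (sub_CC S))"
      proof (rule group.subgroupI[OF a_group])
        fix a assume "a \<in> I"
        then have "a \<in> S" using * by blast
        then show "inv\<^bsub>add_monoid (sub_CC S)\<^esub> a \<in> I"
          using a_inv_sub_CC[OF S \<open>a \<in> S\<close>] neg[OF \<open>a \<in> I\<close>] unfolding a_inv_def by simp
      qed (use * in auto)
      fix a x assume "a \<in> I" "x \<in> carrier (sub_CC S)"
      then show "x \<otimes>\<^bsub>sub_CC S\<^esub> a \<in> I" "a \<otimes>\<^bsub>sub_CC S\<^esub> x \<in> I" using * by (auto simp: mult.commute)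
    qed (rule ring_axioms)
  qed
qed

lemma primeideal_sub_CC_iff:
  assumes S: "subring S CC"
  shows "primeideal I (sub_CC S) \<longleftrightarrow> ideal I (sub_CC S) \<and> 1 \<notin> I \<and>
    (\<forall>a\<in>S. \<forall>b\<in>S. a * b \<in> I \<longrightarrow> a \<in> I \<or> b \<in> I)"
proof -
  interpret domain "sub_CC S" by (rule domain_sub_CC[OF S])
  show ?thesis
  proof
    assume "primeideal I (sub_CC S)"
    then interpret I: primeideal I "sub_CC S" .
    show "ideal I (sub_CC S) \<and> 1 \<notin> I \<and> (\<forall>a\<in>S. \<forall>b\<in>S. a * b \<in> I \<longrightarrow> a \<in> I \<or> b \<in> I)"
      using I.ideal_axioms I.one_imp_carrier I.I_notcarr I.I_prime by auto
  next
    assume *: "ideal I (sub_CC S) \<and> 1 \<notin> I \<and> (\<forall>a\<in>S. \<forall>b\<in>S. a * b \<in> I \<longrightarrow> a \<in> I \<or> b \<in> I)"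
    show "primeideal I (sub_CC S)"
      by (rule primeidealI) (use * is_cring subring_CC_closed(2)[OF S] in auto)
  qed
qed

lemma finite_places_iff:
  assumes F: "subfield F CC"
  shows "Q \<in> finite_places F \<longleftrightarrow> Q \<subseteq> ints_of F \<and> 0 \<in> Q \<and> (\<forall>x\<in>Q. \<forall>y\<in>Q. x + y \<in> Q) \<and>
    (\<forall>a\<in>ints_of F. \<forall>x\<in>Q. a * x \<in> Q) \<and> 1 \<notin> Q \<and>
    (\<forall>a\<in>ints_of F. \<forall>b\<in>ints_of F. a * b \<in> Q \<longrightarrow> a \<in> Q \<or> b \<in> Q) \<and> Q \<noteq> {0}"
proof -
  have S: "subring (ints_of F) CC" using subring_ints_of[OF subfield_CC_subring[OF F]] .
  show ?thesis
    unfolding finite_places_def ring_of_integers_eq primeideal_sub_CC_iff[OF S] ideal_sub_CC_iff[OF S] mem_Collect_eq conj_assoc ..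
qed

lemma finite_placeD:
  assumes F: "subfield F CC" and Q: "Q \<in> finite_places F"
  shows "x \<in> Q \<Longrightarrow> x \<in> ints_of F" "0 \<in> Q" "x \<in> Q \<Longrightarrow> y \<in> Q \<Longrightarrow> x + y \<in> Q"
    "a \<in> ints_of F \<Longrightarrow> x \<in> Q \<Longrightarrow> a * x \<in> Q" "1 \<notin> Q"
    "a \<in> ints_of F \<Longrightarrow> b \<in> ints_of F \<Longrightarrow> a * b \<in> Q \<Longrightarrow> a \<in> Q \<or> b \<in> Q" "Q \<noteq> {0}"
    "x \<in> Q \<Longrightarrow> - x \<in> Q" "x \<in> Q \<Longrightarrow> y \<in> Q \<Longrightarrow> x - y \<in> Q"
proof -
  have *: "Q \<subseteq> ints_of F" "0 \<in> Q" "\<forall>x\<in>Q. \<forall>y\<in>Q. x + y \<in> Q" "\<forall>a\<in>ints_of F. \<forall>x\<in>Q. a * x \<in> Q" "1 \<notin> Q"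
    "\<forall>a\<in>ints_of F. \<forall>b\<in>ints_of F. a * b \<in> Q \<longrightarrow> a \<in> Q \<or> b \<in> Q" "Q \<noteq> {0}"
    using Q unfolding finite_places_iff[OF F] by - (elim conjE, assumption)+
  show a: "x \<in> Q \<Longrightarrow> y \<in> Q \<Longrightarrow> x + y \<in> Q" "a \<in> ints_of F \<Longrightarrow> x \<in> Q \<Longrightarrow> a * x \<in> Q"
    "x \<in> Q \<Longrightarrow> x \<in> ints_of F" "0 \<in> Q" "1 \<notin> Q" "Q \<noteq> {0}"
    "a \<in> ints_of F \<Longrightarrow> b \<in> ints_of F \<Longrightarrow> a * b \<in> Q \<Longrightarrow> a \<in> Q \<or> b \<in> Q" for x y a b
    using * by simp_all blast
  have "- 1 \<in> ints_of F"
    by (intro subring_CC_closed(2,6)[OF subring_ints_of[OF subfield_CC_subring[OF F]]])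
  then show n: "x \<in> Q \<Longrightarrow> - x \<in> Q" for x using a(2)[of "- 1" x] by simp
  show "x \<in> Q \<Longrightarrow> y \<in> Q \<Longrightarrow> x - y \<in> Q" using a(1)[of x "- y"] n by simp
qed

text \<open>Products of ideals do not see the surrounding ring, so all of them can be formed in
  \<open>CC\<close>.\<close>

lemma ideal_prod_sub_CC: "ideal_prod (sub_CC S) I J = ideal_prod CC I J"
proof -
  have "x \<in> ideal_prod CC I J" if "x \<in> ideal_prod (sub_CC S) I J" for x
    using that
  proof induction
    case (prod i j) then show ?case using ideal_prod.prod[of i I j J CC] by simp
  next
    case (sum s1 s2) then show ?case using ideal_prod.sum[of s1 CC I J s2] by simp
  qed
  moreover have "x \<in> ideal_prod (sub_CC S) I J" if "x \<in> ideal_prod CC I J" for x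
    using that
  proof induction
    case (prod i j) then show ?case using ideal_prod.prod[of i I j J "sub_CC S"] by simp
  next
    case (sum s1 s2) then show ?case using ideal_prod.sum[of s1 "sub_CC S" I J s2] by simp
  qed
  ultimately show ?thesis by blast
qed

text \<open>The powers of \<open>Q\<close> decrease and \<open>P \<subseteq> Q\<close>, so the
  supremum is 1 exactly when the exponent 2 is excluded.\<close>

lemma ramification_index_eq_1_iff:
  assumes F: "subfield F CC" and Q: "Q \<in> finite_places F" and PQ: "P \<subseteq> Q"
  shows "ramification_index F P Q = 1 \<longleftrightarrow> \<not> P \<subseteq> ideal_prod CC Q Q"
proof -
  define R where "R = ring_of_integers F"
  have S: "subring (ints_of F) CC" using F by (intro subring_ints_of subfield_CC_subring)
  interpret domain R unfolding R_def ring_of_integers_eq by (rule domain_sub_CC[OF S])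
  have Qi: "ideal Q R" using Q unfolding finite_places_def R_def by (auto simp: primeideal.axioms)
  have Pc: "P \<subseteq> carrier R" using PQ finite_placeD(1)[OF F Q] by (auto simp: R_def ring_of_integers_eq)
  define q where "q = (\<lambda>n::nat. Q [^]\<^bsub>ideals_set R\<^esub> n)"
  have q0: "q 0 = carrier R" and qS: "q (Suc n) = ideal_prod R (q n) Q" for n
    by (simp_all add: q_def nat_pow_def ideals_set_def)
  have qi: "ideal (q n) R" for n
    by (induction n) (auto simp: q0 qS oneideal intro: ideal_prod_is_ideal Qi)
  have q1: "q (Suc 0) = Q" unfolding qS q0 using ideal_prod_one[OF Qi] ideal_prod_commute[OF Qi oneideal] by simp
  have q2: "q 2 = ideal_prod CC Q Q"
    using ideal_prod_sub_CC[of "ints_of F" Q Q] qS[of "Suc 0"] q1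
    by (simp add: numeral_2_eq_2 R_def ring_of_integers_eq)
  have dec: "q (Suc n) \<subseteq> q n" for n unfolding qS using ideal_prod_inter[OF qi Qi] by blast
  have mem: "Idl\<^bsub>R\<^esub> P \<subseteq> q n \<longleftrightarrow> P \<subseteq> q n" for n
    using genideal_minimal[OF qi] genideal_self[OF Pc] by blast
  have ri: "ramification_index F P Q = Sup {enat n | n. P \<subseteq> q n}"
    using mem unfolding ramification_index_def R_def[symmetric] q_def by simp
  have one: "P \<subseteq> q 1" using PQ q1 by simp
  show ?thesis
  proof
    assume r: "ramification_index F P Q = 1"
    show "\<not> P \<subseteq> ideal_prod CC Q Q"
    proof
      assume "P \<subseteq> ideal_prod CC Q Q"
      then have "enat 2 \<in> {enat n | n. P \<subseteq> q n}" using q2 by auto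
      then have "enat 2 \<le> 1" unfolding r[symmetric] ri by (rule Sup_upper)
      then show False by (simp add: one_enat_def)
    qed
  next
    assume no: "\<not> P \<subseteq> ideal_prod CC Q Q"
    have ge2: "\<not> P \<subseteq> q (Suc (Suc n))" for n
    proof (induction n)
      case 0
      then show ?case using no q2 by (simp add: numeral_2_eq_2)
    next
      case (Suc n)
      then show ?case using dec[of "Suc (Suc n)"] by blast
    qed
    have n: "n \<le> 1" if Pn: "P \<subseteq> q n" for n
    proof (rule ccontr)
      assume "\<not> n \<le> 1"
      then have "n = Suc (Suc (n - 2))" by simp
      with ge2[of "n - 2"] Pn show False by simp
    qed
    have "Sup {enat n | n. P \<subseteq> q n} \<le> 1" by (rule Sup_least) (use n in \<open>auto simp: one_enat_def\<close>)
    moreover have "enat 1 \<le> Sup {enat n | n. P \<subseteq> q n}" by (rule Sup_upper) (use one in auto)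
    ultimately show "ramification_index F P Q = 1" unfolding ri by (simp add: one_enat_def)
  qed
qed

lemma unramified_at_finite_iff:
  assumes F: "subfield F CC"
  shows "unramified_at_finite E F P \<longleftrightarrow> (\<forall>Q\<in>finite_places F. Q \<inter> E = P \<longrightarrow> \<not> P \<subseteq> ideal_prod CC Q Q)"
proof -
  have "ramification_index F P Q = 1 \<longleftrightarrow> \<not> P \<subseteq> ideal_prod CC Q Q"
    if "Q \<in> finite_places F" "Q \<inter> E = P" for Q
    using ramification_index_eq_1_iff[OF F that(1), of P] that(2) by blast
  then show ?thesis unfolding unramified_at_finite_def by (intro ball_cong) auto
qed

lemma ideal_square_closed:
  assumes F: "subfield F CC" and Q: "Q \<in> finite_places F"
  shows "a \<in> ints_of F \<Longrightarrow> x \<in> ideal_prod CC Q Q \<Longrightarrow> a * x \<in> ideal_prod CC Q Q"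
    "x \<in> ideal_prod CC Q Q \<Longrightarrow> y \<in> ideal_prod CC Q Q \<Longrightarrow> x + y \<in> ideal_prod CC Q Q"
    "x \<in> Q \<Longrightarrow> y \<in> Q \<Longrightarrow> x * y \<in> ideal_prod CC Q Q"
proof -
  show m: "x * y \<in> ideal_prod CC Q Q" if "x \<in> Q" "y \<in> Q" for x y
    using ideal_prod.prod[of x Q y Q CC] that by simp
  show s: "x + y \<in> ideal_prod CC Q Q" if "x \<in> ideal_prod CC Q Q" "y \<in> ideal_prod CC Q Q" for x y
    using ideal_prod.sum[of x CC Q Q y] that by simp
  show "a * x \<in> ideal_prod CC Q Q" if "a \<in> ints_of F" "x \<in> ideal_prod CC Q Q"
    using that(2)
  proof induction
    case (prod i j)
    then show ?case using m[of "a * i" j] finite_placeD(4)[OF F Q that(1)] by (simp add: mult.assoc)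
  next
    case (sum s1 s2)
    then show ?case using s by (simp add: distrib_left)
  qed
qed

section \<open>Unramified primes and reduced residue rings\<close>

abbreviation pdiv :: "nat \<Rightarrow> complex \<Rightarrow> bool"
  where "pdiv p x \<equiv> algebraic_int (x / of_nat p)"

text \<open>No nilpotents modulo \<open>p\<close>; elements of square zero detect them. The
  condition mentions \<open>F\<close> only through the range of \<open>z\<close>, which is why it
  passes to subfields.\<close>

definition reduced_mod :: "nat \<Rightarrow> complex set \<Rightarrow> bool"
  where "reduced_mod p F \<longleftrightarrow> (\<forall>z\<in>ints_of F. pdiv p (z ^ 2) \<longrightarrow> pdiv p z)"

lemma reduced_mod_subfield: "reduced_mod p F \<Longrightarrow> E \<subseteq> F \<Longrightarrow> reduced_mod p E"
  by (auto simp: reduced_mod_def ints_of_def)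

locale place_over =
  fixes F :: "complex set" and Q :: "complex set" and p :: nat
  assumes F: "number_field F" and Q: "Q \<in> finite_places F" and p: "Factorial_Ring.prime p" and pQ: "of_nat p \<in> Q"
begin

lemma subfield_F: "subfield F CC" using F by (simp add: number_field_def)

lemma subring_F: "subring F CC" using subfield_F by (rule subfield_CC_subring)

lemma subring_O: "subring (ints_of F) CC" using subring_ints_of[OF subring_F] .

lemmas Q_closed = finite_placeD[OF subfield_F Q]
lemmas O_closed = subring_CC_closed[OF subring_O]

lemma p_nonzero: "(of_nat p :: complex) \<noteq> 0"
  using p by (auto simp: prime_gt_0_nat)

lemma div_p_in_O: "x \<in> F \<Longrightarrow> pdiv p x \<Longrightarrow> x / of_nat p \<in> ints_of F"
  using subfield_CC_closed(2)[OF subfield_F] subring_CC_closed(8)[OF subring_F] by (simp add: ints_of_def)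

lemma pdiv_in_Q: "x \<in> F \<Longrightarrow> pdiv p x \<Longrightarrow> x \<in> Q"
  using Q_closed(4)[OF div_p_in_O pQ, of x] p_nonzero by simp

lemma O_F: "x \<in> ints_of F \<Longrightarrow> x \<in> F" and O_int: "x \<in> ints_of F \<Longrightarrow> algebraic_int x"
  by (auto simp: ints_of_def)

lemma pdiv_mult: "a \<in> ints_of F \<Longrightarrow> pdiv p x \<Longrightarrow> pdiv p (a * x)"
  using algebraic_int_closed(5)[OF O_int, of a "x / of_nat p"] by simp

lemma not_in_Q_mult: "s \<in> ints_of F - Q \<Longrightarrow> s' \<in> ints_of F - Q \<Longrightarrow> s * s' \<in> ints_of F - Q"
  using Q_closed(6)[of s s'] O_closed(5)[of s s'] by blast

lemma one_minus_power_not_in_Q: "q \<in> Q \<Longrightarrow> n > 0 \<Longrightarrow> 1 - q ^ n \<in> ints_of F - Q"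
proof -
  assume q: "q \<in> Q" and n: "n > 0"
  then obtain m where m: "n = Suc m" by (cases n) auto
  have qn: "q ^ n \<in> Q" unfolding m power_Suc2 using q by (intro Q_closed(4) O_closed(7) Q_closed(1))
  have "1 - q ^ n \<notin> Q" using Q_closed(3)[OF _ qn, of "1 - q ^ n"] Q_closed(5) by auto
  then show ?thesis using O_closed(4)[OF O_closed(2) Q_closed(1)[OF qn]] by blast
qed

text \<open>The residue ring at \<open>Q\<close> is a finite domain: two powers of \<open>u\<close>
  agree modulo \<open>p\<close>, and cancelling the smaller one makes a positive power of
  \<open>u\<close> congruent to 1 modulo \<open>Q\<close>.\<close>

lemma inverse_mod_Q:
  assumes u: "u \<in> ints_of F - Q"
  obtains t where "t \<in> ints_of F" "1 - u * t \<in> Q"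
proof -
  obtain i j :: nat where ij: "i < j" "pdiv p (u ^ i - u ^ j)"
    using powers_congruent[OF F p, of "\<lambda>n. u ^ n"] u O_closed(7) by blast
  have un: "u ^ n \<in> ints_of F - Q" for n
    by (induction n) (use u Q_closed(5) O_closed(2) not_in_Q_mult in auto)
  have "u ^ i - u ^ j = u ^ i * (1 - u ^ (j - i))" using ij(1) by (simp add: algebra_simps flip: power_add)
  moreover have "u ^ i - u ^ j \<in> Q" using ij(2) un O_F O_closed by (intro pdiv_in_Q) auto
  ultimately have "1 - u ^ (j - i) \<in> Q" using Q_closed(6)[of "u ^ i"] un O_closed by auto
  moreover have "j - i = Suc (j - i - 1)" using ij(1) by simp
  ultimately have "1 - u * u ^ (j - i - 1) \<in> Q" by (metis power_Suc)
  moreover have "u ^ (j - i - 1) \<in> ints_of F" using un by blast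
  ultimately show ?thesis using that by blast
qed

text \<open>The maximal ideal of the localization at \<open>Q\<close> of the finite residue ring modulo \<open>p\<close> is an
  annihilator; \<open>z\<close> is the element that it annihilates.\<close>

lemma annihilator:
  obtains z where "z \<in> ints_of F" "\<And>s. s \<in> ints_of F - Q \<Longrightarrow> \<not> pdiv p (s * z)"
    "\<And>q. q \<in> Q \<Longrightarrow> pdiv p (q * z)"
proof -
  obtain T where T: "finite T" "T \<subseteq> ints_of F" "\<And>x. x \<in> ints_of F \<Longrightarrow> \<exists>t\<in>T. pdiv p (x - t)"
    using finite_residues[OF F p] by metis
  \<comment> \<open>Starting from \<open>z = 1\<close>, the elements of a finite part of
    \<open>Q\<close> are made to annihilate \<open>z\<close> one after the other while
    \<open>z\<close> stays nonzero in the localization. Later the representatives in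
    \<open>T\<close> that lie in \<open>Q\<close> suffice.\<close>
  have "\<exists>z\<in>ints_of F. (\<forall>s\<in>ints_of F - Q. \<not> pdiv p (s * z)) \<and> (\<forall>q\<in>A. pdiv p (q * z))"
    if "finite A" "A \<subseteq> Q" for A
    using that
  proof (induction A)
    case empty
    have "\<not> pdiv p (s * 1)" if "s \<in> ints_of F - Q" for s using that pdiv_in_Q[of s] O_F by auto
    then show ?case using O_closed(2) by blast
  next
    case (insert q A)
    then obtain z where z: "z \<in> ints_of F" "\<And>s. s \<in> ints_of F - Q \<Longrightarrow> \<not> pdiv p (s * z)"
      "\<And>q. q \<in> A \<Longrightarrow> pdiv p (q * z)" by auto
    have q: "q \<in> Q" "q \<in> ints_of F" using insert.prems Q_closed(1) by auto
    obtain i j :: nat where ij: "i < j" "pdiv p (q ^ i - q ^ j)"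
      using powers_congruent[OF F p, of "\<lambda>n. q ^ n"] q O_closed(7) by blast
    \<comment> \<open>\<open>N t\<close> says that \<open>q ^ t * z\<close> vanishes in the
      localization at \<open>Q\<close>. This holds for \<open>t = i\<close> because
      \<open>1 - q ^ (j - i)\<close> lies outside \<open>Q\<close>. The last nonvanishing
      \<open>q ^ t * z\<close>, times \<open>s\<close>, is the next element.\<close>
    define N where "N = (\<lambda>t. \<exists>s\<in>ints_of F - Q. pdiv p (s * (q ^ t * z)))"
    have "N i"
    proof -
      have "(1 - q ^ (j - i)) * (q ^ i * z) = z * (q ^ i - q ^ j)"
        using ij(1) by (simp add: algebra_simps flip: power_add)
      then have "pdiv p ((1 - q ^ (j - i)) * (q ^ i * z))" using pdiv_mult[OF z(1) ij(2)] by (simp only:)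
      then show ?thesis unfolding N_def using one_minus_power_not_in_Q[OF q(1), of "j - i"] ij(1) by auto
    qed
    moreover have "\<not> N 0" unfolding N_def using z(2) by simp
    ultimately obtain t where t: "\<not> N t" "N (Suc t)"
      using ex_least_nat_less[of N i] by blast
    obtain s where s: "s \<in> ints_of F - Q" "pdiv p (s * (q ^ Suc t * z))" using t(2) by (auto simp: N_def)
    show ?case
    proof (intro bexI[of _ "s * (q ^ t * z)"] conjI ballI)
      show "s * (q ^ t * z) \<in> ints_of F" using s(1) q(2) z(1) O_closed by auto
      fix s' assume "s' \<in> ints_of F - Q"
      then have "s' * s \<in> ints_of F - Q" using s(1) not_in_Q_mult by blast
      then have "\<not> pdiv p (s' * s * (q ^ t * z))" using t(1) unfolding N_def by blast
      then show "\<not> pdiv p (s' * (s * (q ^ t * z)))" by (simp add: mult.assoc)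
    next
      fix q' assume "q' \<in> insert q A"
      then show "pdiv p (q' * (s * (q ^ t * z)))"
      proof
        assume "q' = q"
        then show ?thesis using s(2) by (simp add: mult_ac)
      next
        assume "q' \<in> A"
        then have "pdiv p ((s * q ^ t) * (q' * z))" using s(1) q(2) O_closed by (intro pdiv_mult z(3)) auto
        then show ?thesis by (simp add: mult_ac)
      qed
    qed
  qed
  from this[of "T \<inter> Q"] T(1) obtain z where z: "z \<in> ints_of F"
    "\<And>s. s \<in> ints_of F - Q \<Longrightarrow> \<not> pdiv p (s * z)" "\<And>q. q \<in> T \<inter> Q \<Longrightarrow> pdiv p (q * z)" by auto
  have "pdiv p (q * z)" if q: "q \<in> Q" for q
  proof -
    obtain t where t: "t \<in> T" "pdiv p (q - t)" using T(3)[OF Q_closed(1)[OF q]] by blast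
    have "q - t \<in> Q" using t T(2) Q_closed(1)[OF q] O_F O_closed by (intro pdiv_in_Q) auto
    then have "t \<in> Q" using Q_closed(9)[OF q, of "q - t"] by simp
    then have "pdiv p (t * z)" using z(3) t(1) by blast
    from algebraic_int_closed(3)[OF this pdiv_mult[OF z(1) t(2)]]
    show ?thesis by (simp add: algebra_simps add_divide_distrib[symmetric])
  qed
  with z show ?thesis using that by blast
qed

text \<open>The conclusion means that \<open>p\<close> generates \<open>Q\<close> locally at
  \<open>Q\<close>. If the element \<open>z\<close> annihilated by \<open>Q\<close> were in
  \<open>Q\<close>, its square would vanish modulo \<open>p\<close>.\<close>

lemma unramified_of_reduced:
  assumes "reduced_mod p F"
  obtains s where "s \<in> ints_of F - Q" "\<And>q. q \<in> Q \<Longrightarrow> pdiv p (s * q)"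
proof -
  obtain z where z: "z \<in> ints_of F" "\<And>s. s \<in> ints_of F - Q \<Longrightarrow> \<not> pdiv p (s * z)"
    "\<And>q. q \<in> Q \<Longrightarrow> pdiv p (q * z)" using annihilator by metis
  have "z \<notin> Q"
  proof
    assume "z \<in> Q"
    then have "pdiv p (z ^ 2)" using z(3) by (simp add: power2_eq_square)
    then have "pdiv p z" using assms z(1) by (simp add: reduced_mod_def)
    then show False using z(2)[of 1] O_closed(2) Q_closed(5) by simp
  qed
  then show ?thesis using that[of z] z(1,3) by (simp add: mult.commute)
qed

text \<open>With \<open>s\<close> mapping \<open>Q\<close> into the multiples of \<open>p\<close>,
  it maps the square of \<open>Q\<close> into \<open>p\<close> times \<open>Q\<close>. If
  \<open>p\<close> were in that square, \<open>s\<close> would be in \<open>Q\<close>.\<close>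

lemma not_in_square_of_reduced:
  assumes "reduced_mod p F"
  shows "of_nat p \<notin> ideal_prod CC Q Q"
proof
  obtain s where s: "s \<in> ints_of F - Q" "\<And>q. q \<in> Q \<Longrightarrow> pdiv p (s * q)"
    using unramified_of_reduced[OF assms] by metis
  have "s * x / of_nat p \<in> Q" if "x \<in> ideal_prod CC Q Q" for x
    using that
  proof induction
    case (prod i j)
    have "s * i / of_nat p \<in> ints_of F"
      using s prod Q_closed(1) O_closed O_F by (intro div_p_in_O) auto
    from Q_closed(4)[OF this prod(2)] show ?case by (simp add: mult.assoc)
  next
    case (sum s1 s2)
    then show ?case using Q_closed(3) by (simp add: distrib_left add_divide_distrib)
  qed
  moreover assume "of_nat p \<in> ideal_prod CC Q Q"
  ultimately have "s * of_nat p / of_nat p \<in> Q" .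
  then show False using s(1) p_nonzero by simp
qed

text \<open>Otherwise \<open>z / p\<close> would stabilize \<open>Q\<close> and hence be integral, or \<open>p\<close> would lie in \<open>Q\<^sup>2\<close>.\<close>

lemma unramified_of_not_in_square:
  assumes "of_nat p \<notin> ideal_prod CC Q Q"
  obtains s where "s \<in> ints_of F - Q" "\<And>q. q \<in> Q \<Longrightarrow> pdiv p (s * q)"
proof -
  note sq = ideal_square_closed[OF subfield_F Q]
  obtain z where z: "z \<in> ints_of F" "\<And>s. s \<in> ints_of F - Q \<Longrightarrow> \<not> pdiv p (s * z)"
    "\<And>q. q \<in> Q \<Longrightarrow> pdiv p (q * z)" using annihilator by metis
  have "z \<notin> Q"
  proof
    assume zQ: "z \<in> Q"
    define w where "w = z / of_nat p"
    show False
    proof (cases "\<forall>q\<in>Q. q * w \<in> Q")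
      case True
      have "of_nat p * w ^ n \<in> Q" for n
        using pQ True by (induction n) (auto simp: mult.assoc[symmetric] power_Suc2 simp del: power_Suc)
      then obtain i j :: nat where "i < j" "pdiv p (of_nat p * w ^ i - of_nat p * w ^ j)"
        using powers_congruent[OF F p, of "\<lambda>n. of_nat p * w ^ n"] Q_closed(1) by blast
      then have "algebraic_int w" using p_nonzero
        by (intro algebraic_int_if_powers_congruent[of w i j]) (auto simp: right_diff_distrib[symmetric])
      then show False using z(2)[of 1] O_closed(2) Q_closed(5) by (simp add: w_def)
    next
      case False
      then obtain y where y: "y \<in> Q" "y * w \<notin> Q" by blast
      define u where "u = y * w"
      have "u \<in> ints_of F - Q" using div_p_in_O[OF _ z(3)[OF y(1)]] y Q_closed(1) z(1) O_F O_closed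
        by (simp add: u_def w_def)
      then obtain t where t: "t \<in> ints_of F" "1 - u * t \<in> Q" using inverse_mod_Q by blast
      \<comment> \<open>Since \<open>p * u = y * z\<close> and \<open>t\<close> inverts
        \<open>u\<close> modulo \<open>Q\<close>, \<open>p\<close> becomes a sum of two products of
        elements of \<open>Q\<close>.\<close>
      have "of_nat p = of_nat p * (1 - u * t) + (t * z) * y"
        using p_nonzero by (simp add: u_def w_def algebra_simps)
      moreover have "of_nat p * (1 - u * t) \<in> ideal_prod CC Q Q" using pQ t(2) by (rule sq(3))
      moreover have "(t * z) * y \<in> ideal_prod CC Q Q" using Q_closed(4)[OF t(1) zQ] y(1) by (rule sq(3))
      ultimately show False using assms sq(2) by metis
    qed
  qed
  then show ?thesis using that[of z] z(1,3) by (simp add: mult.commute)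
qed

lemma place_below:
  assumes E: "subfield E CC" "E \<subseteq> F"
  shows "Q \<inter> E \<in> finite_places E"
proof -
  have "of_nat p \<in> Q \<inter> E" using pQ subring_CC_closed(8)[OF subfield_CC_subring[OF E(1)]] by blast
  then have "Q \<inter> E \<noteq> {0}" using p_nonzero by blast
  moreover have i: "ints_of E \<subseteq> ints_of F" using ints_of_mono[OF E(2)] .
  have iE: "ints_of E \<subseteq> E" by (auto simp: ints_of_def)
  note EE = subring_CC_closed[OF subfield_CC_subring[OF E(1)]]
  have "x \<in> ints_of E" if "x \<in> Q \<inter> E" for x using that Q_closed(1)[of x] by (auto simp: ints_of_def)
  moreover have "a * x \<in> Q \<inter> E" if "a \<in> ints_of E" "x \<in> Q \<inter> E" for a x
    using that Q_closed(4)[of a x] i iE EE(5)[of a x] by blast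
  moreover have "a \<in> Q \<inter> E \<or> b \<in> Q \<inter> E" if "a \<in> ints_of E" "b \<in> ints_of E" "a * b \<in> Q \<inter> E" for a b
    using that Q_closed(6)[of a b] i iE by blast
  moreover have "x + y \<in> Q \<inter> E" if "x \<in> Q \<inter> E" "y \<in> Q \<inter> E" for x y
    using that Q_closed(3)[of x y] EE(3)[of x y] by blast
  moreover have "0 \<in> Q \<inter> E" "1 \<notin> Q \<inter> E" using Q_closed(2,5) EE(1) by auto
  ultimately show ?thesis unfolding finite_places_iff[OF E(1)] by (intro conjI subsetI ballI impI)
qed

text \<open>By reducedness some \<open>s\<close> outside \<open>Q\<close> sends the place below into
  the multiples of \<open>p\<close>. If \<open>p\<close> were in the square of \<open>Q\<close>,
  these multiples would be too, and since \<open>s\<close> is invertible modulo \<open>Q\<close>, so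
  would the whole place below.\<close>

lemma not_in_square_of_unramified:
  assumes E: "number_field E" "E \<subseteq> F" and red: "reduced_mod p E" and nr: "\<not> Q \<inter> E \<subseteq> ideal_prod CC Q Q"
  shows "of_nat p \<notin> ideal_prod CC Q Q"
proof
  note sq = ideal_square_closed[OF subfield_F Q]
  assume pQ2: "of_nat p \<in> ideal_prod CC Q Q"
  have Es: "subfield E CC" using E(1) by (simp add: number_field_def)
  have "of_nat p \<in> E" using subring_CC_closed(8)[OF subfield_CC_subring[OF Es]] .
  then interpret E: place_over E "Q \<inter> E" p
    by unfold_locales (use E p pQ place_below[OF Es E(2)] in auto)
  obtain s where s: "s \<in> ints_of E - Q \<inter> E" "\<And>q. q \<in> Q \<inter> E \<Longrightarrow> pdiv p (s * q)"
    using E.unramified_of_reduced[OF red] by metis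
  have "s \<in> ints_of F - Q" using s(1) ints_of_mono[OF E(2)] by (auto simp: ints_of_def)
  then obtain t where t: "t \<in> ints_of F" "1 - s * t \<in> Q" and sO: "s \<in> ints_of F" using inverse_mod_Q by blast
  have "y \<in> ideal_prod CC Q Q" if y: "y \<in> Q \<inter> E" for y
  proof -
    have yO: "y \<in> ints_of F" using y Q_closed(1) by blast
    have "s * y / of_nat p \<in> ints_of F" using s(2)[OF y] sO yO O_closed O_F by (intro div_p_in_O) auto
    from sq(1)[OF this pQ2] have "s * y \<in> ideal_prod CC Q Q" using p_nonzero by simp
    from sq(1)[OF t(1) this] have "t * (s * y) \<in> ideal_prod CC Q Q" .
    moreover have "y * (1 - s * t) \<in> ideal_prod CC Q Q" using y t(2) by (intro sq(3)) auto
    ultimately have "y * (1 - s * t) + t * (s * y) \<in> ideal_prod CC Q Q" by (intro sq(2))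
    then show ?thesis by (simp add: algebra_simps)
  qed
  with nr show False by blast
qed

end

text \<open>Zorn's lemma gives an ideal that is maximal among those containing \<open>J\<close> but
  not 1, and such an ideal is prime.\<close>

lemma exists_place_containing:
  assumes F: "subfield F CC" and J: "J \<subseteq> ints_of F" "0 \<in> J" "\<And>x y. x \<in> J \<Longrightarrow> y \<in> J \<Longrightarrow> x + y \<in> J"
    "\<And>a x. a \<in> ints_of F \<Longrightarrow> x \<in> J \<Longrightarrow> a * x \<in> J" "1 \<notin> J" "J \<noteq> {0}"
  obtains Q where "Q \<in> finite_places F" "J \<subseteq> Q"
proof -
  define \<A> where "\<A> = {I. J \<subseteq> I \<and> I \<subseteq> ints_of F \<and> (\<forall>x\<in>I. \<forall>y\<in>I. x + y \<in> I) \<and>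
      (\<forall>a\<in>ints_of F. \<forall>x\<in>I. a * x \<in> I) \<and> 1 \<notin> I}"
  note O = subring_CC_closed[OF subring_ints_of[OF subfield_CC_subring[OF F]]]
  have "J \<in> \<A>" using J by (simp add: \<A>_def)
  then have "\<A> \<noteq> {}" by blast
  moreover have "\<Union>\<C> \<in> \<A>" if C: "\<C> \<noteq> {}" "subset.chain \<A> \<C>" for \<C>
  proof -
    have sub: "\<C> \<subseteq> \<A>" and lin: "\<And>A B. A \<in> \<C> \<Longrightarrow> B \<in> \<C> \<Longrightarrow> A \<subseteq> B \<or> B \<subseteq> A"
      using C(2) by (auto simp: subset.chain_def)
    have "x + y \<in> \<Union>\<C>" if xy: "x \<in> \<Union>\<C>" "y \<in> \<Union>\<C>" for x y
    proof -
      obtain A B where AB: "A \<in> \<C>" "B \<in> \<C>" "x \<in> A" "y \<in> B" using xy by blast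
      then obtain Z where "Z \<in> \<C>" "x \<in> Z" "y \<in> Z" using lin by blast
      then show ?thesis using sub unfolding \<A>_def by blast
    qed
    moreover have "J \<subseteq> \<Union>\<C>" using C(1) sub unfolding \<A>_def by blast
    moreover have "\<Union>\<C> \<subseteq> ints_of F" "1 \<notin> \<Union>\<C>" using sub unfolding \<A>_def by blast+
    moreover have "a * x \<in> \<Union>\<C>" if "a \<in> ints_of F" "x \<in> \<Union>\<C>" for a x
      using sub that unfolding \<A>_def by blast
    ultimately show ?thesis unfolding \<A>_def by simp
  qed
  ultimately obtain Q where QA: "Q \<in> \<A>" and max: "\<And>I. I \<in> \<A> \<Longrightarrow> Q \<subseteq> I \<Longrightarrow> I = Q"
    using subset_Zorn_nonempty[of \<A>] by blast
  have Q: "J \<subseteq> Q" "Q \<subseteq> ints_of F" "\<And>x y. x \<in> Q \<Longrightarrow> y \<in> Q \<Longrightarrow> x + y \<in> Q"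
    "\<And>a x. a \<in> ints_of F \<Longrightarrow> x \<in> Q \<Longrightarrow> a * x \<in> Q" "1 \<notin> Q"
    using QA unfolding \<A>_def by auto
  have prime: "b \<in> Q" if ab: "a \<in> ints_of F" "b \<in> ints_of F" "a * b \<in> Q" "a \<notin> Q" for a b
  proof -
    define I where "I = {i + a * r | i r. i \<in> Q \<and> r \<in> ints_of F}"
    have QI: "Q \<subseteq> I" unfolding I_def using O(1) by force
    have "a \<in> I" unfolding I_def using Q(1) J(2) O(2) by force
    then have "I \<noteq> Q" using ab(4) by blast
    then have "I \<notin> \<A>" using max QI by blast
    moreover have "I \<subseteq> ints_of F" using Q(2) ab(1) O by (auto simp: I_def)
    moreover have "x + y \<in> I" if xy: "x \<in> I" "y \<in> I" for x y
    proof -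
      obtain i r i' r' where "x = i + a * r" "y = i' + a * r'" "i \<in> Q" "r \<in> ints_of F" "i' \<in> Q" "r' \<in> ints_of F"
        using xy unfolding I_def by blast
      moreover have "x + y = (i + i') + a * (r + r')" using calculation by (simp add: algebra_simps)
      ultimately show ?thesis unfolding I_def using Q(3) O(3) by blast
    qed
    moreover have "c * x \<in> I" if cx: "c \<in> ints_of F" "x \<in> I" for c x
    proof -
      obtain i r where "x = i + a * r" "i \<in> Q" "r \<in> ints_of F" using cx unfolding I_def by blast
      moreover have "c * x = c * i + a * (c * r)" using calculation by (simp add: algebra_simps)
      ultimately show ?thesis unfolding I_def using Q(4) O(5) cx(1) by blast
    qed
    ultimately have "1 \<in> I" using Q(1) QI unfolding \<A>_def by blast
    then obtain i r where ir: "1 = i + a * r" "i \<in> Q" "r \<in> ints_of F" unfolding I_def by blast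
    have "b = b * (i + a * r)" using ir(1) by simp
    then have "b = b * i + r * (a * b)" by (simp add: algebra_simps)
    then show ?thesis using Q(3)[OF Q(4)[OF ab(2) ir(2)] Q(4)[OF ir(3) ab(3)]] by simp
  qed
  have "Q \<noteq> {0}" using Q(1) J(2,6) by blast
  moreover have "\<forall>a\<in>ints_of F. \<forall>b\<in>ints_of F. a * b \<in> Q \<longrightarrow> a \<in> Q \<or> b \<in> Q" using prime by blast
  moreover have "0 \<in> Q" using Q(1) J(2) by blast
  ultimately have "Q \<in> finite_places F" unfolding finite_places_iff[OF F]
    by (intro conjI Q(2,5) ballI Q(3,4)) blast+
  with Q(1) show ?thesis using that by blast
qed

text \<open>Suppose \<open>z ^ 2\<close> but not \<open>z\<close> vanishes modulo \<open>p\<close>,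
  and let a place \<open>Q\<close> contain the annihilator \<open>J\<close> of \<open>z\<close>
  modulo \<open>p\<close>. Then \<open>z\<close> is in \<open>J\<close>, hence in \<open>Q\<close>,
  and the factor \<open>s\<close> outside \<open>Q\<close> with \<open>s * Q\<close> divisible by
  \<open>p\<close> would lie in \<open>J\<close>.\<close>

lemma reduced_if_places_unramified:
  assumes F: "number_field F" and p: "Factorial_Ring.prime p"
    and unr: "\<And>Q. Q \<in> finite_places F \<Longrightarrow> of_nat p \<in> Q \<Longrightarrow> of_nat p \<notin> ideal_prod CC Q Q"
  shows "reduced_mod p F"
  unfolding reduced_mod_def
proof (intro ballI impI)
  fix z assume z: "z \<in> ints_of F" and z2: "pdiv p (z ^ 2)"
  have Fs: "subfield F CC" using F by (simp add: number_field_def)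
  note O = subring_CC_closed[OF subring_ints_of[OF subfield_CC_subring[OF Fs]]]
  have p0: "(of_nat p :: complex) \<noteq> 0" using p by (auto simp: prime_gt_0_nat)
  show "pdiv p z"
  proof (rule ccontr)
    assume nz: "\<not> pdiv p z"
    define J where "J = {x \<in> ints_of F. pdiv p (x * z)}"
    have pJ: "of_nat p \<in> J" using O(8) z p0 by (simp add: J_def ints_of_def)
    obtain Q where QJ: "Q \<in> finite_places F" "J \<subseteq> Q"
    proof (rule exists_place_containing[OF Fs, of J])
      show "0 \<in> J" using O(1) by (simp add: J_def)
      fix x y assume "x \<in> J" "y \<in> J"
      then show "x + y \<in> J" using O(3) algebraic_int_closed(3)[of "x * z / of_nat p" "y * z / of_nat p"]
        by (simp add: J_def distrib_right add_divide_distrib)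
    next
      fix a x assume "a \<in> ints_of F" "x \<in> J"
      then show "a * x \<in> J" using O(5) algebraic_int_closed(5)[of a "x * z / of_nat p"]
        by (simp add: J_def ints_of_def mult.assoc)
    next
      show "J \<noteq> {0}" using pJ p0 by blast
    qed (use nz in \<open>auto simp: J_def\<close>)
    interpret place_over F Q p using F QJ p pJ by unfold_locales auto
    obtain s where s: "s \<in> ints_of F - Q" "\<And>q. q \<in> Q \<Longrightarrow> pdiv p (s * q)"
      using unramified_of_not_in_square[OF unr[OF QJ(1) pQ]] by metis
    have "z \<in> Q" using z z2 QJ(2) by (auto simp: J_def power2_eq_square)
    then have "s \<in> J" using s by (auto simp: J_def)
    then show False using s(1) QJ(2) by blast
  qed
qed

section \<open>The real quadratic field\<close>

lemma sqrt_prime_irrational: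
  assumes "Factorial_Ring.prime (l::nat)"
  shows "complex_of_real (sqrt (real l)) \<notin> \<rat>"
proof
  assume "complex_of_real (sqrt (real l)) \<in> \<rat>"
  moreover have "algebraic_int (complex_of_real (sqrt (real l)))" by auto
  ultimately have "complex_of_real (sqrt (real l)) \<in> \<int>" by (metis rational_algebraic_int_is_int)
  then obtain k where k: "complex_of_real (sqrt (real l)) = of_int k" by (auto elim: Ints_cases)
  have "complex_of_real (sqrt (real l)) ^ 2 = of_nat l" by (simp flip: of_real_power)
  then have "(of_int (k ^ 2) :: complex) = of_int (int l)" using k by simp
  then have "k ^ 2 = int l" by (simp only: of_int_eq_iff)
  then have "(nat \<bar>k\<bar>) ^ 2 = l" by (metis nat_int power2_abs nat_power_eq abs_ge_zero)
  then have "Factorial_Ring.prime ((nat \<bar>k\<bar>) ^ 2)" using assms by simp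
  then have "(2::nat) = 1" unfolding prime_power_iff by blast
  then show False by simp
qed

locale quadratic_field =
  fixes l :: nat
  assumes l: "Factorial_Ring.prime l" and l4: "[l = 1] (mod 4)"
begin

definition s :: complex where "s = complex_of_real (sqrt (real l))"

lemma s2: "s * s = of_nat l"
  by (simp add: s_def flip: of_real_mult)

lemma s_irrational: "s \<notin> \<rat>"
  unfolding s_def by (rule sqrt_prime_irrational[OF l])

lemma rat_lin_indep:
  assumes "a \<in> \<rat>" "b \<in> \<rat>" "a + b * s = 0"
  shows "a = 0" "b = 0"
proof -
  show b: "b = 0"
  proof (rule ccontr)
    assume "b \<noteq> 0"
    then have "s = - a / b" using assms(3) by (simp add: field_simps eq_neg_iff_add_eq_0)
    also have "\<dots> \<in> \<rat>" using assms(1,2) by simp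
    finally show False using s_irrational by simp
  qed
  then show "a = 0" using assms(3) by simp
qed

lemma sqrt_field_subfield: "subfield (sqrt_field l) CC"
  unfolding sqrt_field_def by (rule field.generate_field_is_subfield[OF field_CC]) simp

lemma s_in_sqrt_field: "s \<in> sqrt_field l"
  unfolding sqrt_field_def s_def by (rule generate_field.incl) simp

lemma sqrt_field_elem:
  assumes "x \<in> sqrt_field l"
  obtains a b where "a \<in> \<rat>" "b \<in> \<rat>" "x = a + b * s"
proof -
  define K where "K = {a + b * s | a b. a \<in> \<rat> \<and> b \<in> \<rat>}"
  have KI: "a + b * s \<in> K" if "a \<in> \<rat>" "b \<in> \<rat>" for a b using that by (auto simp: K_def)
  have "subfield K CC"
    unfolding subfield_CC_iff subring_CC_iff
  proof (intro conjI ballI)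
    show "1 \<in> K" using KI[of 1 0] by simp
    fix x assume "x \<in> K"
    then obtain a b where x: "a \<in> \<rat>" "b \<in> \<rat>" "x = a + b * s" unfolding K_def by blast
    \<comment> \<open>The norm of \<open>x\<close>; the inverse of \<open>x\<close> is its conjugate
      divided by \<open>d\<close>.\<close>
    define d where "d = a * a - of_nat l * (b * b)"
    have d: "d \<in> \<rat>" using x by (simp add: d_def)
    have xd: "x * (a - b * s) = d" unfolding d_def x(3) s2[symmetric] by (simp add: algebra_simps)
    show "inverse x \<in> K"
    proof (cases "x = 0")
      case True
      then show ?thesis using KI[of 0 0] by simp
    next
      case False
      have "d \<noteq> 0"
      proof
        assume "d = 0"
        then have "a + (- b) * s = 0" using xd False by simp
        then show False using rat_lin_indep[of a "- b"] x False by simp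
      qed
      then have "x * (a / d + (- b / d) * s) = 1" using xd by (simp add: field_simps)
      then have "inverse x = a / d + (- b / d) * s" by (rule inverse_unique)
      moreover have "a / d \<in> \<rat>" "- b / d \<in> \<rat>" using x(1,2) d by auto
      ultimately show ?thesis using KI by metis
    qed
    fix y assume "y \<in> K"
    then obtain c e where y: "c \<in> \<rat>" "e \<in> \<rat>" "y = c + e * s" unfolding K_def by blast
    have "x - y = (a - c) + (b - e) * s" using x y by (simp add: algebra_simps)
    then show "x - y \<in> K" using KI[of "a - c" "b - e"] x(1,2) y(1,2) by simp
    have "x * y = (a * c + of_nat l * (b * e)) + (a * e + b * c) * s"
      unfolding x(3) y(3) s2[symmetric] by (simp add: algebra_simps)
    then show "x * y \<in> K" using KI[of "a * c + of_nat l * (b * e)" "a * e + b * c"] x(1,2) y(1,2) by simp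
  qed
  moreover have "s \<in> K" using KI[of 0 1] by simp
  ultimately have "sqrt_field l \<subseteq> K"
    unfolding sqrt_field_def s_def
    using field.generate_field_min_subfield1[OF field_CC, of "{complex_of_real (sqrt (real l))}" K] by (simp add: s_def)
  then show ?thesis using assms that unfolding K_def by blast
qed

lemma sqrt_field_real: "sqrt_field l \<subseteq> \<real>"
proof
  fix x assume "x \<in> sqrt_field l"
  then obtain a b where "a \<in> \<rat>" "b \<in> \<rat>" "x = a + b * s" by (rule sqrt_field_elem)
  moreover have "\<rat> \<subseteq> (\<real> :: complex set)" using Rats_subset_subfield[of \<real>]
    by (auto simp: subfield_CC_iff subring_CC_iff)
  ultimately show "x \<in> \<real>" unfolding s_def by (auto intro!: Reals_add Reals_mult)
qed

text \<open>Conjugation, \<open>s\<close> to \<open>- s\<close>, is followed on rational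
  coordinates; evaluating an integer polynomial commutes with it.\<close>

lemma poly_conjugate:
  assumes p: "\<forall>i. coeff p i \<in> \<int>" and ab: "a \<in> \<rat>" "b \<in> \<rat>"
  shows "\<exists>A\<in>\<rat>. \<exists>B\<in>\<rat>. poly p (a + b * s) = A + B * s \<and> poly p (a - b * s) = A - B * s"
  using p
proof (induction p)
  case 0
  then show ?case by (auto intro!: bexI[of _ 0])
next
  case (pCons c p)
  have c: "c \<in> \<rat>" using spec[OF pCons.prems, of 0] Ints_subset_Rats by auto
  have "\<forall>i. coeff p i \<in> \<int>"
  proof
    fix i show "coeff p i \<in> \<int>" using spec[OF pCons.prems, of "Suc i"] by simp
  qed
  then obtain A B where AB: "A \<in> \<rat>" "B \<in> \<rat>" "poly p (a + b * s) = A + B * s" "poly p (a - b * s) = A - B * s"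
    using pCons.IH by blast
  show ?case
  proof (intro bexI conjI)
    show "poly (pCons c p) (a + b * s) = (c + (a * A + of_nat l * (b * B))) + (a * B + b * A) * s"
      "poly (pCons c p) (a - b * s) = (c + (a * A + of_nat l * (b * B))) - (a * B + b * A) * s"
      unfolding s2[symmetric] by (simp_all add: AB algebra_simps)
  qed (use c ab AB(1,2) in auto)
qed

lemma algebraic_int_conjugate:
  assumes "a \<in> \<rat>" "b \<in> \<rat>" "algebraic_int (a + b * s)"
  shows "algebraic_int (a - b * s)"
proof -
  obtain p where p: "lead_coeff p = 1" "\<forall>i. coeff p i \<in> \<int>" "poly p (a + b * s) = 0"
    using assms(3) by (auto elim: algebraic_int.cases)
  obtain A B where AB: "A \<in> \<rat>" "B \<in> \<rat>" "poly p (a + b * s) = A + B * s" "poly p (a - b * s) = A - B * s"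
    using poly_conjugate[OF p(2) assms(1,2)] by blast
  then have "poly p (a - b * s) = 0" using rat_lin_indep[of A B] p(3) by simp
  then show ?thesis using p by (intro algebraic_int.intros[of p]) auto
qed

lemma trace_norm_Ints:
  assumes "a \<in> \<rat>" "b \<in> \<rat>" "algebraic_int (a + b * s)"
  shows "2 * a \<in> \<int>" "a * a - of_nat l * (b * b) \<in> \<int>"
proof -
  note c = algebraic_int_conjugate[OF assms]
  have "(a + b * s) + (a - b * s) = 2 * a" by simp
  with algebraic_int_closed(3)[OF assms(3) c] have "algebraic_int (2 * a)" by simp
  then show "2 * a \<in> \<int>" using assms(1) by (intro rational_algebraic_int_is_int) auto
  have "(a + b * s) * (a - b * s) = a * a - of_nat l * (b * b)"
    unfolding s2[symmetric] by (simp add: algebra_simps)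
  with algebraic_int_closed(5)[OF assms(3) c] have "algebraic_int (a * a - of_nat l * (b * b))" by simp
  then show "a * a - of_nat l * (b * b) \<in> \<int>" using assms(1,2) by (intro rational_algebraic_int_is_int) auto
qed

lemma rat_square_Ints: "x \<in> \<rat> \<Longrightarrow> x ^ 2 \<in> \<int> \<Longrightarrow> (x::complex) \<in> \<int>"
  by (rule rational_algebraic_int_is_int, rule algebraic_int_root[of "x ^ 2" "Polynomial.monom 1 2"])
    (simp_all add: poly_monom degree_monom_eq int_imp_algebraic_int)

text \<open>Let \<open>t\<close> and \<open>N\<close> be trace and norm of the element. The norm of
  its square over \<open>p\<close> is \<open>(N / p)^2\<close>, so \<open>p\<close> divides
  \<open>N\<close>; the trace of its square over \<open>p\<close> is
  \<open>(t^2 - 2 * N) / p\<close>, so \<open>p\<close> divides \<open>t^2\<close>, hence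
  \<open>t\<close>.\<close>

lemma trace_divisible:
  assumes p: "Factorial_Ring.prime p" and ab: "a \<in> \<rat>" "b \<in> \<rat>" "algebraic_int (a + b * s)"
    and sq: "pdiv p ((a + b * s) ^ 2)"
  shows "2 * a / of_nat p \<in> \<int>"
proof -
  have p0: "(of_nat p :: complex) \<noteq> 0" using p by (auto simp: prime_gt_0_nat)
  define N where "N = a * a - of_nat l * (b * b)"
  define A where "A = (a * a + of_nat l * (b * b)) / of_nat p"
  define B where "B = 2 * a * b / of_nat p"
  have AB: "A \<in> \<rat>" "B \<in> \<rat>" "N \<in> \<rat>" using ab by (auto simp: A_def B_def N_def)
  have "(a + b * s) ^ 2 / of_nat p = A + B * s"
    unfolding A_def B_def s2[symmetric] using p0 by (simp add: field_simps power2_eq_square)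
  then have int: "algebraic_int (A + B * s)" using sq by simp
  have "A * A - of_nat l * (B * B) = (N / of_nat p) ^ 2"
    unfolding A_def B_def N_def using p0 by (simp add: field_simps power2_eq_square)
  then have "(N / of_nat p) ^ 2 \<in> \<int>" using trace_norm_Ints(2)[OF AB(1,2) int] by simp
  then have Np: "N / of_nat p \<in> \<int>" using AB(3) rat_square_Ints[of "N / of_nat p"] by simp
  have "(2 * a) ^ 2 / of_nat p = 2 * A + 2 * (N / of_nat p)"
  proof -
    have *: "(2 * a) ^ 2 = 2 * (a * a + of_nat l * (b * b)) + 2 * N"
      by (simp add: N_def power2_eq_square algebra_simps)
    show ?thesis unfolding A_def * add_divide_distrib[of "2 * _"] times_divide_eq_right ..
  qed
  also have "\<dots> \<in> \<int>"
    by (rule Ints_add[OF trace_norm_Ints(1)[OF AB(1,2) int] Ints_mult[OF Ints_numeral Np]])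
  finally obtain m where m: "(2 * a) ^ 2 / of_nat p = of_int m" by (auto elim: Ints_cases)
  obtain t where t: "2 * a = of_int t" using trace_norm_Ints(1)[OF ab] by (auto elim: Ints_cases)
  have "(of_int t :: complex) ^ 2 = of_nat p * of_int m" using m p0 unfolding t by (simp add: divide_eq_eq mult.commute)
  then have "(of_int (t ^ 2) :: complex) = of_int (int p * m)" by simp
  then have "t ^ 2 = int p * m" by (simp only: of_int_eq_iff)
  then have "int p dvd t ^ 2" by simp
  then have "int p dvd t" using p by (metis prime_dvd_power prime_nat_int_transfer)
  then obtain r where "t = int p * r" by blast
  then have "2 * a / of_nat p = of_int r" using t p0 by simp
  then show ?thesis by simp
qed

text \<open>Nilpotents modulo \<open>p\<close> lie in the radical of the trace form, whose discriminant is \<open>l\<close>.\<close>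

theorem reduced_mod_sqrt_field:
  assumes p: "Factorial_Ring.prime p" and "p \<noteq> l"
  shows "reduced_mod p (sqrt_field l)"
  unfolding reduced_mod_def
proof (intro ballI impI)
  fix z assume z: "z \<in> ints_of (sqrt_field l)" and z2: "pdiv p (z ^ 2)"
  have p0: "(of_nat p :: complex) \<noteq> 0" using p by (auto simp: prime_gt_0_nat)
  have zi: "algebraic_int z" using z by (simp add: ints_of_def)
  obtain u v where uv: "u \<in> \<rat>" "v \<in> \<rat>" "z = u + v * s" using z sqrt_field_elem by (auto simp: ints_of_def)
  \<comment> \<open>A product of \<open>z\<close> with an integral element again has its square
    divisible by \<open>p\<close>, so its trace is divisible by \<open>p\<close>.\<close>
  have tr: "2 * (u * c + of_nat l * (v * d)) / of_nat p \<in> \<int>"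
    if cd: "c \<in> \<rat>" "d \<in> \<rat>" "algebraic_int (c + d * s)" for c d
  proof -
    have zy: "z * (c + d * s) = (u * c + of_nat l * (v * d)) + (u * d + v * c) * s"
      unfolding uv(3) s2[symmetric] by (simp add: algebra_simps)
    have "(z * (c + d * s)) ^ 2 / of_nat p = (c + d * s) * (c + d * s) * (z ^ 2 / of_nat p)"
      by (simp add: power2_eq_square)
    then have "pdiv p ((z * (c + d * s)) ^ 2)" using z2 cd(3) algebraic_int_closed(5) by metis
    moreover have "algebraic_int (z * (c + d * s))" using zi cd(3) algebraic_int_closed(5) by metis
    ultimately show ?thesis unfolding zy using p uv cd by (intro trace_divisible) auto
  qed
  obtain m where m: "l = 1 + 4 * m"
  proof -
    have "l mod 4 = 1" using l4 by (simp add: cong_def)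
    then show ?thesis using that[of "l div 4"] by (metis mult_div_mod_eq add.commute)
  qed
  have lm: "(of_nat l :: complex) = 1 + 4 * of_nat m" by (subst m) simp
  have si: "algebraic_int s" unfolding s_def by auto
  \<comment> \<open>Integral because \<open>l\<close> is 1 modulo 4: \<open>w\<close> is a root of
    \<open>X^2 - X - m\<close>. On 1 and \<open>w\<close> the trace form has determinant
    \<open>2 * (1 + 2 * m) - 1 = l\<close>.\<close>
  define w where "w = (1 + s) / 2"
  have wi: "algebraic_int w"
  proof (rule algebraic_int.intros[of "[:- of_nat m, - 1, 1:]"])
    have "w * w - w = (s * s - 1) / 4" unfolding w_def by (simp add: field_simps)
    then have "w * w - w = of_nat m" unfolding s2 lm by simp
    then show "poly [:- of_nat m, - 1, 1:] w = 0" by (simp add: algebra_simps)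
  qed (auto simp: coeff_pCons split: nat.splits)
  have 1: "2 * u / of_nat p \<in> \<int>" using tr[of 1 0] by simp
  have 2: "(u + v * of_nat l) / of_nat p \<in> \<int>"
  proof -
    have "1 / 2 + 1 / 2 * s = w" by (simp add: w_def add_divide_distrib)
    then have "2 * (u * (1 / 2) + of_nat l * (v * (1 / 2))) / of_nat p \<in> \<int>" using wi by (intro tr) auto
    moreover have "2 * (u * (1 / 2) + of_nat l * (v * (1 / 2))) = u + v * of_nat l"
      unfolding distrib_left by simp
    ultimately show ?thesis by (simp only:)
  qed
  have l': "(of_nat l - s) / 2 = of_nat (2 * m + 1) - w" unfolding w_def lm by (simp add: field_simps)
  \<comment> \<open>\<open>u + v * l\<close> and \<open>2 * u\<close> are the traces of
    \<open>z * w\<close> and \<open>z\<close>. The factors \<open>s\<close> and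
    \<open>(l - s) / 2\<close> are \<open>l\<close> times the basis dual to \<open>w\<close> and 1
    under the trace form.\<close>
  have "z * of_nat l / of_nat p = (u + v * of_nat l) / of_nat p * s + 2 * u / of_nat p * ((of_nat l - s) / 2)"
  proof -
    have *: "z * of_nat l = (u + v * of_nat l) * s + 2 * u * ((of_nat l - s) / 2)"
      unfolding uv(3) by (simp add: algebra_simps)
    show ?thesis unfolding * add_divide_distrib[of "_ * s"] by (simp only: times_divide_eq_left)
  qed
  moreover have "algebraic_int ((u + v * of_nat l) / of_nat p * s + 2 * u / of_nat p * ((of_nat l - s) / 2))"
    unfolding l' by (intro algebraic_int_add_mult algebraic_int_closed(4) si wi algebraic_int_of_nat
        int_imp_algebraic_int[OF 1] int_imp_algebraic_int[OF 2])
  ultimately have zl: "algebraic_int (z * of_nat l / of_nat p)" by simp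
  \<comment> \<open>The factor \<open>l\<close> is removed, being invertible modulo
    \<open>p\<close>.\<close>
  have "Rings.coprime (int l) (int p)" using l p \<open>p \<noteq> l\<close> by (simp add: primes_coprime)
  then obtain a b where ab: "a * int l + b * int p = 1" using bezout_int[of "int l" "int p"] by auto
  then have ab': "(of_int a * of_nat l + of_int b * of_nat p :: complex) = 1"
    by (metis of_int_1 of_int_add of_int_mult of_int_of_nat_eq)
  have "z / of_nat p = (of_int a * of_nat l + of_int b * of_nat p) * z / of_nat p" unfolding ab' by simp
  also have "\<dots> = of_int a * (z * of_nat l / of_nat p) + of_int b * z"
    using p0 by (simp add: distrib_right add_divide_distrib)
  also have "algebraic_int \<dots>" by (intro algebraic_int_add_mult zl zi algebraic_int_of_int)
  finally show "pdiv p z" .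
qed

end

section \<open>Ramification in towers\<close>

lemma reduced_mod_unramified_ext:
  assumes E: "number_field E" and F: "number_field F" and EF: "E \<subseteq> F" and p: "Factorial_Ring.prime p"
    and red: "reduced_mod p E"
    and unr: "\<And>P. P \<in> finite_places E \<Longrightarrow> of_nat p \<in> P \<Longrightarrow> unramified_at_finite E F P"
  shows "reduced_mod p F"
proof (rule reduced_if_places_unramified[OF F p])
  fix Q assume QF: "Q \<in> finite_places F" "of_nat p \<in> Q"
  interpret place_over F Q p using F QF p by unfold_locales
  have Es: "subfield E CC" using E by (simp add: number_field_def)
  have "of_nat p \<in> Q \<inter> E" using QF(2) subring_CC_closed(8)[OF subfield_CC_subring[OF Es], of p] by blast
  then have "unramified_at_finite E F (Q \<inter> E)" using unr place_below[OF Es EF] by blast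
  then have "\<not> Q \<inter> E \<subseteq> ideal_prod CC Q Q" using QF(1) unfolding unramified_at_finite_iff[OF subfield_F] by blast
  then show "of_nat p \<notin> ideal_prod CC Q Q" by (rule not_in_square_of_unramified[OF E EF red])
qed

lemma prime_in_rational_place:
  assumes P: "P \<in> finite_places \<rat>"
  obtains p where "Factorial_Ring.prime p" "of_nat p \<in> P"
proof -
  note c = finite_placeD[OF subfield_Rats P]
  have Z: "\<int> \<subseteq> ints_of \<rat>" using Ints_subset_Rats by (auto simp: ints_of_def int_imp_algebraic_int)
  have *: "\<exists>p. Factorial_Ring.prime p \<and> of_nat p \<in> P" if "n > 0" "of_nat n \<in> P" for n
    using that
  proof (induction n rule: less_induct)
    case (less n)
    have "n \<noteq> 1" using less.prems c(5) by auto
    then obtain p where p: "Factorial_Ring.prime p" "p dvd n" using prime_factor_nat by blast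
    then obtain m where m: "n = p * m" by blast
    have "of_nat p \<in> P \<or> of_nat m \<in> P" using less.prems(2) Z unfolding m of_nat_mult by (intro c(6)) auto
    then show ?case
    proof
      assume "of_nat m \<in> P"
      moreover have "m < n" "m > 0" using less.prems(1) p(1) m prime_gt_1_nat[of p] by auto
      ultimately show ?thesis using less.IH by blast
    qed (use p in blast)
  qed
  obtain x where x: "x \<in> P" "x \<noteq> 0" using c(2,7) by blast
  have "x \<in> \<int>" using c(1)[OF x(1)] by (auto simp: ints_of_def intro: rational_algebraic_int_is_int)
  then obtain k where k: "x = of_int k" by (auto elim: Ints_cases)
  have "of_nat (nat \<bar>k\<bar>) \<in> P" using x k c(8)[OF x(1)] by (cases "k \<ge> 0") auto
  moreover have "nat \<bar>k\<bar> > 0" using x k by auto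
  ultimately show ?thesis using * that by blast
qed

text \<open>Reducedness descends from \<open>F\<close> to \<open>F'\<close>, and there it keeps
  \<open>p\<close> out of the square of each place above \<open>P\<close>.\<close>

lemma unramified_at_finite_of_reduced:
  assumes F: "number_field F" and F': "number_field F'" "F' \<subseteq> F" and P: "P \<in> finite_places \<rat>"
    and red: "\<And>p. Factorial_Ring.prime p \<Longrightarrow> of_nat p \<in> P \<Longrightarrow> reduced_mod p F"
  shows "unramified_at_finite \<rat> F' P"
proof -
  obtain p where pP: "Factorial_Ring.prime p" "of_nat p \<in> P" using prime_in_rational_place[OF P] .
  have s: "subfield F' CC" using F' by (simp add: number_field_def)
  have "\<not> P \<subseteq> ideal_prod CC Q Q" if QF: "Q \<in> finite_places F'" "Q \<inter> \<rat> = P" for Q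
  proof -
    interpret place_over F' Q p using F'(1) QF pP by unfold_locales auto
    have "of_nat p \<notin> ideal_prod CC Q Q"
      by (rule not_in_square_of_reduced) (rule reduced_mod_subfield[OF red[OF pP] F'(2)])
    then show ?thesis using pP(2) by blast
  qed
  then show ?thesis unfolding unramified_at_finite_iff[OF s] by blast
qed

section \<open>Transport along embeddings\<close>

lemma nat_pow_CC [simp]: "x [^]\<^bsub>CC\<^esub> (n::nat) = x ^ n"
  by (induction n) (simp_all add: nat_pow_def)

text \<open>The list polynomials of HOL-Algebra begin with the leading coefficient, the argument of
  \<open>Poly\<close> with the constant term; hence \<open>rev\<close>.\<close>

lemma eval_CC: "ring.eval CC p x = poly (Poly (rev p)) x"
proof (induction p)
  case Nil
  then show ?case using ring.eval.simps(1)[OF ring_CC] by simp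
next
  case (Cons c p)
  have "ring.eval CC (c # p) x = c * x ^ length p + ring.eval CC p x"
    using ring.eval.simps(2)[OF ring_CC, of c p] by simp
  then show ?case using Cons by (simp add: Poly_append Poly_snoc poly_monom mult.commute)
qed

lemma algebraic_CC_iff:
  assumes E: "subfield E CC"
  shows "ring.algebraic CC E x \<longleftrightarrow> alg_over E x"
proof -
  interpret domain CC by (rule domain_CC)
  have S: "subring E CC" using E by (rule subfield_CC_subring)
  show ?thesis
  proof
    assume "algebraic E x"
    then obtain p where p: "p \<in> carrier (E[X]\<^bsub>CC\<^esub>)" "p \<noteq> []" "eval p x = \<zero>\<^bsub>CC\<^esub>"
      using algebraicE[OF S, of x] by (auto simp: over_def)
    have pE: "set p \<subseteq> E" and hd: "hd p \<noteq> 0"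
      using p(1,2) by (auto simp: univ_poly_carrier[symmetric] polynomial_def)
    show "alg_over E x"
      unfolding alg_over_def
    proof (intro bexI conjI)
      show "poly (Poly (rev p)) x = 0" using p(3) by (simp add: eval_CC)
      show "Poly (rev p) \<noteq> 0"
      proof
        assume "Poly (rev p) = 0"
        then obtain n where "rev p = replicate n 0" by (auto simp: Poly_eq_0)
        then have "p = replicate n 0" by (metis rev_replicate rev_rev_ident)
        then show False using hd p(2) by (cases n) auto
      qed
      have "nth_default 0 (rev p) i \<in> E" for i
        using pE subring_CC_closed(1)[OF S] by (metis nth_default_def nth_mem set_rev subsetD)
      then show "Poly (rev p) \<in> polys_over E" by (simp add: polys_over_def)
    qed
  next
    assume "alg_over E x"
    then obtain p where p: "p \<in> polys_over E" "p \<noteq> 0" "poly p x = 0" by (auto simp: alg_over_def)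
    have "rev (coeffs p) \<in> carrier (E[X]\<^bsub>CC\<^esub>)"
      unfolding univ_poly_carrier[symmetric] polynomial_def
    proof (intro disjI2 conjI)
      show "set (rev (coeffs p)) \<subseteq> E" using p(1) by (auto simp: coeffs_def polys_over_def)
      show "hd (rev (coeffs p)) \<noteq> \<zero>\<^bsub>CC\<^esub>"
        using p(2) by (simp add: hd_rev last_coeffs_eq_coeff_degree)
    qed
    moreover have "rev (coeffs p) \<noteq> []" using p(2) by simp
    moreover have "eval (rev (coeffs p)) x = \<zero>\<^bsub>CC\<^esub>" using p(3) by (simp add: eval_CC)
    ultimately have "(algebraic over E) x" by (rule algebraicI)
    then show "algebraic E x" by (simp add: over_def)
  qed
qed

lemma galois_ext_iff:
  "galois_ext E F \<longleftrightarrow> subfield E CC \<and> subfield F CC \<and> E \<subseteq> F \<and> (\<forall>x\<in>F. alg_over E x) \<and>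
    (\<forall>x\<in>F. (\<forall>\<sigma>\<in>carrier (Gal F E). \<sigma> x = x) \<longrightarrow> x \<in> E)"
proof (cases "subfield E CC \<and> subfield F CC \<and> E \<subseteq> F")
  case True
  have "{x \<in> F. \<forall>\<sigma>\<in>carrier (Gal F E). \<sigma> x = x} = E \<longleftrightarrow>
      (\<forall>x\<in>F. (\<forall>\<sigma>\<in>carrier (Gal F E). \<sigma> x = x) \<longrightarrow> x \<in> E)"
    using True Gal_apply(4)[of F _ E] by blast
  then show ?thesis using True by (simp add: galois_ext_def algebraic_CC_iff)
next
  case False
  then show ?thesis by (auto simp: galois_ext_def)
qed

lemma (in group) comm_group_of_exponent_2:
  assumes "\<And>x. x \<in> carrier G \<Longrightarrow> x \<otimes> x = \<one>"
  shows "comm_group G"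
proof (rule group_comm_groupI)
  fix x y assume xy: "x \<in> carrier G" "y \<in> carrier G"
  have i: "inv z = z" if "z \<in> carrier G" for z using assms[OF that] that by (simp add: inv_equality)
  have "x \<otimes> y = inv (x \<otimes> y)" using i[of "x \<otimes> y"] xy by (metis m_closed)
  also have "\<dots> = inv y \<otimes> inv x" using xy by (rule inv_mult_group)
  also have "\<dots> = y \<otimes> x" using xy by (simp only: i)
  finally show "x \<otimes> y = y \<otimes> x" .
qed

text \<open>Exponent 2 implies commutativity, so both group conditions turn into a single pointwise
  one that is easy to transport.\<close>

lemma elementary_abelian_2_iff:
  "elementary_abelian_ext 2 E F \<longleftrightarrow>
    galois_ext E F \<and> (\<forall>\<sigma>\<in>carrier (Gal F E). \<forall>x\<in>F. \<sigma> (\<sigma> x) = x)"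
proof (cases "galois_ext E F")
  case True
  then have F: "subfield F CC" "E \<subseteq> F" by (auto simp: galois_ext_def)
  interpret group "Gal F E" by (rule group_Gal[OF F])
  have sq: "\<sigma> [^]\<^bsub>Gal F E\<^esub> (2::nat) = \<sigma> \<otimes>\<^bsub>Gal F E\<^esub> \<sigma>" if "\<sigma> \<in> carrier (Gal F E)" for \<sigma>
    using that by (simp add: numeral_2_eq_2)
  have iff: "\<sigma> \<otimes>\<^bsub>Gal F E\<^esub> \<sigma> = \<one>\<^bsub>Gal F E\<^esub> \<longleftrightarrow> (\<forall>x\<in>F. \<sigma> (\<sigma> x) = x)" if s: "\<sigma> \<in> carrier (Gal F E)" for \<sigma>
  proof
    assume "\<sigma> \<otimes>\<^bsub>Gal F E\<^esub> \<sigma> = \<one>\<^bsub>Gal F E\<^esub>"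
    then show "\<forall>x\<in>F. \<sigma> (\<sigma> x) = x" using Gal_apply(5)[OF F(1) s s, of _ E] by (simp add: Gal_one)
  next
    assume "\<forall>x\<in>F. \<sigma> (\<sigma> x) = x"
    then show "\<sigma> \<otimes>\<^bsub>Gal F E\<^esub> \<sigma> = \<one>\<^bsub>Gal F E\<^esub>"
      by (intro Gal_eqI[OF F(1) m_closed[OF s s] one_closed]) (simp add: Gal_apply(5)[OF F(1) s s] Gal_one)
  qed
  show ?thesis using True sq iff comm_group_of_exponent_2
    by (auto simp: elementary_abelian_ext_def)
qed (simp add: elementary_abelian_ext_def)

section \<open>Images of number fields, places and elementary abelian extensions under an
  embedding\<close>

lemma number_field_emb_image:
  assumes F: "number_field F" and j: "field_emb F j"
  shows "number_field (j ` F)"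
proof -
  have Fs: "subfield F CC" using F by (simp add: number_field_def)
  have S: "subring F CC" using Fs by (rule subfield_CC_subring)
  interpret R: ring CC by (rule ring_CC)
  have "R.dimension n K (j ` E)" if "R.dimension n K E" "K = \<rat>" "E \<subseteq> F" for n K E
    using that
  proof (induction rule: R.dimension.induct)
    case (zero_dim K)
    then show ?case using R.dimension.zero_dim[of K] field_emb_simps(1)[OF j S] by simp
  next
    case (Suc_dim v E n K)
    have line: "R.line_extension K v E = {k * v + u | k u. k \<in> \<rat> \<and> u \<in> E}"
      by (rule Set.set_eqI) (simp add: R.line_extension_mem_iff Suc_dim.prems(1), blast)
    have lineI: "k * v + u \<in> R.line_extension K v E" if "k \<in> \<rat>" "u \<in> E" for k u
      using that unfolding line by blast
    note dim = \<open>R.dimension n K E\<close>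
    have "0 \<in> E"
      using R.space_subgroup_props(2)[OF _ dim] subfield_Rats Suc_dim.prems(1) by simp
    then have vF: "v \<in> F"
    proof -
      have "1 * v + 0 \<in> R.line_extension K v E" using \<open>0 \<in> E\<close> by (intro lineI) auto
      then show ?thesis using Suc_dim.prems(2) by auto
    qed
    have EF: "E \<subseteq> F"
    proof
      fix u assume "u \<in> E"
      then have "0 * v + u \<in> R.line_extension K v E" by (intro lineI) auto
      then show "u \<in> F" using Suc_dim.prems(2) by auto
    qed
    have "j v \<notin> j ` E" using Suc_dim.hyps vF EF field_emb_inj_on[OF j Fs] by (auto dest: inj_onD)
    then have "R.dimension (Suc n) K (R.line_extension K (j v) (j ` E))"
      using Suc_dim.IH[OF Suc_dim.prems(1) EF] by (intro R.dimension.Suc_dim) auto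
    \<comment> \<open>Embeddings fix the rational coefficients, so each one-dimensional step is
      carried to a one-dimensional step.\<close>
    moreover have "R.line_extension K (j v) (j ` E) = j ` R.line_extension K v E"
    proof -
      have jk: "j (k * v + u) = k * j v + j u" if "k \<in> \<rat>" "u \<in> E" for k u
      proof -
        have "k \<in> F" "u \<in> F" using that EF Rats_subset_subfield[OF Fs] by auto
        then show ?thesis using vF that(1)
          by (simp add: field_embD[OF j] field_emb_Rats[OF j Fs] subring_CC_closed(5)[OF S])
      qed
      have l1: "R.line_extension K (j v) (j ` E) = {k * j v + j u | k u. k \<in> \<rat> \<and> u \<in> E}"
        by (rule Set.set_eqI) (simp add: R.line_extension_mem_iff Suc_dim.prems(1), blast)
      show ?thesis
        unfolding line l1
      proof (intro equalityI subsetI)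
        fix x assume "x \<in> {k * j v + j u | k u. k \<in> \<rat> \<and> u \<in> E}"
        then obtain k u where ku: "k \<in> \<rat>" "u \<in> E" "x = k * j v + j u" by auto
        have "x = j (k * v + u)" using ku(3) jk[OF ku(1,2), symmetric] by (rule trans)
        with ku(1,2) show "x \<in> j ` {k * v + u | k u. k \<in> \<rat> \<and> u \<in> E}" by blast
      next
        fix x assume "x \<in> j ` {k * v + u | k u. k \<in> \<rat> \<and> u \<in> E}"
        then obtain k u where ku: "k \<in> \<rat>" "u \<in> E" "x = j (k * v + u)" by auto
        have "x = k * j v + j u" using ku(3) jk[OF ku(1,2)] by (rule trans)
        then show "x \<in> {k * j v + j u | k u. k \<in> \<rat> \<and> u \<in> E}" using ku(1,2) by blast
      qed
    qed
    ultimately show ?case by simp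
  qed
  then have "R.finite_dimension \<rat> (j ` F)"
    using F unfolding number_field_def R.finite_dimension_def by blast
  then show ?thesis using subfield_emb_image[OF j Fs] by (simp add: number_field_def)
qed

lemma ints_of_emb_image:
  assumes F: "subfield F CC" and j: "field_emb F j"
  shows "ints_of (j ` F) = j ` ints_of F"
proof -
  have S: "subring F CC" using F by (rule subfield_CC_subring)
  have "algebraic_int (j x) \<longleftrightarrow> algebraic_int x" if x: "x \<in> F" for x
  proof
    assume "algebraic_int (j x)"
    then have "algebraic_int (inv_into F j (j x))"
      using emb_algebraic_int[OF field_emb_inv_into[OF j F] subring_emb_image[OF j S]] x by blast
    then show "algebraic_int x" using inv_into_f_f[OF field_emb_inj_on[OF j F] x] by simp
  qed (rule emb_algebraic_int[OF j S x])
  then show ?thesis by (auto simp: ints_of_def)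
qed

lemma finite_place_emb_image:
  assumes F: "subfield F CC" and j: "field_emb F j" and Q: "Q \<in> finite_places F"
  shows "j ` Q \<in> finite_places (j ` F)"
proof -
  note S = subfield_CC_subring[OF F]
  note c = finite_placeD[OF F Q]
  have O: "ints_of (j ` F) = j ` ints_of F" using ints_of_emb_image[OF F j] .
  have OF: "ints_of F \<subseteq> F" by (auto simp: ints_of_def)
  have QF: "Q \<subseteq> F" using c(1) OF by blast
  have inj: "x \<in> Q" if "j x \<in> j ` Q" "x \<in> F" for x
    using that QF field_emb_inj_on[OF j F] by (auto dest: inj_onD)
  show ?thesis
    unfolding finite_places_iff[OF subfield_emb_image[OF j F]] O
  proof (intro conjI)
    show "j ` Q \<subseteq> j ` ints_of F" using c(1) by blast
    show "0 \<in> j ` Q" using c(2) field_emb_simps(1)[OF j S] by (metis imageI)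
    show "\<forall>x\<in>j ` Q. \<forall>y\<in>j ` Q. x + y \<in> j ` Q"
    proof clarify
      fix x y assume "x \<in> Q" "y \<in> Q"
      moreover have "j x + j y = j (x + y)" using calculation QF by (intro field_embD(2)[OF j, symmetric]) auto
      ultimately show "j x + j y \<in> j ` Q" using c(3)[of x y] by simp
    qed
    show "\<forall>a\<in>j ` ints_of F. \<forall>x\<in>j ` Q. a * x \<in> j ` Q"
    proof clarify
      fix x y assume "x \<in> ints_of F" "y \<in> Q"
      moreover have "j x * j y = j (x * y)" using calculation QF OF by (intro field_embD(3)[OF j, symmetric]) auto
      ultimately show "j x * j y \<in> j ` Q" using c(4)[of x y] by simp
    qed
    show "1 \<notin> j ` Q" using inj[of 1] c(5) field_embD(1)[OF j] subring_CC_closed(2)[OF S] by auto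
    show "\<forall>a\<in>j ` ints_of F. \<forall>b\<in>j ` ints_of F. a * b \<in> j ` Q \<longrightarrow> a \<in> j ` Q \<or> b \<in> j ` Q"
    proof (intro ballI impI)
      fix a b assume "a \<in> j ` ints_of F" "b \<in> j ` ints_of F" and ab: "a * b \<in> j ` Q"
      then obtain x y where xy: "x \<in> ints_of F" "y \<in> ints_of F" "j x * j y \<in> j ` Q" "a = j x" "b = j y" by auto
      then have "x \<in> F" "y \<in> F" using OF by auto
      moreover have "j x * j y = j (x * y)" using calculation by (intro field_embD(3)[OF j, symmetric]) auto
      ultimately have "x * y \<in> Q" using inj[of "x * y"] xy(3) subring_CC_closed(5)[OF S, of x y] by simp
      then show "a \<in> j ` Q \<or> b \<in> j ` Q" using c(6)[OF xy(1,2)] xy(4,5) by blast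
    qed
    show "j ` Q \<noteq> {0}"
    proof
      assume j0: "j ` Q = {0}"
      have "x = 0" if "x \<in> Q" for x
      proof -
        have "j x = 0" using j0 that by blast
        then show ?thesis using field_emb_eq_0_iff[OF j F, of x] QF that by blast
      qed
      then show False using c(2,7) by blast
    qed
  qed
qed

lemma ideal_prod_emb_image:
  assumes F: "subfield F CC" and j: "field_emb F j" and Q: "Q \<subseteq> F" and x: "x \<in> ideal_prod CC Q Q"
  shows "x \<in> F \<and> j x \<in> ideal_prod CC (j ` Q) (j ` Q)"
  using x
proof induction
  case (prod a b)
  then have "a \<in> F" "b \<in> F" using Q by auto
  moreover have "j a * j b \<in> ideal_prod CC (j ` Q) (j ` Q)"
    using ideal_prod.prod[of "j a" "j ` Q" "j b" "j ` Q" CC] prod by simp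
  ultimately show ?case using field_embD(3)[OF j, of a b] subring_CC_closed(5)[OF subfield_CC_subring[OF F], of a b] by simp
next
  case (sum a b)
  then have "j a + j b \<in> ideal_prod CC (j ` Q) (j ` Q)"
    using ideal_prod.sum[of "j a" CC "j ` Q" "j ` Q" "j b"] by simp
  then show ?case using sum field_embD(2)[OF j, of a b] subring_CC_closed(3)[OF subfield_CC_subring[OF F], of a b] by simp
qed

lemma unramified_at_finite_emb:
  assumes F: "subfield F CC" and j: "field_emb F j" and E: "E \<subseteq> F" "j ` E = E"
    and unr: "unramified_at_finite E (j ` F) (j ` P)"
  shows "unramified_at_finite E F P"
  unfolding unramified_at_finite_iff[OF F]
proof (intro ballI impI notI)
  fix Q assume Q: "Q \<in> finite_places F" "Q \<inter> E = P" "P \<subseteq> ideal_prod CC Q Q"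
  have QF: "Q \<subseteq> F" using finite_placeD(1)[OF F Q(1)] by (auto simp: ints_of_def)
  have "j ` Q \<inter> E = j ` P"
    using inj_on_image_Int[OF field_emb_inj_on[OF j F] QF E(1)] E(2) Q(2) by simp
  then have "\<not> j ` P \<subseteq> ideal_prod CC (j ` Q) (j ` Q)"
    using unr finite_place_emb_image[OF F j Q(1)]
    unfolding unramified_at_finite_iff[OF subfield_emb_image[OF j F]] by blast
  moreover have "j ` P \<subseteq> ideal_prod CC (j ` Q) (j ` Q)"
    using Q(3) ideal_prod_emb_image[OF F j QF] by blast
  ultimately show False by blast
qed

text \<open>The condition ranges over number fields inside the extension; these are pulled back into
  \<open>M\<close> by the inverse \<open>j\<close> of \<open>\<sigma>\<close>. As
  \<open>\<sigma>\<close> maps \<open>E\<close> onto itself but may move its elements, the places of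
  \<open>E\<close> are permuted.\<close>

lemma unramified_outside_emb_image:
  assumes E: "subfield E CC" and M: "subfield M CC" and EM: "E \<subseteq> M" and \<sigma>: "field_emb M \<sigma>" "\<sigma> ` E = E"
    and unr: "unramified_outside S E M"
  shows "unramified_outside S E (\<sigma> ` M)"
  unfolding unramified_outside_def
proof (intro allI impI)
  fix F assume F: "number_field F \<and> E \<subseteq> F \<and> F \<subseteq> \<sigma> ` M"
  then have Fs: "subfield F CC" by (simp add: number_field_def)
  define j where "j = inv_into M \<sigma>"
  have inj: "inj_on \<sigma> M" using field_emb_inj_on[OF \<sigma>(1) M] .
  have js: "j (\<sigma> x) = x" if "x \<in> M" for x using inv_into_f_f[OF inj that] by (simp add: j_def)
  have jM: "field_emb (\<sigma> ` M) j" unfolding j_def by (rule field_emb_inv_into[OF \<sigma>(1) M])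
  have j: "field_emb F j" using field_emb_mono[OF jM] F by blast
  have jE: "j ` E = E"
  proof -
    have "j ` (\<sigma> ` E) = E" unfolding image_image using js EM by force
    then show ?thesis using \<sigma>(2) by simp
  qed
  have "number_field (j ` F)" using number_field_emb_image[OF _ j] F by blast
  moreover have "E \<subseteq> j ` F" using jE F by blast
  moreover have "j ` F \<subseteq> M" using F js by fastforce
  ultimately have *: "(\<forall>P\<in>finite_places E.
         (\<forall>p. Factorial_Ring.prime p \<and> Finite_Place p \<in> S \<longrightarrow> of_nat p \<notin> P) \<longrightarrow> unramified_at_finite E (j ` F) P) \<and>
      (Infinite_Place \<notin> S \<longrightarrow> unramified_at_infinity E (j ` F))"
    using unr unfolding unramified_outside_def by blast
  have jEe: "field_emb E j" using field_emb_mono[OF j] F by blast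
  show "(\<forall>P\<in>finite_places E.
         (\<forall>p. Factorial_Ring.prime p \<and> Finite_Place p \<in> S \<longrightarrow> of_nat p \<notin> P) \<longrightarrow> unramified_at_finite E F P) \<and>
      (Infinite_Place \<notin> S \<longrightarrow> unramified_at_infinity E F)"
  proof (intro conjI ballI impI)
    fix P assume P: "P \<in> finite_places E" and out: "\<forall>p. Factorial_Ring.prime p \<and> Finite_Place p \<in> S \<longrightarrow> of_nat p \<notin> P"
    have PE: "P \<subseteq> E" using finite_placeD(1)[OF E P] by (auto simp: ints_of_def)
    have "j ` P \<in> finite_places E" using finite_place_emb_image[OF E jEe P] jE by simp
    \<comment> \<open>Rational primes are fixed by \<open>j\<close>, so a permuted place lies above
      the same prime and the exemption by \<open>S\<close> is respected.\<close>
    moreover have "of_nat p \<notin> j ` P" if "of_nat p \<notin> P" for p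
    proof
      assume "of_nat p \<in> j ` P"
      then obtain x where x: "x \<in> P" "j x = of_nat p" by auto
      have "j (of_nat p) = of_nat p" using field_emb_simps(6)[OF jEe subfield_CC_subring[OF E]] .
      then have "x = of_nat p" using inj_onD[OF field_emb_inj_on[OF jEe E], of x "of_nat p"] x PE
          subring_CC_closed(8)[OF subfield_CC_subring[OF E]] by auto
      then show False using x that by simp
    qed
    ultimately have "unramified_at_finite E (j ` F) (j ` P)" using * out by blast
    then show "unramified_at_finite E F P"
      using unramified_at_finite_emb[OF Fs j _ jE] F by blast
  next
    assume "Infinite_Place \<notin> S"
    then have inf: "unramified_at_infinity E (j ` F)" using * by blast
    show "unramified_at_infinity E F"
      unfolding unramified_at_infinity_def ring_hom_CC_iff
    proof (intro ballI impI)
      fix \<tau> assume \<tau>: "\<tau> \<in> ring_hom (sub_CC F) CC" and real: "\<tau> ` E \<subseteq> \<real>"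
      then have \<tau>: "field_emb F \<tau>" by (simp add: ring_hom_CC_iff)
      have sF: "\<sigma> (j x) = x" if "x \<in> F" for x using F that f_inv_into_f[of x \<sigma> M] by (auto simp: j_def)
      define \<rho> where "\<rho> = (\<lambda>x. \<tau> (\<sigma> x))"
      have "field_emb (j ` F) \<rho>" unfolding \<rho>_def
      proof (rule field_emb_compose[where g = \<sigma> and h = \<tau>])
        show "field_emb (j ` F) \<sigma>" using field_emb_mono[OF \<sigma>(1) \<open>j ` F \<subseteq> M\<close>] .
        show "\<sigma> ` j ` F \<subseteq> F" using sF by force
      qed (rule \<tau>)
      moreover have "\<rho> ` E \<subseteq> \<real>" using real \<sigma>(2) unfolding \<rho>_def by blast
      ultimately have "\<rho> ` j ` F \<subseteq> \<real>"
        using inf by (simp add: unramified_at_infinity_def ring_hom_CC_iff)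
      then show "\<tau> ` F \<subseteq> \<real>" using sF unfolding \<rho>_def by force
    qed
  qed
qed

text \<open>Conjugation by \<open>\<sigma>\<close> exchanges the automorphisms over \<open>E\<close>
  of \<open>M\<close> and of its image. It is enough that \<open>\<sigma>\<close> maps
  \<open>E\<close> onto itself: fixed elements and coefficients of polynomials then stay in
  \<open>E\<close>.\<close>

lemma elementary_abelian_emb_image:
  assumes EM: "elementary_abelian_ext 2 E M" and \<sigma>: "field_emb M \<sigma>" "\<sigma> ` E = E"
  shows "elementary_abelian_ext 2 E (\<sigma> ` M)"
proof -
  have g: "galois_ext E M" and sq: "\<And>\<tau> x. \<tau> \<in> carrier (Gal M E) \<Longrightarrow> x \<in> M \<Longrightarrow> \<tau> (\<tau> x) = x"
    using EM by (auto simp: elementary_abelian_2_iff)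
  have E: "subfield E CC" and M: "subfield M CC" and sub: "E \<subseteq> M" and alg: "\<And>x. x \<in> M \<Longrightarrow> alg_over E x"
    and fixed: "\<And>x. x \<in> M \<Longrightarrow> (\<And>\<tau>. \<tau> \<in> carrier (Gal M E) \<Longrightarrow> \<tau> x = x) \<Longrightarrow> x \<in> E"
    using g unfolding galois_ext_iff by blast+
  note SM = subfield_CC_subring[OF M]
  have M': "subfield (\<sigma> ` M) CC" using subfield_emb_image[OF \<sigma>(1) M] .
  define j where "j = inv_into M \<sigma>"
  have js: "j (\<sigma> x) = x" if "x \<in> M" for x
    using inv_into_f_f[OF field_emb_inj_on[OF \<sigma>(1) M] that] by (simp add: j_def)
  have jM: "field_emb (\<sigma> ` M) j" unfolding j_def by (rule field_emb_inv_into[OF \<sigma>(1) M])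
  have jE: "j x \<in> E" "\<sigma> (j x) = x" if "x \<in> E" for x
    using that \<sigma>(2) js sub by (metis imageE subsetD)+
  have sE: "\<sigma> x \<in> E" if "x \<in> E" for x using that \<sigma>(2) by blast
  have EM': "E \<subseteq> \<sigma> ` M" using \<sigma>(2) sub by blast
  have conj: "restrict (\<lambda>y. \<sigma> (\<tau> (j y))) (\<sigma> ` M) \<in> carrier (Gal (\<sigma> ` M) E)" if t: "\<tau> \<in> carrier (Gal M E)" for \<tau>
  proof (rule Gal_restrict_mem[OF M' _ _ EM'])
    note tt = Gal_apply[OF M t]
    have "field_emb (\<sigma> ` M) (\<lambda>y. \<tau> (j y))"
      by (rule field_emb_compose[OF jM tt(2)]) (use js in auto)
    then show "field_emb (\<sigma> ` M) (\<lambda>y. \<sigma> (\<tau> (j y)))"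
      by (rule field_emb_compose[OF _ \<sigma>(1)]) (use js tt in auto)
    have "(\<lambda>y. \<sigma> (\<tau> (j y))) ` \<sigma> ` M = \<sigma> ` \<tau> ` M" unfolding image_image using js by (intro image_cong) auto
    then show "(\<lambda>y. \<sigma> (\<tau> (j y))) ` \<sigma> ` M = \<sigma> ` M" using tt(3) by simp
    show "\<sigma> (\<tau> (j x)) = x" if "x \<in> E" for x using tt(4)[of "j x"] jE[OF that] by simp
  qed
  have conj': "restrict (\<lambda>x. j (\<tau> (\<sigma> x))) M \<in> carrier (Gal M E)" if t: "\<tau> \<in> carrier (Gal (\<sigma> ` M) E)" for \<tau>
  proof (rule Gal_restrict_mem[OF M _ _ sub])
    note tt = Gal_apply[OF M' t]
    have "field_emb M (\<lambda>y. \<tau> (\<sigma> y))"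
      by (rule field_emb_compose[OF \<sigma>(1) tt(2)]) auto
    then show "field_emb M (\<lambda>x. j (\<tau> (\<sigma> x)))"
      by (rule field_emb_compose[OF _ jM]) (use tt in auto)
    have "(\<lambda>x. j (\<tau> (\<sigma> x))) ` M = j ` \<tau> ` \<sigma> ` M" by (simp add: image_image)
    also have "\<dots> = j ` \<sigma> ` M" using tt(3) by simp
    also have "\<dots> = M" unfolding image_image using js by force
    finally show "(\<lambda>x. j (\<tau> (\<sigma> x))) ` M = M" .
    show "j (\<tau> (\<sigma> x)) = x" if "x \<in> E" for x using tt(4)[OF sE[OF that]] js sub that by auto
  qed
  have "alg_over E (\<sigma> x)" if x: "x \<in> M" for x
  proof -
    obtain p where p: "p \<in> polys_over E" "p \<noteq> 0" "poly p x = 0" using alg[OF x] by (auto simp: alg_over_def)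
    have pM: "p \<in> polys_over M" using p(1) polys_over_mono[OF sub] by blast
    have "map_poly \<sigma> p \<in> polys_over E"
      using p(1) sE field_emb_simps(1)[OF \<sigma>(1) SM] by (auto simp: polys_over_def coeff_map_poly)
    moreover have "map_poly \<sigma> p \<noteq> 0"
    proof
      assume "map_poly \<sigma> p = 0"
      then have "\<sigma> (lead_coeff p) = 0"
        using field_emb_simps(1)[OF \<sigma>(1) SM] by (metis coeff_0 coeff_map_poly)
      then have "lead_coeff p = 0" using field_emb_eq_0_iff[OF \<sigma>(1) M] polys_overD[OF pM] by blast
      then show False using p(2) by simp
    qed
    moreover have "poly (map_poly \<sigma> p) (\<sigma> x) = 0"
      using emb_poly[OF \<sigma>(1) SM pM x] p(3) field_emb_simps(1)[OF \<sigma>(1) SM] by simp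
    ultimately show ?thesis by (auto simp: alg_over_def)
  qed
  moreover have "x \<in> E" if x: "x \<in> \<sigma> ` M" "\<forall>\<tau>\<in>carrier (Gal (\<sigma> ` M) E). \<tau> x = x" for x
  proof -
    obtain y where y: "y \<in> M" "x = \<sigma> y" using x(1) by blast
    have "\<tau> y = y" if t: "\<tau> \<in> carrier (Gal M E)" for \<tau>
    proof -
      have "\<sigma> (\<tau> (j (\<sigma> y))) = \<sigma> y" using bspec[OF x(2) conj[OF t]] x(1) y by simp
      then have "\<sigma> (\<tau> y) = \<sigma> y" using js[OF y(1)] by simp
      then show ?thesis using field_emb_inj_on[OF \<sigma>(1) M] Gal_apply(1)[OF M t y(1)] y(1) by (auto dest: inj_onD)
    qed
    then have "y \<in> E" using fixed y(1) by blast
    then show ?thesis using sE y(2) by blast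
  qed
  ultimately have "galois_ext E (\<sigma> ` M)" unfolding galois_ext_iff using E M' EM' by blast
  moreover have "\<tau> (\<tau> x) = x" if t: "\<tau> \<in> carrier (Gal (\<sigma> ` M) E)" and x: "x \<in> \<sigma> ` M" for \<tau> x
  proof -
    obtain y where y: "y \<in> M" "x = \<sigma> y" using x by blast
    note tt = Gal_apply[OF M' t]
    have jm: "j z \<in> M" "\<sigma> (j z) = z" if "z \<in> \<sigma> ` M" for z using that js by auto
    have "j (\<tau> (\<sigma> (j (\<tau> (\<sigma> y))))) = y"
      using sq[OF conj'[OF t] y(1)] jm(1)[OF tt(1)] y by simp
    then have "j (\<tau> (\<tau> x)) = j x" using jm(2)[OF tt(1)[OF x]] y js by simp
    then show ?thesis using field_emb_inj_on[OF jM M'] tt(1)[OF tt(1)[OF x]] x by (auto dest: inj_onD)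
  qed
  ultimately show ?thesis by (simp add: elementary_abelian_2_iff)
qed

text \<open>The two structures may have different record types, such as the additive monoid of a
  module and a Galois group.\<close>

lemma subgroup_cong:
  fixes A :: "('a, 'b) monoid_scheme" and B :: "('a, 'c) monoid_scheme"
  assumes "carrier A = carrier B" "monoid.mult A = monoid.mult B" "one A = one B"
  shows "subgroup U A \<longleftrightarrow> subgroup U B"
  using assms by (simp add: subgroup_def m_inv_def)

section \<open>The Galois group of the maximal elementary abelian extension\<close>

locale tower =
  fixes S :: "rat_place set" and L M :: "complex set"
  assumes galL: "galois_ext \<rat> L" and finL: "finite (carrier (Gal L \<rat>))"
    and maxM: "is_max_elementary_ext 2 S L M"
begin

lemma sL: "subfield L CC" and sM: "subfield M CC" and LM: "L \<subseteq> M"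
  and algM: "x \<in> M \<Longrightarrow> alg_over L x"
  and fixedM: "x \<in> M \<Longrightarrow> (\<And>\<sigma>. \<sigma> \<in> carrier (Gal M L) \<Longrightarrow> \<sigma> x = x) \<Longrightarrow> x \<in> L"
  and fixedL: "x \<in> L \<Longrightarrow> (\<And>\<sigma>. \<sigma> \<in> carrier (Gal L \<rat>) \<Longrightarrow> \<sigma> x = x) \<Longrightarrow> x \<in> \<rat>"
  and sqM: "\<sigma> \<in> carrier (Gal M L) \<Longrightarrow> x \<in> M \<Longrightarrow> \<sigma> (\<sigma> x) = x"
  and elabM: "elementary_abelian_ext 2 L M" and unrM: "unramified_outside S L M"
  and maximal: "elementary_abelian_ext 2 L M' \<Longrightarrow> unramified_outside S L M' \<Longrightarrow> M' \<subseteq> M"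
  using galL maxM by (simp_all add: is_max_elementary_ext_def elementary_abelian_2_iff galois_ext_iff)

lemma QL: "\<rat> \<subseteq> L" and QM: "\<rat> \<subseteq> M"
  using Rats_subset_subfield sL sM by auto

text \<open>Normality of \<open>L\<close>: an embedding fixes \<rat>, the fixed field of the finite
  group of \<open>L\<close>, so on \<open>L\<close> it agrees with an element of that group.\<close>

lemma emb_image_L:
  assumes "field_emb L \<sigma>"
  shows "\<sigma> ` L = L"
proof -
  interpret group "Gal L \<rat>" by (rule group_Gal[OF sL QL])
  have "\<exists>g\<in>carrier (Gal L \<rat>). \<forall>x\<in>L. \<sigma> x = g x"
    by (rule emb_fixing_fixed_field_in_group[OF sL QL subgroup_self finL assms])
      (use fixedL field_emb_Rats[OF assms sL] in blast)
  then obtain g where g: "g \<in> carrier (Gal L \<rat>)" "\<forall>x\<in>L. \<sigma> x = g x" by blast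
  then have "\<sigma> ` L = g ` L" by (intro image_cong) auto
  then show ?thesis using Gal_apply(3)[OF sL g(1)] by simp
qed

text \<open>Conjugates of \<open>M\<close> satisfy the conditions that \<open>M\<close> is maximal for.\<close>

lemma emb_image_M:
  assumes \<sigma>: "field_emb M \<sigma>"
  shows "\<sigma> ` M = M"
proof -
  have sub: "\<tau> ` M \<subseteq> M" if t: "field_emb M \<tau>" for \<tau>
  proof -
    have "\<tau> ` L = L" using emb_image_L[OF field_emb_mono[OF t LM]] .
    then show ?thesis
      using maximal elementary_abelian_emb_image[OF elabM t] unramified_outside_emb_image[OF sL sM LM t _ unrM]
      by blast
  qed
  \<comment> \<open>Maximality only gives that the image of \<open>M\<close> lies in
    \<open>M\<close>, and the degree may be infinite. Equality comes from an extension
    \<open>\<tau>\<close> to \<open>M\<close> of the inverse of \<open>\<sigma>\<close>: it maps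
    \<open>M\<close> into \<open>M\<close>, is injective, and satisfies
    \<open>\<tau> (\<sigma> (\<tau> m)) = \<tau> m\<close>.\<close>
  define j where "j = inv_into M \<sigma>"
  have js: "j (\<sigma> x) = x" if "x \<in> M" for x
    using inv_into_f_f[OF field_emb_inj_on[OF \<sigma> sM] that] by (simp add: j_def)
  have jM: "field_emb (\<sigma> ` M) j" unfolding j_def by (rule field_emb_inv_into[OF \<sigma> sM])
  have "L \<subseteq> \<sigma> ` M" using emb_image_L[OF field_emb_mono[OF \<sigma> LM]] LM by blast
  then obtain \<tau> where t: "field_emb M \<tau>" "\<And>x. x \<in> \<sigma> ` M \<Longrightarrow> \<tau> x = j x"
    using extend_field_emb[OF subfield_emb_image[OF \<sigma> sM] sM sub[OF \<sigma>] _ jM] alg_over_mono[OF algM] by metis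
  have "m \<in> \<sigma> ` M" if m: "m \<in> M" for m
  proof -
    have tm: "\<tau> m \<in> M" using sub[OF t(1)] m by blast
    then have "\<tau> (\<sigma> (\<tau> m)) = \<tau> m" using t(2)[of "\<sigma> (\<tau> m)"] js by simp
    moreover have "\<sigma> (\<tau> m) \<in> M" using sub[OF \<sigma>] tm by blast
    ultimately have "\<sigma> (\<tau> m) = m" using inj_onD[OF field_emb_inj_on[OF t(1) sM]] m by blast
    then show ?thesis using tm by (metis imageI)
  qed
  then show ?thesis using sub[OF \<sigma>] by blast
qed

lemma lift_Gal:
  assumes g: "g \<in> carrier (Gal L E)" and E: "E \<subseteq> L"
  obtains h where "h \<in> carrier (Gal M E)" "restrict h L = g"
proof -
  note gg = Gal_apply[OF sL g]
  obtain h where h: "field_emb M h" "\<And>x. x \<in> L \<Longrightarrow> h x = g x"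
    using extend_field_emb[OF sL sM LM algM gg(2)] by metis
  have "restrict h M \<in> carrier (Gal M E)"
    by (rule Gal_restrict_mem[OF sM h(1) emb_image_M[OF h(1)]]) (use E LM h(2) gg(4) in auto)
  moreover have "restrict (restrict h M) L = g"
  proof
    fix x show "restrict (restrict h M) L x = g x"
      using LM h(2) g by (cases "x \<in> L") (auto simp: carrier_Gal[OF sL] extensional_def)
  qed
  ultimately show ?thesis using that by blast
qed

lemma restrict_Gal:
  assumes h: "h \<in> carrier (Gal M E)" and E: "E \<subseteq> L"
  shows "restrict h L \<in> carrier (Gal L E)"
proof -
  note hh = Gal_apply[OF sM h]
  have "field_emb L h" using field_emb_mono[OF hh(2) LM] .
  then show ?thesis using emb_image_L[of h] hh(4) E by (intro Gal_restrict_mem[OF sL]) auto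
qed

lemma fixed_Gal_M:
  assumes x: "x \<in> M" and fix_x: "\<And>h. h \<in> carrier (Gal M \<rat>) \<Longrightarrow> h x = x"
  shows "x \<in> \<rat>"
proof -
  have xL: "x \<in> L" using fixedM[OF x] fix_x Gal_mono[OF sM QL] by blast
  have "g x = x" if g: "g \<in> carrier (Gal L \<rat>)" for g
  proof -
    obtain h where "h \<in> carrier (Gal M \<rat>)" "restrict h L = g" using lift_Gal[OF g QL] .
    then show ?thesis using fix_x[of h] xL by (metis restrict_apply')
  qed
  then show ?thesis using fixedL[OF xL] by blast
qed

abbreviation "G \<equiv> Gal M \<rat>"
abbreviation "V \<equiv> carrier (Gal M L)"

lemma group_G: "group G" by (rule group_Gal[OF sM QM])

sublocale G: group G by (rule group_G)

lemma mult_Gal_M: "monoid.mult (Gal M E) = monoid.mult G" and one_Gal_M: "one (Gal M E) = one G"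
  by (auto simp: Gal_def)

lemma Gal_M_eq: "Gal M E = G\<lparr>carrier := carrier (Gal M E)\<rparr>"
  by (simp add: Gal_def)

lemma subgroup_Gal_M:
  assumes "\<rat> \<subseteq> E" "E \<subseteq> M"
  shows "subgroup (carrier (Gal M E)) G"
proof -
  have "group (Gal M E)" by (rule group_Gal[OF sM assms(2)])
  then show ?thesis
    using G.group_incl_imp_subgroup[OF Gal_mono[OF sM assms(1)]] Gal_M_eq[of E] by simp
qed

lemma subgroup_V: "subgroup V G" by (rule subgroup_Gal_M[OF QL LM])

lemma V_G: "v \<in> V \<Longrightarrow> v \<in> carrier G"
  using subgroup.subset[OF subgroup_V] by blast

lemma mult_apply: "g \<in> carrier G \<Longrightarrow> h \<in> carrier G \<Longrightarrow> x \<in> M \<Longrightarrow> (g \<otimes>\<^bsub>G\<^esub> h) x = g (h x)"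
  by (rule Gal_apply(5)[OF sM])

lemma inv_apply: "g \<in> carrier G \<Longrightarrow> x \<in> M \<Longrightarrow> g ((inv\<^bsub>G\<^esub> g) x) = x"
  using mult_apply[of g "inv\<^bsub>G\<^esub> g" x] by (simp add: Gal_one)

lemma V_iff: "g \<in> V \<longleftrightarrow> g \<in> carrier G \<and> (\<forall>x\<in>L. g x = x)"
  using V_G by (auto simp: carrier_Gal[OF sM])

lemma V_square: "v \<in> V \<Longrightarrow> v \<otimes>\<^bsub>G\<^esub> v = \<one>\<^bsub>G\<^esub>"
  by (rule Gal_eqI[OF sM G.m_closed G.one_closed]) (auto simp: V_G mult_apply sqM Gal_one)

lemma V_commute:
  assumes "v \<in> V" "w \<in> V" shows "v \<otimes>\<^bsub>G\<^esub> w = w \<otimes>\<^bsub>G\<^esub> v"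
proof -
  interpret comm_group "Gal M L"
    using elabM by (simp add: elementary_abelian_ext_def)
  show ?thesis using m_comm[OF assms] by (simp only: mult_Gal_M[of L])
qed

definition conj :: "(complex \<Rightarrow> complex) \<Rightarrow> (complex \<Rightarrow> complex) \<Rightarrow> (complex \<Rightarrow> complex)"
  where "conj h v = h \<otimes>\<^bsub>G\<^esub> v \<otimes>\<^bsub>G\<^esub> inv\<^bsub>G\<^esub> h"

lemma conj_in_V:
  assumes h: "h \<in> carrier G" and v: "v \<in> V"
  shows "conj h v \<in> V"
proof -
  have vG: "v \<in> carrier G" using v V_G by blast
  have "(h \<otimes>\<^bsub>G\<^esub> v \<otimes>\<^bsub>G\<^esub> inv\<^bsub>G\<^esub> h) x = x" if x: "x \<in> L" for x
  proof -
    have xM: "x \<in> M" using x LM by blast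
    have i: "inv\<^bsub>G\<^esub> h \<in> carrier G" using h by simp
    have "(inv\<^bsub>G\<^esub> h) x \<in> L" using Gal_apply(1)[OF sL restrict_Gal[OF i QL] x] x by simp
    then have "v ((inv\<^bsub>G\<^esub> h) x) = (inv\<^bsub>G\<^esub> h) x" using v by (simp add: V_iff)
    then show ?thesis using h vG i xM inv_apply[OF h xM] Gal_apply(1)[OF sM i xM]
      by (simp add: mult_apply)
  qed
  then show ?thesis unfolding conj_def V_iff using h vG by simp
qed

lemma conj_mult:
  assumes "h \<in> carrier G" "v \<in> V" "w \<in> V"
  shows "conj h (v \<otimes>\<^bsub>G\<^esub> w) = conj h v \<otimes>\<^bsub>G\<^esub> conj h w"
  using assms V_G by (simp add: conj_def G.m_assoc G.inv_solve_left)

lemma conj_conj: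
  assumes "g \<in> carrier G" "h \<in> carrier G" "v \<in> V"
  shows "conj g (conj h v) = conj (g \<otimes>\<^bsub>G\<^esub> h) v"
  using assms V_G by (simp add: conj_def G.m_assoc G.inv_mult_group)

text \<open>\<open>g\<close> and \<open>h\<close> differ by an element of \<open>V\<close>, which
  centralizes the abelian group \<open>V\<close>. So the action depends only on the restriction to
  \<open>L\<close>.\<close>

lemma conj_cong:
  assumes g: "g \<in> carrier G" and h: "h \<in> carrier G" and eq: "restrict g L = restrict h L" and v: "v \<in> V"
  shows "conj g v = conj h v"
proof -
  define w where "w = inv\<^bsub>G\<^esub> h \<otimes>\<^bsub>G\<^esub> g"
  have wG: "w \<in> carrier G" using g h by (simp add: w_def)
  have hw: "g = h \<otimes>\<^bsub>G\<^esub> w" using g h by (simp add: w_def G.m_assoc[symmetric])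
  have "w x = x" if x: "x \<in> L" for x
  proof -
    have xM: "x \<in> M" using x LM by blast
    have "g x = h x" using eq x by (metis restrict_apply')
    then have "h (w x) = h x" using hw mult_apply[OF h wG xM] by simp
    then show ?thesis
      using inj_onD[OF field_emb_inj_on[OF Gal_apply(2)[OF sM h] sM]] Gal_apply(1)[OF sM wG xM] xM by blast
  qed
  then have w: "w \<in> V" using wG by (simp add: V_iff)
  have "conj w v = v" unfolding conj_def using V_commute[OF w v] w v V_G by (simp add: G.m_assoc)
  then show ?thesis using conj_conj[OF h wG v] hw by simp
qed

end

section \<open>The Galois module and its submodules\<close>

locale tower_over = tower +
  fixes k :: "complex set"
  assumes sk: "subfield k CC" and kL: "k \<subseteq> L"
begin

lemma Qk: "\<rat> \<subseteq> k" using Rats_subset_subfield[OF sk] .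

abbreviation "H \<equiv> carrier (Gal M k)"
abbreviation "C \<equiv> carrier (Gal L k)"

lemma subgroup_H: "subgroup H G" using subgroup_Gal_M[OF Qk] kL LM by blast

lemma H_G: "h \<in> H \<Longrightarrow> h \<in> carrier G" using subgroup.subset[OF subgroup_H] by blast

lemma finite_C: "finite C" using finite_subset[OF Gal_mono[OF sL Qk] finL] .

text \<open>The lift chosen by \<open>SOME\<close> may be replaced by any other, by
  \<open>conj_cong\<close>.\<close>

lemma conj_action_eq:
  assumes h: "h \<in> H" and v: "v \<in> V"
  shows "conj_action k L M (restrict h L) v = conj h v"
proof -
  define g where "g = (SOME g. g \<in> H \<and> restrict g L = restrict h L)"
  have "g \<in> H \<and> restrict g L = restrict h L"
    unfolding g_def by (rule someI[of _ h]) (use h in auto)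
  moreover have "inv\<^bsub>Gal M k\<^esub> g = inv\<^bsub>G\<^esub> g"
    using G.m_inv_consistent[OF subgroup_H, of g] calculation Gal_M_eq[of k] by simp
  ultimately have "conj_action k L M (restrict h L) v = conj g v"
    by (simp add: conj_action_def Let_def g_def[symmetric] conj_def mult_Gal_M[of k])
  also have "\<dots> = conj h v"
    using h v H_G \<open>g \<in> H \<and> _\<close> by (intro conj_cong) auto
  finally show ?thesis .
qed

lemma conj_action_in_V: "g \<in> C \<Longrightarrow> v \<in> V \<Longrightarrow> conj_action k L M g v \<in> V"
proof -
  assume "g \<in> C" and v: "v \<in> V"
  then obtain h where h: "h \<in> H" "restrict h L = g" using lift_Gal[OF _ kL] by metis
  then show ?thesis using conj_action_eq[OF h(1) v] conj_in_V[OF H_G[OF h(1)] v] by simp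
qed

lemma conj_action_mult:
  "g \<in> C \<Longrightarrow> v \<in> V \<Longrightarrow> w \<in> V \<Longrightarrow>
    conj_action k L M g (v \<otimes>\<^bsub>G\<^esub> w) = conj_action k L M g v \<otimes>\<^bsub>G\<^esub> conj_action k L M g w"
proof -
  assume "g \<in> C" and v: "v \<in> V" and w: "w \<in> V"
  then obtain h where h: "h \<in> H" "restrict h L = g" using lift_Gal[OF _ kL] by metis
  then show ?thesis using conj_action_eq[OF h(1)] conj_mult[OF H_G[OF h(1)] v w] v w
      subgroup.m_closed[OF subgroup_V v w] by simp
qed

text \<open>The submodules of the Galois module in terms of groups
  (\<open>submodule_iff_stable\<close>). Invariance under lifts in \<open>H\<close> avoids any
  choice of lift.\<close>

definition stable :: "(complex \<Rightarrow> complex) set \<Rightarrow> bool"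
  where "stable U \<longleftrightarrow> subgroup U G \<and> U \<subseteq> V \<and> (\<forall>h\<in>H. \<forall>u\<in>U. conj h u \<in> U)"

abbreviation "A \<equiv> galois_module k L M"
abbreviation "R \<equiv> group_algebra (residue_ring 2) (Gal L k)"

lemma subgroup_A_iff: "subgroup U (add_monoid A) \<longleftrightarrow> subgroup U (Gal M L)"
  by (rule subgroup_cong) (simp_all add: galois_module_def)

lemma comm_group_V: "comm_group (Gal M L)"
  using elabM by (simp add: elementary_abelian_ext_def)

lemma smult_A: "a \<odot>\<^bsub>A\<^esub> v = finprod (Gal M L) (\<lambda>g. conj_action k L M g v [^]\<^bsub>Gal M L\<^esub> a g) C"
  by (simp add: galois_module_def)

lemma pow_in_V: "v \<in> V \<Longrightarrow> v [^]\<^bsub>Gal M L\<^esub> (n::int) \<in> V"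
  using group.int_pow_closed[OF comm_group.axioms(2)[OF comm_group_V]] .

lemma subgroup_V_iff: "subgroup U (Gal M L) \<longleftrightarrow> subgroup U G \<and> U \<subseteq> V"
proof
  assume U: "subgroup U (Gal M L)"
  then have "subgroup U (G\<lparr>carrier := V\<rparr>)" using Gal_M_eq[of L] by simp
  then show "subgroup U G \<and> U \<subseteq> V" using G.incl_subgroup[OF subgroup_V] subgroup.subset[OF U] by blast
next
  assume "subgroup U G \<and> U \<subseteq> V"
  then have "subgroup U (G\<lparr>carrier := V\<rparr>)" using G.subgroup_incl[OF _ subgroup_V] by blast
  then show "subgroup U (Gal M L)" using Gal_M_eq[of L] by simp
qed

lemma smult_in_stable:
  assumes U: "stable U" and u: "u \<in> U"
  shows "a \<odot>\<^bsub>A\<^esub> u \<in> U"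
proof -
  interpret VG: comm_group "Gal M L" by (rule comm_group_V)
  have sU: "subgroup U (Gal M L)" using U by (simp add: stable_def subgroup_V_iff)
  have c: "conj_action k L M g u \<in> U" if gC: "g \<in> C" for g
  proof -
    obtain h where h: "h \<in> H" "restrict h L = g" using lift_Gal[OF gC kL] by metis
    have "u \<in> V" "conj h u \<in> U" using U u h(1) unfolding stable_def by auto
    then show ?thesis using conj_action_eq[OF h(1)] h(2) by simp
  qed
  have p: "conj_action k L M g u [^]\<^bsub>Gal M L\<^esub> a g \<in> U" if "g \<in> C" for g
    using VG.subgroup_int_pow_closed[OF sU c[OF that]] .
  have "finprod (Gal M L) (\<lambda>g. conj_action k L M g u [^]\<^bsub>Gal M L\<^esub> a g) D \<in> U" if "D \<subseteq> C" for D
  proof -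
    have "finite D" using finite_subset[OF that finite_C] .
    then show ?thesis using that
    proof (induction D)
      case empty
      then show ?case using subgroup.one_closed[OF sU] by simp
    next
      case (insert g D)
      then show ?case using p subgroup.mem_carrier[OF sU p] subgroup.m_closed[OF sU]
        by (subst VG.finprod_insert) auto
    qed
  qed
  then show ?thesis by (simp add: smult_A)
qed

lemma smult_mult:
  assumes "v \<in> V" "w \<in> V"
  shows "a \<odot>\<^bsub>A\<^esub> (v \<otimes>\<^bsub>G\<^esub> w) = (a \<odot>\<^bsub>A\<^esub> v) \<otimes>\<^bsub>G\<^esub> (a \<odot>\<^bsub>A\<^esub> w)"
proof -
  interpret VG: comm_group "Gal M L" by (rule comm_group_V)
  have c: "conj_action k L M g (v \<otimes>\<^bsub>G\<^esub> w) = conj_action k L M g v \<otimes>\<^bsub>Gal M L\<^esub> conj_action k L M g w"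
    if "g \<in> C" for g
    unfolding mult_Gal_M[of L] using conj_action_mult[OF that assms] .
  have "a \<odot>\<^bsub>A\<^esub> (v \<otimes>\<^bsub>G\<^esub> w) = finprod (Gal M L) (\<lambda>g. (conj_action k L M g v [^]\<^bsub>Gal M L\<^esub> a g) \<otimes>\<^bsub>Gal M L\<^esub>
      (conj_action k L M g w [^]\<^bsub>Gal M L\<^esub> a g)) C"
    unfolding smult_A using assms
    by (intro VG.finprod_cong' refl)
      (auto simp: c conj_action_in_V VG.int_pow_distrib)
  also have "\<dots> = (a \<odot>\<^bsub>A\<^esub> v) \<otimes>\<^bsub>Gal M L\<^esub> (a \<odot>\<^bsub>A\<^esub> w)"
    unfolding smult_A using assms by (intro VG.finprod_multf) (auto intro: pow_in_V conj_action_in_V)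
  finally show ?thesis by (simp only: mult_Gal_M[of L])
qed

text \<open>For \<open>g\<close> in \<open>C\<close>, the basis element of the group algebra that
  belongs to \<open>g\<close>.\<close>

definition delta :: "(complex \<Rightarrow> complex) \<Rightarrow> (complex \<Rightarrow> complex) \<Rightarrow> int"
  where "delta g = (\<lambda>x\<in>C. if x = g then 1 else 0)"

lemma delta_in_R: "delta g \<in> carrier R"
  by (auto simp: delta_def group_algebra_def residue_ring_def)

lemma smult_delta:
  assumes g: "g \<in> C" and v: "v \<in> V"
  shows "delta g \<odot>\<^bsub>A\<^esub> v = conj_action k L M g v"
proof -
  interpret VG: comm_group "Gal M L" by (rule comm_group_V)
  have "delta g \<odot>\<^bsub>A\<^esub> v = finprod (Gal M L) (\<lambda>x. if g = x then conj_action k L M x v else \<one>\<^bsub>Gal M L\<^esub>) C"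
    unfolding smult_A using v conj_action_in_V
    by (intro VG.finprod_cong' refl) (auto simp: delta_def VG.int_pow_1)
  also have "\<dots> = conj_action k L M g v"
    using g v finite_C conj_action_in_V by (intro VG.finprod_singleton) auto
  finally show ?thesis .
qed

text \<open>Conjugation by \<open>h\<close> is multiplication by a basis element of the group
  algebra. Conversely a scalar acts by a product of powers of conjugates, which stays in a stable
  subgroup.\<close>

lemma submodule_iff_stable: "submodule U R A \<longleftrightarrow> stable U"
proof
  assume U: "submodule U R A"
  then have s: "subgroup U (Gal M L)" unfolding submodule_def subgroup_A_iff by blast
  then have UV: "U \<subseteq> V" by (rule subgroup.subset)
  have "conj h u \<in> U" if h: "h \<in> H" and u: "u \<in> U" for h u
  proof -
    have "restrict h L \<in> C" using restrict_Gal[OF h kL] .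
    then have "conj h u = delta (restrict h L) \<odot>\<^bsub>A\<^esub> u"
      using u UV h by (simp add: smult_delta conj_action_eq subset_iff)
    then show ?thesis using submodule.smult_closed[OF U delta_in_R u] by simp
  qed
  then show "stable U" using s by (simp add: stable_def subgroup_V_iff)
next
  assume U: "stable U"
  then show "submodule U R A"
    by (intro submodule.intro submodule_axioms.intro)
      (auto simp: subgroup_A_iff stable_def subgroup_V_iff smult_in_stable)
qed

end

lemma comm_monoid_cong:
  fixes A :: "('a, 'b) monoid_scheme" and B :: "('a, 'c) monoid_scheme"
  assumes "carrier A = carrier B" "monoid.mult A = monoid.mult B" "one A = one B" "comm_monoid B"
  shows "comm_monoid A"
proof -
  interpret B: comm_monoid B by (rule assms(4))
  show ?thesis
    by (rule comm_monoidI) (simp_all add: assms(1-3) B.m_assoc, rule B.m_comm)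
qed

section \<open>Composition series of the Galois module\<close>

context tower_over
begin

lemma r_coset_Gal: "N #>\<^bsub>Gal M L\<^esub> v = N #>\<^bsub>G\<^esub> v"
  unfolding r_coset_def mult_Gal_M[of L] ..

lemma carrier_subquotient: "carrier (subquotient A W N) = (\<lambda>v. N #>\<^bsub>G\<^esub> v) ` W"
  by (auto simp: quotient_module_def A_RCOSETS_def RCOSETS_def r_coset_def galois_module_def mult_Gal_M[of L])

lemma zero_subquotient: "\<zero>\<^bsub>subquotient A W N\<^esub> = N"
  by (simp add: quotient_module_def)

lemma smult_subquotient: "a \<odot>\<^bsub>subquotient A W N\<^esub> Z = N <#>\<^bsub>G\<^esub> ((\<lambda>x. a \<odot>\<^bsub>A\<^esub> x) ` Z)"
  by (simp add: quotient_module_def set_add_def set_mult_def galois_module_def mult_Gal_M[of L])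

lemma stableD:
  assumes "stable U"
  shows "subgroup U G" "U \<subseteq> V" "h \<in> H \<Longrightarrow> u \<in> U \<Longrightarrow> conj h u \<in> U" "\<one>\<^bsub>G\<^esub> \<in> U"
    "u \<in> U \<Longrightarrow> v \<in> U \<Longrightarrow> u \<otimes>\<^bsub>G\<^esub> v \<in> U"
proof -
  show s: "subgroup U G" "U \<subseteq> V" "h \<in> H \<Longrightarrow> u \<in> U \<Longrightarrow> conj h u \<in> U"
    using assms by (simp_all add: stable_def)
  show "\<one>\<^bsub>G\<^esub> \<in> U" "u \<in> U \<Longrightarrow> v \<in> U \<Longrightarrow> u \<otimes>\<^bsub>G\<^esub> v \<in> U"
    by (rule subgroup.one_closed[OF s(1)], rule subgroup.m_closed[OF s(1)])
qed

lemma comm_group_stable: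
  assumes W: "stable W"
  shows "comm_group (Gal M L\<lparr>carrier := W\<rparr>)"
proof -
  interpret VG: comm_group "Gal M L" by (rule comm_group_V)
  have "subgroup W (Gal M L)" using stableD[OF W] by (simp add: subgroup_V_iff)
  then have "group (Gal M L\<lparr>carrier := W\<rparr>)" by (rule VG.subgroup_imp_group)
  then show ?thesis
    by (rule group.group_comm_groupI) (use stableD(2)[OF W] in \<open>auto intro!: VG.m_comm\<close>)
qed

text \<open>Scalars act on the quotient through images of whole cosets; additivity and the stability
  of \<open>N\<close> reduce this to representatives.\<close>

lemma smult_coset:
  assumes N: "stable N" and u: "u \<in> V"
  shows "N <#>\<^bsub>G\<^esub> ((\<lambda>x. a \<odot>\<^bsub>A\<^esub> x) ` (N #>\<^bsub>G\<^esub> u)) = N #>\<^bsub>G\<^esub> (a \<odot>\<^bsub>A\<^esub> u)"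
proof -
  have au: "a \<odot>\<^bsub>A\<^esub> u \<in> V"
  proof -
    have "stable V" using subgroup_V conj_in_V H_G by (simp add: stable_def)
    then show ?thesis using smult_in_stable u by blast
  qed
  have nV: "n \<in> V" if "n \<in> N" for n using that stableD(2)[OF N] by blast
  have *: "n \<otimes>\<^bsub>G\<^esub> (a \<odot>\<^bsub>A\<^esub> (n' \<otimes>\<^bsub>G\<^esub> u)) = (n \<otimes>\<^bsub>G\<^esub> (a \<odot>\<^bsub>A\<^esub> n')) \<otimes>\<^bsub>G\<^esub> (a \<odot>\<^bsub>A\<^esub> u)" if "n \<in> N" "n' \<in> N" for n n'
    using smult_mult[OF nV[OF that(2)] u, of a] smult_in_stable[OF N that(2), of a] that nV V_G au
    by (simp add: G.m_assoc)
  have 1: "\<one>\<^bsub>G\<^esub> \<otimes>\<^bsub>G\<^esub> u = u" using u V_G by simp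
  show ?thesis
  proof (intro equalityI subsetI)
    fix x assume "x \<in> N <#>\<^bsub>G\<^esub> ((\<lambda>x. a \<odot>\<^bsub>A\<^esub> x) ` (N #>\<^bsub>G\<^esub> u))"
    then obtain n n' where n: "n \<in> N" "n' \<in> N" "x = n \<otimes>\<^bsub>G\<^esub> (a \<odot>\<^bsub>A\<^esub> (n' \<otimes>\<^bsub>G\<^esub> u))"
      by (auto simp: set_mult_def r_coset_def)
    then show "x \<in> N #>\<^bsub>G\<^esub> (a \<odot>\<^bsub>A\<^esub> u)"
      using *[OF n(1,2)] stableD(5)[OF N n(1) smult_in_stable[OF N n(2), of a]] by (auto simp: r_coset_def)
  next
    fix x assume "x \<in> N #>\<^bsub>G\<^esub> (a \<odot>\<^bsub>A\<^esub> u)"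
    then obtain n where n: "n \<in> N" "x = n \<otimes>\<^bsub>G\<^esub> (a \<odot>\<^bsub>A\<^esub> u)" by (auto simp: r_coset_def)
    moreover have "u \<in> N #>\<^bsub>G\<^esub> u" using stableD(4)[OF N] 1 by (force simp: r_coset_def)
    ultimately show "x \<in> N <#>\<^bsub>G\<^esub> ((\<lambda>x. a \<odot>\<^bsub>A\<^esub> x) ` (N #>\<^bsub>G\<^esub> u))" by (auto simp: set_mult_def)
  qed
qed

text \<open>Correspondence of submodules: the image of \<open>U\<close> among the cosets of
  \<open>N\<close> is a submodule, hence zero or everything, and \<open>U\<close> is recovered from
  it because it contains \<open>N\<close>.\<close>

lemma irreducible_subquotient:
  assumes W: "stable W" and N: "stable N" and NW: "N \<subseteq> W" and irr: "irreducible_module R (subquotient A W N)"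
    and U: "stable U" "N \<subseteq> U" "U \<subseteq> W"
  shows "U = N \<or> U = W"
proof -
  let ?W = "Gal M L\<lparr>carrier := W\<rparr>"
  interpret W: comm_group ?W by (rule comm_group_stable[OF W])
  interpret VG: comm_group "Gal M L" by (rule comm_group_V)
  have sub: "subgroup Z ?W" if "stable Z" "Z \<subseteq> W" for Z
    using VG.subgroup_incl[of Z W] stableD[OF that(1)] stableD[OF W] that(2) by (simp add: subgroup_V_iff)
  interpret N: normal N ?W using W.subgroup_imp_normal[OF sub[OF N NW]] .
  define \<U> where "\<U> = (\<lambda>v. N #>\<^bsub>G\<^esub> v) ` U"
  have coset: "N #>\<^bsub>?W\<^esub> v = N #>\<^bsub>G\<^esub> v" for v using r_coset_Gal[of N v] by (simp add: r_coset_def)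
  have "group_hom ?W (?W Mod N) (\<lambda>v. N #>\<^bsub>?W\<^esub> v)"
    using N.r_coset_hom_Mod N.factorgroup_is_group W.is_group by (simp add: group_hom_def group_hom_axioms_def)
  from group_hom.subgroup_img_is_subgroup[OF this sub[OF U(1,3)]]
  have "subgroup \<U> (?W Mod N)" unfolding \<U>_def coset .
  then have "subgroup \<U> (add_monoid (subquotient A W N))"
    by (rule subgroup_cong[THEN iffD2, rotated -1])
      (simp_all add: quotient_module_def FactGroup_def A_RCOSETS_def RCOSETS_def r_coset_def set_add_def
        set_mult_def galois_module_def fun_eq_iff)
  moreover have "a \<odot>\<^bsub>subquotient A W N\<^esub> Z \<in> \<U>" if "Z \<in> \<U>" for a Z
    using that stableD(2)[OF U(1)] smult_in_stable[OF U(1)]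
    by (auto simp: \<U>_def smult_subquotient smult_coset[OF N])
  ultimately have "submodule \<U> R (subquotient A W N)"
    by (intro submodule.intro submodule_axioms.intro) auto
  then consider "\<U> = {N}" | "\<U> = (\<lambda>v. N #>\<^bsub>G\<^esub> v) ` W"
    using irr unfolding irreducible_module_def zero_subquotient carrier_subquotient by blast
  then show ?thesis
  proof cases
    case 1
    have "u \<in> N" if u: "u \<in> U" for u
    proof -
      have "N #>\<^bsub>G\<^esub> u = N" using 1 u by (auto simp: \<U>_def)
      moreover have "u \<in> carrier G" using u stableD(2)[OF U(1)] V_G by blast
      moreover have "\<one>\<^bsub>G\<^esub> \<otimes>\<^bsub>G\<^esub> u \<in> N #>\<^bsub>G\<^esub> u" using stableD(4)[OF N] by (auto simp: r_coset_def)
      ultimately show ?thesis by simp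
    qed
    then show ?thesis using U(2) by blast
  next
    case 2
    have "w \<in> U" if w: "w \<in> W" for w
    proof -
      have "N #>\<^bsub>G\<^esub> w \<in> \<U>" using 2 w by blast
      then obtain u where u: "u \<in> U" "N #>\<^bsub>G\<^esub> w = N #>\<^bsub>G\<^esub> u" by (auto simp: \<U>_def)
      have "w \<in> carrier G" using w stableD(2)[OF W] V_G by blast
      moreover have "\<one>\<^bsub>G\<^esub> \<otimes>\<^bsub>G\<^esub> w \<in> N #>\<^bsub>G\<^esub> w" using stableD(4)[OF N] by (auto simp: r_coset_def)
      ultimately have "w \<in> N #>\<^bsub>G\<^esub> u" using u(2) by simp
      then obtain n where "n \<in> N" "w = n \<otimes>\<^bsub>G\<^esub> u" by (auto simp: r_coset_def)
      then show ?thesis using stableD(5)[OF U(1)] U(2) u(1) by auto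
    qed
    then show ?thesis using U(3) by blast
  qed
qed

text \<open>\<open>V\<close> is commutative of exponent 2, so a new generator \<open>x\<close> adds
  at most one coset.\<close>

lemma adjoin_subgroup:
  assumes U: "subgroup U G" "U \<subseteq> V" and x: "x \<in> V"
  shows "subgroup (U \<union> (\<lambda>u. x \<otimes>\<^bsub>G\<^esub> u) ` U) G"
proof -
  have UV: "u \<in> V" "u \<in> carrier G" if "u \<in> U" for u using that U(2) V_G by auto
  have xG: "x \<in> carrier G" using x V_G by blast
  have xx: "x \<otimes>\<^bsub>G\<^esub> (x \<otimes>\<^bsub>G\<^esub> u) = u" if "u \<in> carrier G" for u
    using V_square[OF x] xG that by (simp add: G.m_assoc[symmetric])
  have com: "u \<otimes>\<^bsub>G\<^esub> (x \<otimes>\<^bsub>G\<^esub> v) = x \<otimes>\<^bsub>G\<^esub> (u \<otimes>\<^bsub>G\<^esub> v)" if "u \<in> U" "v \<in> U" for u v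
    using UV that xG V_commute[OF UV(1)[OF that(1)] x] by (simp add: G.m_assoc[symmetric])
  have mul: "u \<otimes>\<^bsub>G\<^esub> v \<in> U" if "u \<in> U" "v \<in> U" for u v using subgroup.m_closed[OF U(1)] that by blast
  let ?Z = "U \<union> (\<lambda>u. x \<otimes>\<^bsub>G\<^esub> u) ` U"
  have ZV: "?Z \<subseteq> V" using U(2) x subgroup.m_closed[OF subgroup_V] by blast
  show ?thesis
  proof (rule G.subgroupI)
    show "?Z \<subseteq> carrier G" using ZV V_G by blast
    show "?Z \<noteq> {}" using subgroup.one_closed[OF U(1)] by blast
    fix a assume a: "a \<in> ?Z"
    then have "inv\<^bsub>G\<^esub> a = a" using V_square[of a] ZV V_G by (intro G.inv_equality) auto
    then show "inv\<^bsub>G\<^esub> a \<in> ?Z" using a by simp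
    fix b assume b: "b \<in> ?Z"
    show "a \<otimes>\<^bsub>G\<^esub> b \<in> ?Z"
      using a
    proof
      assume a: "a \<in> U"
      show ?thesis using b
      proof
        assume "b \<in> U" then show ?thesis using mul a by blast
      next
        assume "b \<in> (\<lambda>u. x \<otimes>\<^bsub>G\<^esub> u) ` U"
        then obtain v where v: "v \<in> U" "b = x \<otimes>\<^bsub>G\<^esub> v" by blast
        then show ?thesis using com[OF a v(1)] mul[OF a v(1)] by simp
      qed
    next
      assume "a \<in> (\<lambda>u. x \<otimes>\<^bsub>G\<^esub> u) ` U"
      then obtain u where u: "u \<in> U" "a = x \<otimes>\<^bsub>G\<^esub> u" by blast
      show ?thesis using b
      proof
        assume "b \<in> U"
        then have "a \<otimes>\<^bsub>G\<^esub> b = x \<otimes>\<^bsub>G\<^esub> (u \<otimes>\<^bsub>G\<^esub> b)" using u xG UV by (simp add: G.m_assoc)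
        then show ?thesis using mul[OF u(1) \<open>b \<in> U\<close>] by simp
      next
        assume "b \<in> (\<lambda>u. x \<otimes>\<^bsub>G\<^esub> u) ` U"
        then obtain v where v: "v \<in> U" "b = x \<otimes>\<^bsub>G\<^esub> v" by blast
        have "a \<otimes>\<^bsub>G\<^esub> b = x \<otimes>\<^bsub>G\<^esub> (u \<otimes>\<^bsub>G\<^esub> (x \<otimes>\<^bsub>G\<^esub> v))" using u v xG UV by (simp add: G.m_assoc)
        also have "\<dots> = u \<otimes>\<^bsub>G\<^esub> v" using com[OF u(1) v(1)] xx UV u v by simp
        finally show ?thesis using mul[OF u(1) v(1)] by simp
      qed
    qed
  qed
qed

lemma finite_subgroup_containing:
  assumes "finite Z" "Z \<subseteq> V"
  shows "\<exists>U. subgroup U G \<and> finite U \<and> Z \<subseteq> U \<and> U \<subseteq> V"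
  using assms
proof (induction Z)
  case empty
  then show ?case using G.triv_subgroup subgroup.one_closed[OF subgroup_V] by (intro exI[of _ "{\<one>\<^bsub>G\<^esub>}"]) auto
next
  case (insert x Z)
  then obtain U where U: "subgroup U G" "finite U" "Z \<subseteq> U" "U \<subseteq> V" and x: "x \<in> V" by auto
  show ?case
  proof (intro exI[of _ "U \<union> (\<lambda>u. x \<otimes>\<^bsub>G\<^esub> u) ` U"] conjI)
    show "subgroup (U \<union> (\<lambda>u. x \<otimes>\<^bsub>G\<^esub> u) ` U) G" by (rule adjoin_subgroup[OF U(1,4) x])
    have "x \<otimes>\<^bsub>G\<^esub> \<one>\<^bsub>G\<^esub> = x" using x V_G by simp
    then have "x \<in> (\<lambda>u. x \<otimes>\<^bsub>G\<^esub> u) ` U" using subgroup.one_closed[OF U(1)] by (metis imageI)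
    then show "insert x Z \<subseteq> U \<union> (\<lambda>u. x \<otimes>\<^bsub>G\<^esub> u) ` U" using U(3) by blast
    show "U \<union> (\<lambda>u. x \<otimes>\<^bsub>G\<^esub> u) ` U \<subseteq> V" using U(4) x subgroup.m_closed[OF subgroup_V] by blast
  qed (use U(2) in simp)
qed

text \<open>The action of \<open>H\<close> on \<open>V\<close> factors through the finite group of
  \<open>L\<close> over \<open>k\<close>, so the orbit of \<open>v\<close> is finite. With
  \<open>N\<close> it generates a finite subgroup, because finitely generated subgroups of
  \<open>V\<close> are finite.\<close>

lemma stable_hull:
  assumes N: "stable N" "finite N" and W: "stable W" "N \<subseteq> W" and v: "v \<in> W"
  obtains U where "stable U" "finite U" "N \<subseteq> U" "v \<in> U" "U \<subseteq> W"
proof -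
  define orb where "orb = (\<lambda>h. conj h v) ` H"
  define Z where "Z = N \<union> orb"
  have vV: "v \<in> V" using v stableD(2)[OF W(1)] by blast
  have "orb \<subseteq> (\<lambda>g. conj_action k L M g v) ` C"
    using conj_action_eq[OF _ vV] restrict_Gal[OF _ kL] by (force simp: orb_def)
  then have "finite orb" using finite_C by (meson finite_imageI finite_subset)
  moreover have OW: "orb \<subseteq> W" using stableD(3)[OF W(1) _ v] by (auto simp: orb_def)
  ultimately have Z: "finite Z" "Z \<subseteq> W" using N(2) W(2) by (auto simp: Z_def)
  then have ZV: "Z \<subseteq> V" using stableD(2)[OF W(1)] by blast
  then have ZG: "Z \<subseteq> carrier G" using V_G by blast
  define U where "U = generate G Z"
  have sU: "subgroup U G" unfolding U_def by (rule G.generate_is_subgroup[OF ZG])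
  obtain U' where U': "subgroup U' G" "finite U'" "Z \<subseteq> U'" using finite_subgroup_containing[OF Z(1) ZV] by blast
  have "finite U" using G.generate_subgroup_incl[OF U'(3,1)] U'(2) unfolding U_def by (rule finite_subset)
  moreover have UW: "U \<subseteq> W" unfolding U_def by (rule G.generate_subgroup_incl[OF Z(2) stableD(1)[OF W(1)]])
  moreover have ZU: "Z \<subseteq> U" unfolding U_def by (auto intro: generate.incl)
  moreover have "v \<in> orb"
  proof -
    have "conj \<one>\<^bsub>G\<^esub> v = v" using vV V_G by (simp add: conj_def)
    moreover have "\<one>\<^bsub>G\<^esub> \<in> H" using subgroup.one_closed[OF subgroup_H] .
    ultimately show ?thesis unfolding orb_def by (metis imageI)
  qed
  moreover have "stable U"
    unfolding stable_def
  proof (intro conjI ballI)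
    show "U \<subseteq> V" using UW stableD(2)[OF W(1)] by blast
    fix h u assume h: "h \<in> H" and "u \<in> U"
    have hG: "h \<in> carrier G" using H_G[OF h] .
    have cX: "conj h x \<in> U" if "x \<in> Z" for x
    proof -
      have "conj h x \<in> Z"
        using that unfolding Z_def
      proof
        assume "x \<in> N" then show "conj h x \<in> N \<union> orb" using stableD(3)[OF N(1) h] by blast
      next
        assume "x \<in> orb"
        then obtain h' where h': "h' \<in> H" "x = conj h' v" by (auto simp: orb_def)
        then have "conj h x = conj (h \<otimes>\<^bsub>G\<^esub> h') v" using conj_conj[OF hG H_G vV] by simp
        then show "conj h x \<in> N \<union> orb" using subgroup.m_closed[OF subgroup_H h h'(1)] by (auto simp: orb_def)
      qed
      then show ?thesis using ZU by blast
    qed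
    have genV: "x \<in> V" if "x \<in> generate G Z" for x
      using that UW stableD(2)[OF W(1)] unfolding U_def by blast
    show "conj h u \<in> U"
      using \<open>u \<in> U\<close>[unfolded U_def]
    proof (induction rule: generate.induct)
      case one
      then show ?case using hG subgroup.one_closed[OF sU] by (simp add: conj_def)
    next
      case (incl x)
      then show ?case by (rule cX)
    next
      case (inv x)
      then have "inv\<^bsub>G\<^esub> x = x" using V_square[of x] ZV V_G by (intro G.inv_equality) auto
      then show ?case using cX[OF inv] by simp
    next
      case (eng x y)
      then show ?case using conj_mult[OF hG genV genV] subgroup.m_closed[OF sU] by simp
    qed
  qed (rule sU)
  ultimately show ?thesis using that unfolding Z_def by blast
qed

lemma composition_series_stable:
  assumes "composition_series R A Ws" "i < length Ws"
  shows "stable (Ws ! i)"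
proof -
  have "submodule (Ws ! i) R A"
    using assms nth_mem[of i Ws] unfolding composition_series_def by blast
  then show ?thesis by (simp only: submodule_iff_stable)
qed

text \<open>Finiteness climbs the series: for \<open>v\<close> in the next term but not in the
  present one, the finite stable hull of the present term and \<open>v\<close> is the whole next
  term by irreducibility.\<close>

theorem finite_V:
  assumes cs: "composition_series R A Ws"
  shows "finite V"
proof -
  have "finite (Ws ! i)" if "i < length Ws" for i
    using that
  proof (induction i)
    case 0
    then have "Ws ! 0 = {\<zero>\<^bsub>A\<^esub>}" using cs by (auto simp: composition_series_def hd_conv_nth)
    then show ?case by simp
  next
    case (Suc i)
    let ?N = "Ws ! i" and ?W = "Ws ! Suc i"
    have N: "stable ?N" "finite ?N" and W: "stable ?W"
      using composition_series_stable[OF cs] Suc by auto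
    have NW: "?N \<subseteq> ?W" and irr: "irreducible_module R (subquotient A ?W ?N)"
      using cs Suc.prems by (auto simp: composition_series_def)
    show ?case
    proof (cases "?W \<subseteq> ?N")
      case True
      then show ?thesis using N(2) finite_subset by blast
    next
      case False
      then obtain v where v: "v \<in> ?W" "v \<notin> ?N" by blast
      obtain U where U: "stable U" "finite U" "?N \<subseteq> U" "v \<in> U" "U \<subseteq> ?W"
        using stable_hull[OF N W NW v(1)] .
      then have "U = ?W" using irreducible_subquotient[OF W N(1) NW irr U(1,3,5)] v(2) by blast
      then show ?thesis using U(2) by simp
    qed
  qed
  moreover have "last Ws = V" "Ws \<noteq> []" using cs by (auto simp: composition_series_def galois_module_def)
  ultimately show ?thesis by (metis diff_less last_conv_nth length_greater_0_conv zero_less_one)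
qed

text \<open>Under a trivial action \<open>N\<close> together with the coset of any \<open>w\<close>
  in \<open>W\<close> is stable, so an irreducible subquotient has just two elements. A basis of two
  elements would have to contain zero.\<close>

theorem nontrivial_action:
  assumes JH: "Jordan_Hoelder_factor R A Q"
    and dim: "has_dimension (residue_ring 2) (restrict_scalars (residue_ring 2) (Gal L k) Q) 2"
  obtains h v where "h \<in> H" "v \<in> V" "conj h v \<noteq> v"
proof -
  obtain Ws i where cs: "composition_series R A Ws" and i: "Suc i < length Ws"
    and Q: "Q = subquotient A (Ws ! Suc i) (Ws ! i)"
    using JH unfolding Jordan_Hoelder_factor_def by blast
  define W N where "W = Ws ! Suc i" and "N = Ws ! i"
  have N: "stable N" and W: "stable W" using composition_series_stable[OF cs] i by (auto simp: W_def N_def)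
  have NW: "N \<subseteq> W" and irr: "irreducible_module R (subquotient A W N)"
    using cs i unfolding composition_series_def W_def N_def by blast+
  have Q: "Q = subquotient A W N" using Q by (simp add: W_def N_def)
  have "\<exists>h\<in>H. \<exists>v\<in>V. conj h v \<noteq> v"
  proof (rule ccontr)
    assume "\<not> ?thesis"
    then have triv: "conj h v = v" if "h \<in> H" "v \<in> V" for h v using that by blast
    have one: "N #>\<^bsub>G\<^esub> n = N" if "n \<in> N" for n
      using subgroup.rcos_const[OF stableD(1)[OF N] group_G that] .
    have "\<exists>w\<in>W. w \<notin> N"
    proof (rule ccontr)
      assume "\<not> ?thesis"
      then have "carrier (subquotient A W N) = {N}"
        unfolding carrier_subquotient using one stableD(4)[OF W] by auto
      then show False using irr by (simp add: irreducible_module_def zero_subquotient)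
    qed
    then obtain w where w: "w \<in> W" "w \<notin> N" by blast
    have WV: "x \<in> V" "x \<in> carrier G" if "x \<in> W" for x using that stableD(2)[OF W] V_G by auto
    define U where "U = N \<union> (\<lambda>u. w \<otimes>\<^bsub>G\<^esub> u) ` N"
    have "U \<subseteq> W" using NW stableD(5)[OF W w(1)] by (auto simp: U_def)
    moreover have "stable U"
      unfolding stable_def
      using adjoin_subgroup[OF stableD(1,2)[OF N] WV(1)[OF w(1)]] calculation WV triv by (auto simp: U_def[symmetric])
    moreover have "w \<in> U"
    proof -
      have "w \<otimes>\<^bsub>G\<^esub> \<one>\<^bsub>G\<^esub> = w" using WV w by simp
      then have "w \<in> (\<lambda>u. w \<otimes>\<^bsub>G\<^esub> u) ` N" using stableD(4)[OF N] by (metis imageI)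
      then show ?thesis by (simp add: U_def)
    qed
    ultimately have UW: "U = W"
      using irreducible_subquotient[OF W N NW irr, of U] w(2) by (auto simp: U_def)
    have cosets: "N #>\<^bsub>G\<^esub> x \<in> {N, N #>\<^bsub>G\<^esub> w}" if xW: "x \<in> W" for x
    proof -
      consider "x \<in> N" | n where "n \<in> N" "x = w \<otimes>\<^bsub>G\<^esub> n" using xW UW by (auto simp: U_def)
      then show ?thesis
      proof cases
        case 1 then show ?thesis using one by simp
      next
        case 2
        then have "x = n \<otimes>\<^bsub>G\<^esub> w" using V_commute WV w NW by blast
        then have "N #>\<^bsub>G\<^esub> x = (N #>\<^bsub>G\<^esub> n) #>\<^bsub>G\<^esub> w"
          using G.coset_mult_assoc[of N n w] 2 w WV NW subgroup.subset[OF stableD(1)[OF N]] by auto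
        then show ?thesis using one[OF 2(1)] by simp
      qed
    qed
    then have carr: "carrier Q \<subseteq> {N, N #>\<^bsub>G\<^esub> w}" unfolding Q carrier_subquotient by blast
    define Q' where "Q' = restrict_scalars (residue_ring 2) (Gal L k) Q"
    have carr': "carrier Q' = carrier Q" by (simp add: Q'_def restrict_scalars_def)
    obtain B where B: "B \<subseteq> carrier Q'" "finite B" "card B = 2"
      and uni: "\<And>v. v \<in> carrier Q' \<Longrightarrow> \<exists>!c. c \<in> B \<rightarrow>\<^sub>E carrier (residue_ring 2) \<and> v = (\<Oplus>\<^bsub>Q'\<^esub>b\<in>B. c b \<odot>\<^bsub>Q'\<^esub> b)"
      using dim by (auto simp: has_dimension_def Q'_def)
    have B2: "B \<subseteq> {N, N #>\<^bsub>G\<^esub> w}" using B(1) carr carr' by simp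
    have NB: "N \<in> B"
    proof (rule ccontr)
      assume "N \<notin> B"
      then have "B \<subseteq> {N #>\<^bsub>G\<^esub> w}" using B2 by blast
      then have "card B \<le> 1" using card_mono[of "{N #>\<^bsub>G\<^esub> w}" B] by simp
      then show False using B(3) by simp
    qed
    have comm: "comm_monoid (add_monoid Q')"
    proof (rule comm_monoid_cong[where B = "Gal M L\<lparr>carrier := W\<rparr> Mod N"])
      interpret W: comm_group "Gal M L\<lparr>carrier := W\<rparr>" by (rule comm_group_stable[OF W])
      interpret VG: comm_group "Gal M L" by (rule comm_group_V)
      have "subgroup N (Gal M L\<lparr>carrier := W\<rparr>)"
        using VG.subgroup_incl[of N W] stableD[OF N] stableD[OF W] NW by (simp add: subgroup_V_iff)
      then show "comm_monoid (Gal M L\<lparr>carrier := W\<rparr> Mod N)"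
        using W.abelian_FactGroup by (simp add: comm_group.axioms)
    qed (simp_all add: Q'_def Q restrict_scalars_def quotient_module_def FactGroup_def A_RCOSETS_def RCOSETS_def
        r_coset_def set_add_def set_mult_def galois_module_def fun_eq_iff)
    have zero_sum: "(\<Oplus>\<^bsub>Q'\<^esub>b\<in>B. c b \<odot>\<^bsub>Q'\<^esub> b) = N" if "\<And>b. b \<in> B \<Longrightarrow> c b \<odot>\<^bsub>Q'\<^esub> b = N" for c
    proof -
      have "finprod (add_monoid Q') (\<lambda>b. c b \<odot>\<^bsub>Q'\<^esub> b) B = \<one>\<^bsub>add_monoid Q'\<^esub>"
        by (rule comm_monoid.finprod_one_eqI[OF comm])
          (use that in \<open>simp add: Q'_def Q restrict_scalars_def quotient_module_def\<close>)
      then show ?thesis by (simp add: finsum_def Q'_def Q restrict_scalars_def quotient_module_def)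
    qed
    define e where "e = (\<lambda>c::int. \<lambda>x\<in>C. if x = \<one>\<^bsub>Gal L k\<^esub> then c else \<zero>\<^bsub>residue_ring 2\<^esub>)"
    have smult: "c \<odot>\<^bsub>Q'\<^esub> Z = N <#>\<^bsub>G\<^esub> ((\<lambda>x. e c \<odot>\<^bsub>A\<^esub> x) ` Z)" for c Z
      using smult_subquotient[where a = "e c" and W = W and N = N and Z = Z] by (simp add: Q'_def restrict_scalars_def e_def Q)
    have NN: "N <#>\<^bsub>G\<^esub> Y = N" if Y: "Y \<subseteq> N" "Y \<noteq> {}" for Y
    proof -
      obtain y where y: "y \<in> Y" using Y(2) by blast
      have "N = N #>\<^bsub>G\<^esub> y" using one y Y(1) by blast
      also have "\<dots> \<subseteq> N <#>\<^bsub>G\<^esub> Y" using y by (auto simp: set_mult_def r_coset_def)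
      finally show ?thesis using Y(1) stableD(5)[OF N] by (auto simp: set_mult_def)
    qed
    have e0: "e 0 \<odot>\<^bsub>A\<^esub> x = \<one>\<^bsub>G\<^esub>" for x
      unfolding smult_A one_Gal_M[of L, symmetric]
      by (rule comm_monoid.finprod_one_eqI[OF comm_group.axioms(1)[OF comm_group_V]])
        (simp add: e_def residue_ring_def)
    have s0: "0 \<odot>\<^bsub>Q'\<^esub> b = N" if "b \<in> B" for b
    proof -
      have "b \<noteq> {}" using that B2 stableD(4)[OF N] by (auto simp: r_coset_def)
      then show ?thesis unfolding smult e0 using stableD(4)[OF N] by (intro NN) auto
    qed
    have s1: "c \<odot>\<^bsub>Q'\<^esub> N = N" for c
      unfolding smult using smult_in_stable[OF N] stableD(4)[OF N] by (intro NN) auto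
    \<comment> \<open>Two expressions of zero: the coefficient of the basis element
      \<open>N\<close>, which is the zero of the quotient, may be 0 or 1.\<close>
    define c1 where "c1 = (\<lambda>b\<in>B. 0 :: int)"
    define c2 where "c2 = (\<lambda>b\<in>B. if b = N then 1 else 0 :: int)"
    have "c1 \<in> B \<rightarrow>\<^sub>E carrier (residue_ring 2)" "c2 \<in> B \<rightarrow>\<^sub>E carrier (residue_ring 2)"
      by (auto simp: c1_def c2_def residue_ring_def)
    moreover have "N = (\<Oplus>\<^bsub>Q'\<^esub>b\<in>B. c1 b \<odot>\<^bsub>Q'\<^esub> b)" "N = (\<Oplus>\<^bsub>Q'\<^esub>b\<in>B. c2 b \<odot>\<^bsub>Q'\<^esub> b)"
      by (rule zero_sum[symmetric], simp add: c1_def c2_def s0 s1)+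
    ultimately have "c1 = c2" using uni[of N] NB B(1) by blast
    moreover have "c1 N \<noteq> c2 N" using NB by (simp add: c1_def c2_def)
    ultimately show False by simp
  qed
  then show ?thesis using that by blast
qed

end

section \<open>Groups with quotient \<open>S\<^sub>3\<close> acting nontrivially on an elementary abelian kernel\<close>

definition (in group) conjugate :: "'a \<Rightarrow> 'a \<Rightarrow> 'a"
  where "conjugate g x = g \<otimes> x \<otimes> inv g"

context group
begin

lemma conjugate_closed [simp]: "g \<in> carrier G \<Longrightarrow> x \<in> carrier G \<Longrightarrow> conjugate g x \<in> carrier G"
  by (simp add: conjugate_def)

lemma conjugate_mult:
  assumes "g \<in> carrier G" "x \<in> carrier G" "y \<in> carrier G"
  shows "conjugate g (x \<otimes> y) = conjugate g x \<otimes> conjugate g y"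
proof -
  have "conjugate g x \<otimes> conjugate g y = g \<otimes> x \<otimes> (inv g \<otimes> g) \<otimes> y \<otimes> inv g"
    using assms by (simp only: conjugate_def m_assoc m_closed inv_closed)
  then show ?thesis using assms by (simp add: conjugate_def m_assoc)
qed

lemma conjugate_conjugate:
  assumes "g \<in> carrier G" "h \<in> carrier G" "x \<in> carrier G"
  shows "conjugate g (conjugate h x) = conjugate (g \<otimes> h) x"
  using assms by (simp add: conjugate_def m_assoc inv_mult_group)

lemma conjugate_one [simp]: "g \<in> carrier G \<Longrightarrow> conjugate g \<one> = \<one>" "x \<in> carrier G \<Longrightarrow> conjugate \<one> x = x"
  by (simp_all add: conjugate_def)

lemma conjugate_inv_eq:
  assumes "g \<in> carrier G" "x \<in> carrier G" "y \<in> carrier G" "conjugate g x = conjugate g y"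
  shows "x = y"
  using assms by (simp add: conjugate_def)

lemma conjugate_inv:
  assumes "g \<in> carrier G" "x \<in> carrier G"
  shows "conjugate g (inv x) = inv (conjugate g x)"
  using assms by (simp add: conjugate_def m_assoc inv_mult_group)

lemma conjugate_eq_iff_commute:
  assumes "g \<in> carrier G" "x \<in> carrier G"
  shows "conjugate g x = x \<longleftrightarrow> g \<otimes> x = x \<otimes> g"
  using assms unfolding conjugate_def by (metis inv_solve_right m_closed)

end

text \<open>\<open>c\<close> and \<open>s\<close> are lifts of a rotation and of a reflection in \<open>S\<^sub>3\<close>.\<close>

locale S3_extension = group G for G (structure) +
  fixes V :: "'a set" and c s :: 'a
  assumes V: "subgroup V G" and V_conj: "\<And>g v. g \<in> carrier G \<Longrightarrow> v \<in> V \<Longrightarrow> conjugate g v \<in> V"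
    and V_sq: "\<And>v. v \<in> V \<Longrightarrow> v \<otimes> v = \<one>"
    and c: "c \<in> carrier G" and s: "s \<in> carrier G"
    and c3: "c \<otimes> c \<otimes> c = \<one>" and s2: "s \<otimes> s \<in> V" and scs: "s \<otimes> c \<otimes> inv s \<otimes> c \<in> V"
    and gen: "\<And>g. g \<in> carrier G \<Longrightarrow> \<exists>v\<in>V. g \<in> {v, v \<otimes> c, v \<otimes> (c \<otimes> c), v \<otimes> s, v \<otimes> (c \<otimes> s), v \<otimes> (c \<otimes> c \<otimes> s)}"
    and nontriv: "\<exists>v\<in>V. conjugate c v \<noteq> v"
begin

lemma V_G: "v \<in> V \<Longrightarrow> v \<in> carrier G" using subgroup.subset[OF V] by blast

lemma V_closed: "v \<in> V \<Longrightarrow> w \<in> V \<Longrightarrow> v \<otimes> w \<in> V" "\<one> \<in> V" "v \<in> V \<Longrightarrow> inv v \<in> V"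
  using V by (auto intro: subgroup.m_closed subgroup.one_closed subgroup.m_inv_closed)

lemma V_inv: "v \<in> V \<Longrightarrow> inv v = v"
  using V_sq V_G by (intro inv_equality) auto

lemma V_comm: "v \<in> V \<Longrightarrow> w \<in> V \<Longrightarrow> v \<otimes> w = w \<otimes> v"
proof -
  assume v: "v \<in> V" and w: "w \<in> V"
  have "v \<otimes> w = inv (v \<otimes> w)" using V_inv[OF V_closed(1)[OF v w]] by simp
  also have "\<dots> = inv w \<otimes> inv v" using V_G v w by (intro inv_mult_group) auto
  finally show ?thesis using V_inv v w by simp
qed

lemma V_cancel: "v \<in> V \<Longrightarrow> x \<in> carrier G \<Longrightarrow> v \<otimes> (v \<otimes> x) = x"
  using V_sq V_G by (simp add: m_assoc[symmetric])

lemma conj_V_trivial: "w \<in> V \<Longrightarrow> v \<in> V \<Longrightarrow> conjugate w v = v"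
  using V_comm V_G by (simp add: conjugate_eq_iff_commute)

abbreviation "\<gamma> \<equiv> conjugate c"
abbreviation "\<sigma> \<equiv> conjugate s"

lemma gamma3: "v \<in> V \<Longrightarrow> \<gamma> (\<gamma> (\<gamma> v)) = v"
  using c3 c V_G by (simp add: conjugate_conjugate m_assoc)

lemma sigma2: "v \<in> V \<Longrightarrow> \<sigma> (\<sigma> v) = v"
  using conj_V_trivial[OF s2] s V_G by (simp add: conjugate_conjugate)

lemma sigma_gamma: "v \<in> V \<Longrightarrow> \<sigma> (\<gamma> v) = \<gamma> (\<gamma> (\<sigma> v))"
proof -
  assume v: "v \<in> V"
  define t where "t = s \<otimes> c \<otimes> inv s \<otimes> c"
  have t: "t \<in> V" using scs by (simp add: t_def)
  define w where "w = \<gamma> (\<gamma> (\<sigma> v))"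
  have w: "w \<in> V" using v V_conj c s by (simp add: w_def)
  have "conjugate t w = conjugate (s \<otimes> c \<otimes> inv s) (\<gamma> w)"
    using c s w V_G by (simp add: t_def conjugate_conjugate)
  also have "\<gamma> w = \<sigma> v" using gamma3[of "\<sigma> v"] v V_conj s by (simp add: w_def)
  also have "conjugate (s \<otimes> c \<otimes> inv s) (\<sigma> v) = conjugate (s \<otimes> c \<otimes> inv s \<otimes> s) v"
    using c s v V_G by (simp add: conjugate_conjugate)
  also have "s \<otimes> c \<otimes> inv s \<otimes> s = s \<otimes> c" using c s by (simp add: m_assoc)
  also have "conjugate (s \<otimes> c) v = \<sigma> (\<gamma> v)" using c s v V_G by (simp add: conjugate_conjugate)
  finally show ?thesis using conj_V_trivial[OF t w] by (simp add: w_def)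
qed

lemma gamma_mult: "v \<in> V \<Longrightarrow> w \<in> V \<Longrightarrow> \<gamma> (v \<otimes> w) = \<gamma> v \<otimes> \<gamma> w"
  and sigma_mult: "v \<in> V \<Longrightarrow> w \<in> V \<Longrightarrow> \<sigma> (v \<otimes> w) = \<sigma> v \<otimes> \<sigma> w"
  using c s V_G by (simp_all add: conjugate_mult)

lemma gamma_V: "v \<in> V \<Longrightarrow> \<gamma> v \<in> V" and sigma_V: "v \<in> V \<Longrightarrow> \<sigma> v \<in> V"
  using V_conj c s by auto

text \<open>\<open>V\<close> acts trivially on itself, so by \<open>gen\<close> every element of
  \<open>G\<close> acts on \<open>V\<close> as a product of \<open>\<gamma>\<close> and
  \<open>\<sigma>\<close>.\<close>

lemma normal_if_stable:
  assumes U: "subgroup U G" "U \<subseteq> V" and "\<And>u. u \<in> U \<Longrightarrow> \<gamma> u \<in> U" and "\<And>u. u \<in> U \<Longrightarrow> \<sigma> u \<in> U"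
  shows "U \<lhd> G"
  unfolding normal_inv_iff
proof (intro conjI ballI U)
  fix g u assume g: "g \<in> carrier G" and u: "u \<in> U"
  have uG: "u \<in> carrier G" using u U(2) V_G by auto
  have *: "conjugate v x = x" if "v \<in> V" "x \<in> U" for v x using conj_V_trivial that U(2) by blast
  obtain v where v: "v \<in> V" and g: "g \<in> {v, v \<otimes> c, v \<otimes> (c \<otimes> c), v \<otimes> s, v \<otimes> (c \<otimes> s), v \<otimes> (c \<otimes> c \<otimes> s)}"
    using gen[OF g] by blast
  have "conjugate g u \<in> {u, \<gamma> u, \<gamma> (\<gamma> u), \<sigma> u, \<gamma> (\<sigma> u), \<gamma> (\<gamma> (\<sigma> u))}"
    using g *[OF v] assms(3,4) u c s V_G[OF v] uG
    by (auto simp: conjugate_conjugate[symmetric])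
  then show "g \<otimes> u \<otimes> inv g \<in> U" using u assms(3,4) unfolding conjugate_def[symmetric] by auto
qed

end

text \<open>As \<open>V\<close> has exponent 2, \<open>v \<otimes> \<gamma> v \<in> U\<close> means
  that \<open>c\<close> fixes \<open>v\<close> modulo \<open>U\<close>. The axiom says that dividing
  by any nontrivial normal subgroup inside \<open>V\<close> makes the action of \<open>c\<close>
  trivial.\<close>

locale minimal_S3_extension = S3_extension +
  assumes minimal: "\<And>U v. U \<lhd> G \<Longrightarrow> U \<subseteq> V \<Longrightarrow> U \<noteq> {\<one>} \<Longrightarrow> v \<in> V \<Longrightarrow> v \<otimes> \<gamma> v \<in> U"
begin

text \<open>The fixed points of \<open>\<gamma>\<close> form a normal subgroup. If it were
  nontrivial, every \<open>w \<otimes> \<gamma> w\<close> would be fixed, so \<open>\<gamma>\<close>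
  would satisfy \<open>\<gamma> (\<gamma> w) = w\<close>, and having order dividing 3 it would be
  the identity.\<close>

lemma fixed_trivial:
  assumes "v \<in> V" "\<gamma> v = v" shows "v = \<one>"
proof (rule ccontr)
  assume "v \<noteq> \<one>"
  define U where "U = {v \<in> V. \<gamma> v = v}"
  have "subgroup U G"
    by (rule subgroupI) (use V_G V_closed gamma_mult c in \<open>auto simp: U_def V_inv\<close>)
  moreover have "\<gamma> (\<sigma> u) = \<sigma> u" if u: "u \<in> V" "\<gamma> u = u" for u
    using sigma_gamma[OF u(1)] gamma3[OF sigma_V[OF u(1)]] u(2) by simp
  ultimately have "U \<lhd> G" by (intro normal_if_stable) (auto simp: U_def sigma_V)
  moreover have "v \<in> U" using assms by (simp add: U_def)
  ultimately have *: "w \<otimes> \<gamma> w \<in> U" if "w \<in> V" for w using minimal[of U w] that \<open>v \<noteq> \<one>\<close> by (auto simp: U_def)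
  have "\<gamma> w = w" if w: "w \<in> V" for w
  proof -
    have "\<gamma> w \<otimes> \<gamma> (\<gamma> w) = w \<otimes> \<gamma> w" using *[OF w] gamma_mult[OF w gamma_V[OF w]] by (simp add: U_def)
    then have "\<gamma> w \<otimes> \<gamma> (\<gamma> w) = \<gamma> w \<otimes> w" using V_comm[OF w gamma_V[OF w]] by simp
    then have "\<gamma> (\<gamma> w) = w" using w V_G gamma_V by simp
    then show ?thesis using gamma3[OF w] by simp
  qed
  then show False using nontriv by blast
qed

text \<open>The product of \<open>v\<close>, \<open>\<gamma> v\<close> and
  \<open>\<gamma> (\<gamma> v)\<close> is fixed by \<open>\<gamma>\<close>, hence trivial.\<close>

lemma orbit_sum: "v \<in> V \<Longrightarrow> v \<otimes> \<gamma> v = \<gamma> (\<gamma> v)"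
proof -
  assume v: "v \<in> V"
  note g = gamma_V[OF v] gamma_V[OF gamma_V[OF v]]
  define t where "t = v \<otimes> \<gamma> v \<otimes> \<gamma> (\<gamma> v)"
  have tV: "t \<in> V" using v g V_closed by (simp add: t_def)
  have "\<gamma> t = \<gamma> v \<otimes> \<gamma> (\<gamma> v) \<otimes> v" using v g V_closed gamma3 by (simp add: t_def gamma_mult)
  also have "\<dots> = t" using V_comm[of "\<gamma> v \<otimes> \<gamma> (\<gamma> v)" v] v g V_closed V_G by (simp add: t_def m_assoc)
  finally have "t = \<one>" using fixed_trivial tV by blast
  then have "(v \<otimes> \<gamma> v) \<otimes> \<gamma> (\<gamma> v) = \<one>" by (simp add: t_def)
  then have "v \<otimes> \<gamma> v = inv (\<gamma> (\<gamma> v))" using v g V_G by (intro inv_equality[symmetric]) auto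
  then show ?thesis using V_inv g by simp
qed

text \<open>\<open>\<sigma>\<close> is an involution on a group of exponent 2: either
  \<open>w \<otimes> \<sigma> w\<close> is a nontrivial fixed element, or it is trivial and
  \<open>w\<close> itself is fixed.\<close>

lemma exists_sigma_fixed:
  obtains v where "v \<in> V" "v \<noteq> \<one>" "\<sigma> v = v"
proof -
  obtain w where w: "w \<in> V" "\<gamma> w \<noteq> w" using nontriv by blast
  then have w1: "w \<noteq> \<one>" using c by auto
  show ?thesis
  proof (cases "w \<otimes> \<sigma> w = \<one>")
    case True
    then have "\<sigma> w = inv w" using w V_G sigma_V by (metis inv_equality inv_inv)
    then show ?thesis using that[of w] w w1 V_inv by simp
  next
    case False
    have "\<sigma> (w \<otimes> \<sigma> w) = w \<otimes> \<sigma> w"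
      using sigma_mult[OF w(1) sigma_V[OF w(1)]] sigma2[OF w(1)] V_comm[OF w(1) sigma_V[OF w(1)]] by simp
    then show ?thesis using that[of "w \<otimes> \<sigma> w"] False V_closed w sigma_V by blast
  qed
qed

text \<open>The orbit of \<open>v\<close> under \<open>\<gamma>\<close> together with the unit is
  normal, because \<open>\<sigma>\<close> fixes \<open>v\<close> and swaps the other two elements.
  Minimality puts every \<open>\<gamma> (\<gamma> w)\<close> into it, and
  \<open>\<gamma> (\<gamma> w)\<close> runs through all of \<open>V\<close>.\<close>

lemma V_eq:
  assumes v: "v \<in> V" "v \<noteq> \<one>" "\<sigma> v = v"
  shows "V = {\<one>, v, \<gamma> v, \<gamma> (\<gamma> v)}" "card V = 4"
proof -
  note g = gamma_V[OF v(1)] gamma_V[OF gamma_V[OF v(1)]]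
  define U where "U = {\<one>, v, \<gamma> v, \<gamma> (\<gamma> v)}"
  have UV: "U \<subseteq> V" using v g V_closed by (auto simp: U_def)
  have p: "v \<otimes> \<gamma> v = \<gamma> (\<gamma> v)" "\<gamma> v \<otimes> \<gamma> (\<gamma> v) = v" "\<gamma> (\<gamma> v) \<otimes> v = \<gamma> v"
    using orbit_sum[OF v(1)] orbit_sum[OF g(1)] orbit_sum[OF g(2)] gamma3[OF v(1)] gamma3[OF g(1)] by auto
  then have p': "\<gamma> v \<otimes> v = \<gamma> (\<gamma> v)" "\<gamma> (\<gamma> v) \<otimes> \<gamma> v = v" "v \<otimes> \<gamma> (\<gamma> v) = \<gamma> v"
    using V_comm v g by metis+
  have "subgroup U G"
  proof (rule subgroupI)
    show "U \<subseteq> carrier G" using UV V_G by blast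
    show "U \<noteq> {}" by (simp add: U_def)
    show "inv u \<in> U" if "u \<in> U" for u using that UV V_inv by auto
    show "a \<otimes> b \<in> U" if "a \<in> U" "b \<in> U" for a b
      using that p p' v(1) g V_sq V_G unfolding U_def by auto
  qed
  moreover have "\<sigma> (\<gamma> v) = \<gamma> (\<gamma> v)" "\<sigma> (\<gamma> (\<gamma> v)) = \<gamma> v"
    using sigma_gamma[OF v(1)] sigma_gamma[OF g(1)] v gamma3[OF g(1)] by auto
  ultimately have "U \<lhd> G"
    using UV v g gamma3[OF v(1)] c s by (intro normal_if_stable) (auto simp: U_def)
  then have "w \<otimes> \<gamma> w \<in> U" if "w \<in> V" for w using minimal[of U w] UV that v by (auto simp: U_def)
  then have *: "\<gamma> (\<gamma> w) \<in> U" if "w \<in> V" for w using orbit_sum that by metis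
  have "w \<in> U" if w: "w \<in> V" for w using *[OF gamma_V[OF w]] gamma3[OF w] by simp
  then show VU: "V = {\<one>, v, \<gamma> v, \<gamma> (\<gamma> v)}" using UV unfolding U_def by blast
  have "\<gamma> v \<noteq> v" using fixed_trivial v by blast
  moreover have "\<gamma> (\<gamma> v) \<noteq> v" using gamma3[OF v(1)] calculation by metis
  moreover have "\<gamma> (\<gamma> v) \<noteq> \<gamma> v" using fixed_trivial[OF g(1)] conjugate_inv_eq[OF c, of "\<gamma> v" v] v g V_G calculation by metis
  moreover have "\<gamma> v \<noteq> \<one>" using v g V_G c conjugate_inv_eq[of c v \<one>] by auto
  moreover have "\<gamma> (\<gamma> v) \<noteq> \<one>" using calculation(4) v g V_G c conjugate_inv_eq[of c "\<gamma> v" \<one>] by auto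
  ultimately show "card V = 4" unfolding VU using v(2) by auto
qed

text \<open>Each of the five nontrivial coset representatives of \<open>V\<close> moves
  \<open>v\<close> or \<open>\<gamma> v\<close>.\<close>

lemma centralizer_V:
  assumes g: "g \<in> carrier G" and cent: "\<And>v. v \<in> V \<Longrightarrow> conjugate g v = v"
  shows "g \<in> V"
proof -
  obtain v where v: "v \<in> V" "v \<noteq> \<one>" "\<sigma> v = v" using exists_sigma_fixed .
  note gv = gamma_V[OF v(1)] gamma_V[OF gamma_V[OF v(1)]]
  note vG = V_G[OF v(1)] V_G[OF gv(1)] V_G[OF gv(2)]
  have n1: "\<gamma> v \<noteq> v" using fixed_trivial v by blast
  have n2: "\<gamma> (\<gamma> v) \<noteq> v" using gamma3[OF v(1)] n1 by metis
  have n3: "\<gamma> (\<gamma> v) \<noteq> \<gamma> v" using conjugate_inv_eq[OF c vG(2) vG(1)] n1 by blast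
  have sg: "\<sigma> (\<gamma> v) = \<gamma> (\<gamma> v)" using sigma_gamma[OF v(1)] v(3) by simp
  obtain w where w: "w \<in> V" and gw: "g \<in> {w, w \<otimes> c, w \<otimes> (c \<otimes> c), w \<otimes> s, w \<otimes> (c \<otimes> s), w \<otimes> (c \<otimes> c \<otimes> s)}"
    using gen[OF g] by blast
  have wt: "conjugate w x = x" if "x \<in> V" for x using conj_V_trivial[OF w that] .
  note wG = V_G[OF w]
  have e1: "conjugate (w \<otimes> c) v = \<gamma> v"
    using wt[OF gv(1)] conjugate_conjugate[OF wG c vG(1)] by simp
  have e2: "conjugate (w \<otimes> (c \<otimes> c)) v = \<gamma> (\<gamma> v)"
    using wt[OF gv(2)] conjugate_conjugate[OF wG _ vG(1), of "c \<otimes> c"] conjugate_conjugate[OF c c vG(1)] c by simp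
  have e3: "conjugate (w \<otimes> s) (\<gamma> v) = \<gamma> (\<gamma> v)"
    using wt[OF gv(2)] conjugate_conjugate[OF wG s vG(2)] sg by simp
  have e4: "conjugate (w \<otimes> (c \<otimes> s)) v = \<gamma> v"
    using wt[OF gv(1)] conjugate_conjugate[OF wG _ vG(1), of "c \<otimes> s"] conjugate_conjugate[OF c s vG(1)] c s v(3) by simp
  have e5: "conjugate (w \<otimes> (c \<otimes> c \<otimes> s)) v = \<gamma> (\<gamma> v)"
    using wt[OF gv(2)] conjugate_conjugate[OF wG _ vG(1), of "c \<otimes> c \<otimes> s"]
      conjugate_conjugate[of "c \<otimes> c" s, OF _ s vG(1)] conjugate_conjugate[OF c c vG(1)] c s v(3) by simp
  show ?thesis
    using gw cent[OF v(1)] cent[OF gv(1)] e1 e2 e3 e4 e5 n1 n2 n3 w by auto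
qed

end

section \<open>The action on four pairs and the isomorphism with the symmetric group\<close>

context minimal_S3_extension
begin

text \<open>\<open>G\<close> acts on the four sets \<open>{x, inv x}\<close>, where \<open>x\<close> is a conjugate of \<open>c\<close> under \<open>V\<close>.\<close>

definition pair :: "'a \<Rightarrow> 'a set"
  where "pair u = conjugate u ` {c, inv c}"

definition act :: "'a \<Rightarrow> 'a set \<Rightarrow> 'a set"
  where "act g S = conjugate g ` S"

lemma pair_subset: "u \<in> carrier G \<Longrightarrow> pair u \<subseteq> carrier G"
  using c by (auto simp: pair_def)

lemma act_act: "g \<in> carrier G \<Longrightarrow> h \<in> carrier G \<Longrightarrow> S \<subseteq> carrier G \<Longrightarrow> act g (act h S) = act (g \<otimes> h) S"
  unfolding act_def image_image by (intro image_cong) (auto simp: conjugate_conjugate)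

lemma act_one: "S \<subseteq> carrier G \<Longrightarrow> act \<one> S = S"
  unfolding act_def by force

lemma act_pair: "g \<in> carrier G \<Longrightarrow> u \<in> carrier G \<Longrightarrow> act g (pair u) = pair (g \<otimes> u)"
  using c by (simp add: act_def pair_def conjugate_conjugate)

lemma inv_c: "inv c = c \<otimes> c"
  using c3 c by (intro inv_equality) auto

lemma pair_shift:
  assumes "u \<in> carrier G" "g \<in> carrier G" "pair g = pair w" "w \<in> carrier G"
  shows "pair (u \<otimes> g) = pair (u \<otimes> w)"
  using assms act_pair by metis

lemma pair_c: "pair c = pair \<one>"
  using c by (simp add: pair_def conjugate_def m_assoc)

text \<open>\<open>s\<close> carries \<open>c\<close> to \<open>t\<close> times the inverse of
  \<open>c\<close> with \<open>t\<close> in \<open>V\<close>. The factor \<open>t\<close> is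
  absorbed by conjugation with some \<open>w\<close> in \<open>V\<close>, an instance of the
  vanishing of first cohomology.\<close>

lemma pair_s:
  obtains w where "w \<in> V" "pair s = pair w"
proof -
  define t where "t = s \<otimes> c \<otimes> inv s \<otimes> c"
  have t: "t \<in> V" using scs by (simp add: t_def)
  \<comment> \<open>The equation to solve is \<open>t = w \<otimes> \<gamma> (\<gamma> w)\<close>.
    By \<open>orbit_sum\<close> its right side is \<open>\<gamma> w\<close>, so \<open>w\<close> is
    obtained by applying \<open>\<gamma>\<close> twice to \<open>t\<close>.\<close>
  define w where "w = \<gamma> (\<gamma> t)"
  have w: "w \<in> V" using gamma_V t by (simp add: w_def)
  have "conjugate s c = t \<otimes> inv c" using c s by (simp add: conjugate_def t_def m_assoc)
  also have "t = w \<otimes> conjugate (inv c) w"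
  proof -
    have "conjugate (inv c) w = \<gamma> (\<gamma> w)" unfolding inv_c using c w V_G by (simp add: conjugate_conjugate)
    also have "\<dots> = \<gamma> t" using gamma3[OF gamma_V[OF t]] by (simp add: w_def)
    also have "w \<otimes> \<gamma> t = t"
      using orbit_sum[OF w] V_comm[OF w gamma_V[OF w]] orbit_sum[OF gamma_V[OF t]] V_comm[OF w gamma_V[OF t]] gamma3[OF t]
      by (simp add: w_def)
    finally show ?thesis by simp
  qed
  also have "w \<otimes> conjugate (inv c) w \<otimes> inv c = conjugate w (inv c)"
    using w V_G c V_inv by (simp add: conjugate_def m_assoc)
  finally have sc: "conjugate s c = conjugate w (inv c)" .
  then have "conjugate s (inv c) = conjugate w c"
    using conjugate_inv[OF s c] conjugate_inv[OF V_G[OF w], of "inv c"] c by simp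
  then have "pair s = pair w" using sc by (auto simp: pair_def)
  then show ?thesis using that w by blast
qed

text \<open>The property passes to products, so it is checked on \<open>V\<close>, \<open>c\<close>
  and \<open>s\<close>.\<close>

lemma act_pair_V:
  assumes g: "g \<in> carrier G" and u: "u \<in> V"
  obtains w where "w \<in> V" "act g (pair u) = pair w"
proof -
  define P where "P = (\<lambda>g. \<forall>u\<in>V. \<exists>w\<in>V. act g (pair u) = pair w)"
  have PV: "P v" if "v \<in> V" for v
    using that V_closed V_G act_pair unfolding P_def by metis
  have Pc: "P c"
    unfolding P_def
  proof
    fix u assume u: "u \<in> V"
    have "act c (pair u) = pair (c \<otimes> u)" using act_pair[OF c V_G[OF u]] .
    also have "c \<otimes> u = \<gamma> u \<otimes> c" using c V_G[OF u] by (simp add: conjugate_def m_assoc)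
    also have "pair (\<gamma> u \<otimes> c) = pair (\<gamma> u \<otimes> \<one>)"
      using pair_shift[OF _ c pair_c] V_G gamma_V u by simp
    finally show "\<exists>w\<in>V. act c (pair u) = pair w" using gamma_V[OF u] V_G by auto
  qed
  have Ps: "P s"
    unfolding P_def
  proof
    fix u assume u: "u \<in> V"
    obtain w where w: "w \<in> V" "pair s = pair w" using pair_s .
    have "act s (pair u) = pair (s \<otimes> u)" using act_pair[OF s V_G[OF u]] .
    also have "s \<otimes> u = \<sigma> u \<otimes> s" using s V_G[OF u] by (simp add: conjugate_def m_assoc)
    also have "pair (\<sigma> u \<otimes> s) = pair (\<sigma> u \<otimes> w)"
      using pair_shift[OF _ s w(2)] V_G sigma_V u w(1) by simp
    finally show "\<exists>w\<in>V. act s (pair u) = pair w" using V_closed(1)[OF sigma_V[OF u] w(1)] by blast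
  qed
  have Pm: "P (g \<otimes> h)" if "P g" "P h" "g \<in> carrier G" "h \<in> carrier G" for g h
    unfolding P_def
  proof
    fix u assume u: "u \<in> V"
    obtain w where w: "w \<in> V" "act h (pair u) = pair w" using \<open>P h\<close> u by (auto simp: P_def)
    have "act (g \<otimes> h) (pair u) = act g (pair w)"
      using act_act[OF that(3,4) pair_subset[OF V_G[OF u]]] w(2) by simp
    then show "\<exists>w\<in>V. act (g \<otimes> h) (pair u) = pair w" using \<open>P g\<close> w(1) by (simp add: P_def)
  qed
  obtain v where v: "v \<in> V" and "g \<in> {v, v \<otimes> c, v \<otimes> (c \<otimes> c), v \<otimes> s, v \<otimes> (c \<otimes> s), v \<otimes> (c \<otimes> c \<otimes> s)}"
    using gen[OF g] by blast
  then have "P g" using PV[OF v] Pc Ps Pm V_G[OF v] c s by auto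
  then show ?thesis using u that unfolding P_def by blast
qed

text \<open>With \<open>u = w \<otimes> x\<close>, conjugation by \<open>x\<close> sends
  \<open>c\<close> to \<open>c\<close> or to its inverse. In the first case \<open>\<gamma>\<close>
  fixes \<open>x\<close>; in the second, \<open>c \<otimes> c\<close> would lie in \<open>V\<close>
  and \<open>c\<close> would act trivially.\<close>

lemma pair_inj:
  assumes u: "u \<in> V" and w: "w \<in> V" and eq: "pair u = pair w"
  shows "u = w"
proof -
  note uG = V_G[OF u] and wG = V_G[OF w]
  define x where "x = inv w \<otimes> u"
  have x: "x \<in> V" using u w V_closed by (simp add: x_def)
  have ux: "u = w \<otimes> x" using uG wG by (simp add: x_def m_assoc[symmetric])
  have "conjugate u c \<in> conjugate w ` {c, inv c}" using eq by (auto simp: pair_def)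
  then obtain d where d: "d \<in> {c, inv c}" "conjugate u c = conjugate w d" by blast
  have "conjugate w (conjugate x c) = conjugate w d"
    using d(2) conjugate_conjugate[OF wG V_G[OF x] c] ux by simp
  then have xd: "conjugate x c = d" using conjugate_inv_eq[OF wG conjugate_closed[OF V_G[OF x] c]] d(1) c by auto
  show ?thesis
  proof (cases "d = c")
    case True
    then have "x \<otimes> c = c \<otimes> x" using xd conjugate_eq_iff_commute[OF V_G[OF x] c] by simp
    then have "\<gamma> x = x" using conjugate_eq_iff_commute[OF c V_G[OF x]] by simp
    then show ?thesis using fixed_trivial[OF x] ux wG by simp
  next
    case False
    then have "x \<otimes> c \<otimes> inv x = inv c" using xd d(1) by (auto simp: conjugate_def)
    then have "x \<otimes> c \<otimes> inv x \<otimes> c = \<one>" using c by simp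
    moreover have "x \<otimes> c \<otimes> inv x \<otimes> c = (x \<otimes> \<gamma> (inv x)) \<otimes> (c \<otimes> c)"
    proof -
      have "inv c \<otimes> (c \<otimes> c) = c" using c by (simp add: m_assoc[symmetric])
      then show ?thesis using c V_G[OF x] by (simp add: conjugate_def m_assoc)
    qed
    moreover have y: "x \<otimes> \<gamma> (inv x) \<in> V" using x V_closed gamma_V by simp
    ultimately have "c \<otimes> c = inv (x \<otimes> \<gamma> (inv x))"
      using c V_G[OF y] by (metis inv_equality inv_inv m_closed)
    then have cc: "c \<otimes> c \<in> V" using V_closed(3)[OF y] by simp
    have "\<gamma> v = v" if v: "v \<in> V" for v
    proof -
      have "\<gamma> (\<gamma> v) = v" using conj_V_trivial[OF cc v] conjugate_conjugate[OF c c V_G[OF v]] by simp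
      then show ?thesis using gamma3[OF v] by simp
    qed
    then show ?thesis using nontriv by blast
  qed
qed

text \<open>For \<open>u\<close> in \<open>V\<close>, the commutator \<open>k\<close> of
  \<open>g\<close> and \<open>u\<close> lies in \<open>V\<close> and fixes all pairs involved, so it
  is trivial by \<open>pair_inj\<close>. Hence \<open>g\<close> centralizes \<open>V\<close>, lies
  in \<open>V\<close>, and is trivial again by \<open>pair_inj\<close>.\<close>

lemma act_faithful:
  assumes g: "g \<in> carrier G" and triv: "\<And>u. u \<in> V \<Longrightarrow> act g (pair u) = pair u"
  shows "g = \<one>"
proof -
  have gi: "act (inv g) (pair u) = pair u" if u: "u \<in> V" for u
  proof -
    have "act (inv g) (act g (pair u)) = pair u"
      using act_act[of "inv g" g "pair u"] g pair_subset[OF V_G[OF u]] act_one by simp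
    then show ?thesis using triv[OF u] by simp
  qed
  have "conjugate g u = u" if u: "u \<in> V" for u
  proof -
    note uG = V_G[OF u]
    define k where "k = conjugate g u \<otimes> inv u"
    have kV: "k \<in> V" using V_conj[OF g u] u V_closed by (simp add: k_def)
    have "act k (pair \<one>) = act g (act u (act (inv g) (act (inv u) (pair \<one>))))"
    proof -
      have "act g (act u (act (inv g) (act (inv u) (pair \<one>)))) = act (g \<otimes> (u \<otimes> (inv g \<otimes> inv u))) (pair \<one>)"
        using g uG by (simp add: act_act pair_subset)
      then show ?thesis using g uG by (simp add: k_def conjugate_def m_assoc)
    qed
    also have "\<dots> = act g (act u (act (inv u) (pair \<one>)))"
      using gi[OF V_closed(3)[OF u]] act_pair[of "inv u" \<one>] uG by simp
    also have "\<dots> = act g (pair \<one>)"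
      using uG by (simp add: act_act pair_subset act_one)
    also have "\<dots> = pair \<one>" using triv V_closed(2) by simp
    finally have "pair k = pair \<one>" using act_pair[OF V_G[OF kV] one_closed] V_G[OF kV] by simp
    then have "k = \<one>" using pair_inj[OF kV V_closed(2)] by simp
    then have "conjugate g u = inv (inv u)"
      unfolding k_def using g uG by (metis conjugate_closed inv_closed inv_equality)
    then show ?thesis using uG by simp
  qed
  then have gV: "g \<in> V" by (rule centralizer_V[OF g])
  then have "pair g = pair \<one>" using triv[OF V_closed(2)] act_pair[OF g one_closed] g by simp
  then show ?thesis using pair_inj[OF gV V_closed(2)] by simp
qed

text \<open>\<open>q\<close> records the action on \<open>v\<close> and \<open>\<gamma> v\<close>.
  It is constant on cosets of \<open>V\<close> and separates six representatives; each coset has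
  four elements.\<close>

lemma card_carrier_ge:
  assumes "finite (carrier G)"
  shows "24 \<le> card (carrier G)"
proof -
  obtain v where v: "v \<in> V" "v \<noteq> \<one>" "\<sigma> v = v" using exists_sigma_fixed .
  note gv = gamma_V[OF v(1)] gamma_V[OF gamma_V[OF v(1)]]
  note vG = V_G[OF v(1)] V_G[OF gv(1)] V_G[OF gv(2)]
  define a b where "a = \<gamma> v" and "b = \<gamma> (\<gamma> v)"
  have ne: "v \<noteq> a" "a \<noteq> b" "v \<noteq> b"
  proof -
    show 1: "v \<noteq> a" using fixed_trivial v a_def by metis
    show "a \<noteq> b" using 1 conjugate_inv_eq[OF c vG(2) vG(1)] a_def b_def by metis
    show "v \<noteq> b" using 1 gamma3[OF v(1)] a_def b_def by metis
  qed
  have cy: "\<gamma> v = a" "\<gamma> a = b" "\<gamma> b = v" "\<sigma> v = v" "\<sigma> a = b"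
    using gamma3[OF v(1)] sigma_gamma[OF v(1)] v(3) by (auto simp: a_def b_def)
  have abG: "a \<in> carrier G" "b \<in> carrier G" "a \<in> V" "b \<in> V" using vG gv by (auto simp: a_def b_def)
  define rs where "rs = [\<one>, c, c \<otimes> c, s, c \<otimes> s, c \<otimes> c \<otimes> s]"
  define q where "q = (\<lambda>g. (conjugate g v, conjugate g a))"
  have q: "map q rs = [(v, a), (a, b), (b, v), (v, b), (a, v), (b, a)]"
    using c s vG abG cy by (simp add: rs_def q_def conjugate_conjugate[symmetric])
  have rsG: "r \<in> carrier G" if "r \<in> set rs" for r using that c s by (auto simp: rs_def)
  have "distinct (map q rs)" unfolding q using ne by auto
  then have inj: "inj_on q (set rs)" and dist: "distinct rs" by (auto simp: distinct_map)
  have qV: "q (w \<otimes> r) = q r" if "w \<in> V" "r \<in> set rs" for w r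
    using conj_V_trivial[OF that(1)] V_conj[OF rsG[OF that(2)]] v(1) abG V_G[OF that(1)] rsG[OF that(2)] vG
    by (simp add: q_def conjugate_conjugate[symmetric])
  have "inj_on (\<lambda>(w, r). w \<otimes> r) (V \<times> set rs)"
  proof (rule inj_onI, clarify)
    fix w r w' r' assume *: "w \<in> V" "r \<in> set rs" "w' \<in> V" "r' \<in> set rs" "w \<otimes> r = w' \<otimes> r'"
    then have "q r = q r'" using qV by metis
    then have "r = r'" using inj * by (auto dest: inj_onD)
    then show "w = w' \<and> r = r'" using * V_G rsG by simp
  qed
  then have "card (V \<times> set rs) \<le> card (carrier G)"
    by (rule card_inj_on_le) (use assms V_G rsG in auto)
  moreover have "card (set rs) = 6" using dist by (simp add: distinct_card rs_def)
  ultimately show ?thesis using V_eq(2)[OF v] by (simp add: card_cartesian_product)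
qed

text \<open>The faithful action on four pairs embeds \<open>G\<close> into a group of order 24,
  which gives finiteness of \<open>G\<close>; by \<open>card_carrier_ge\<close> the embedding is
  onto.\<close>

theorem iso_sym_group_4: "G \<cong> sym_group 4"
proof -
  obtain v where v: "v \<in> V" "v \<noteq> \<one>" "\<sigma> v = v" using exists_sigma_fixed .
  define \<Omega> where "\<Omega> = pair ` V"
  have "finite V" using V_eq(2)[OF v] by (simp add: card_ge_0_finite)
  moreover have "card \<Omega> = 4" unfolding \<Omega>_def using V_eq(2)[OF v] pair_inj by (subst card_image) (auto intro: inj_onI)
  ultimately obtain f where f: "bij_betw f {1..4::nat} \<Omega>"
    using ex_bij_betw_nat_finite_1[of \<Omega>] by (auto simp: \<Omega>_def)
  have fO: "f i \<in> \<Omega>" if "i \<in> {1..4}" for i using f that by (auto simp: bij_betw_def)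
  define f' where "f' = inv_into {1..4::nat} f"
  have f'f: "f' (f i) = i" if "i \<in> {1..4}" for i
    unfolding f'_def using f that by (simp add: bij_betw_inv_into_left)
  have ff': "f (f' A) = A" "f' A \<in> {1..4}" if "A \<in> \<Omega>" for A
    unfolding f'_def using f that bij_betw_inv_into_right[OF f that] bij_betw_inv_into[OF f]
    by (auto simp: bij_betw_def)
  have \<Omega>_sub: "A \<subseteq> carrier G" if "A \<in> \<Omega>" for A using that pair_subset V_G by (auto simp: \<Omega>_def)
  have act_\<Omega>: "act g A \<in> \<Omega>" if g: "g \<in> carrier G" and A: "A \<in> \<Omega>" for g A
  proof -
    obtain u where u: "u \<in> V" "A = pair u" using A by (auto simp: \<Omega>_def)
    then show ?thesis using act_pair_V[OF g u(1)] by (metis \<Omega>_def imageI)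
  qed
  define \<psi> where "\<psi> = (\<lambda>g i. if i \<in> {1..4::nat} then f' (act g (f i)) else i)"
  have \<psi>_in: "\<psi> g i \<in> {1..4}" if "g \<in> carrier G" "i \<in> {1..4}" for g i
    using that ff'(2)[OF act_\<Omega>[OF that(1) fO[OF that(2)]]] by (simp add: \<psi>_def)
  have f\<psi>: "f (\<psi> g i) = act g (f i)" if "g \<in> carrier G" "i \<in> {1..4}" for g i
    using that ff'(1)[OF act_\<Omega>[OF that(1) fO[OF that(2)]]] by (simp add: \<psi>_def)
  have \<psi>_mult: "\<psi> (g \<otimes> h) = \<psi> g \<circ> \<psi> h" if "g \<in> carrier G" "h \<in> carrier G" for g h
  proof
    fix i show "\<psi> (g \<otimes> h) i = (\<psi> g \<circ> \<psi> h) i"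
    proof (cases "i \<in> {1..4}")
      case True
      have "\<psi> g (\<psi> h i) = f' (act g (act h (f i)))"
        using \<psi>_in[OF that(2) True] f\<psi>[OF that(2) True] by (simp add: \<psi>_def)
      then show ?thesis using act_act[OF that \<Omega>_sub[OF fO[OF True]]] True by (simp add: \<psi>_def)
    qed (auto simp: \<psi>_def)
  qed
  have \<psi>_one: "\<psi> \<one> = id" using act_one[OF \<Omega>_sub[OF fO]] f'f by (auto simp: \<psi>_def)
  have \<psi>_perm: "\<psi> g permutes {1..4}" if g: "g \<in> carrier G" for g
  proof (rule bij_imp_permutes)
    have "\<psi> (inv g) \<circ> \<psi> g = id" "\<psi> g \<circ> \<psi> (inv g) = id"
      using \<psi>_mult[of "inv g" g] \<psi>_mult[of g "inv g"] g \<psi>_one by simp_all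
    then have "\<psi> (inv g) (\<psi> g i) = i" "\<psi> g (\<psi> (inv g) i) = i" for i
      by (simp_all add: fun_eq_iff)
    then show "bij_betw (\<psi> g) {1..4} {1..4}"
      using \<psi>_in[OF g] \<psi>_in[of "inv g"] g by (intro bij_betwI[where g = "\<psi> (inv g)"]) auto
  qed (auto simp: \<psi>_def)
  have \<psi>_hom: "\<psi> \<in> hom G (sym_group 4)"
    using \<psi>_perm \<psi>_mult by (auto simp: hom_def sym_group_def)
  have inj: "inj_on \<psi> (carrier G)"
  proof (rule inj_onI)
    fix g h assume g: "g \<in> carrier G" and h: "h \<in> carrier G" and eq: "\<psi> g = \<psi> h"
    have "\<psi> (inv h \<otimes> g) = \<psi> (inv h) \<circ> \<psi> h" using \<psi>_mult[of "inv h" g] g h eq by simp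
    also have "\<dots> = id" using \<psi>_mult[of "inv h" h] h \<psi>_one by simp
    finally have id: "\<psi> (inv h \<otimes> g) = id" .
    have "act (inv h \<otimes> g) (pair u) = pair u" if u: "u \<in> V" for u
    proof -
      have A: "pair u \<in> \<Omega>" using u by (simp add: \<Omega>_def)
      have "act (inv h \<otimes> g) (f (f' (pair u))) = f (f' (pair u))"
        using f\<psi>[of "inv h \<otimes> g" "f' (pair u)"] ff'(2)[OF A] id g h by simp
      then show ?thesis using ff'(1)[OF A] by simp
    qed
    then have "inv h \<otimes> g = \<one>" using g h by (intro act_faithful) auto
    then have "g = inv (inv h)" using g h by (metis inv_closed inv_equality inv_inv)
    then show "g = h" using h by simp
  qed
  have sub: "\<psi> ` carrier G \<subseteq> carrier (sym_group 4)" using \<psi>_perm by (auto simp: sym_group_def)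
  have card4: "card (carrier (sym_group 4)) = 24" by (simp add: sym_group_card_carrier fact_numeral)
  then have fin4: "finite (carrier (sym_group 4))" by (simp add: card_ge_0_finite)
  then have "finite (carrier G)" using inj sub by (metis finite_imageD finite_subset)
  then have "24 \<le> card (\<psi> ` carrier G)" using card_carrier_ge inj by (simp add: card_image)
  then have "\<psi> ` carrier G = carrier (sym_group 4)"
    using card_seteq[OF fin4 sub] card4 by simp
  then have "\<psi> \<in> iso G (sym_group 4)" using \<psi>_hom inj by (auto simp: iso_def bij_betw_def)
  then show ?thesis by (auto simp: is_iso_def)
qed

end

section \<open>Reduction to a minimal extension\<close>

context S3_extension
begin

theorem exists_sym_group_4_quotient:
  assumes "finite V"
  obtains N where "N \<lhd> G" "N \<subseteq> V" "G Mod N \<cong> sym_group 4"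
proof -
  \<comment> \<open>The last condition says that \<open>c\<close> does not act trivially modulo
    \<open>N\<close>; an \<open>N\<close> of greatest order with this property exists because
    \<open>V\<close> is finite.\<close>
  define P where "P = (\<lambda>N. N \<lhd> G \<and> N \<subseteq> V \<and> (\<exists>v\<in>V. v \<otimes> \<gamma> v \<notin> N))"
  have P1: "P {\<one>}"
  proof -
    obtain v where v: "v \<in> V" "\<gamma> v \<noteq> v" using nontriv by blast
    have "v \<otimes> \<gamma> v \<noteq> \<one>"
    proof
      assume *: "v \<otimes> \<gamma> v = \<one>"
      have "\<gamma> v = v \<otimes> (v \<otimes> \<gamma> v)" using V_cancel[OF v(1)] V_G[OF gamma_V[OF v(1)]] by simp
      then show False using * v V_G by simp
    qed
    then show ?thesis using v(1) V_closed(2) one_is_normal by (auto simp: P_def)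
  qed
  have "card N \<le> card V" if "P N" for N using that assms by (auto simp: P_def card_mono)
  then have "\<exists>N. P N \<and> (\<forall>N'. P N' \<longrightarrow> card N' \<le> card N)"
    by (intro ex_has_greatest_nat[of P "{\<one>}" card "Suc (card V)"]) (use P1 in \<open>auto simp: less_Suc_eq_le le_SucI\<close>)
  then obtain N where N: "P N" and max: "\<And>N'. P N' \<Longrightarrow> card N' \<le> card N" by blast
  have NN: "N \<lhd> G" "N \<subseteq> V" using N by (auto simp: P_def)
  obtain v0 where v0: "v0 \<in> V" "v0 \<otimes> \<gamma> v0 \<notin> N" using N by (auto simp: P_def)
  interpret N: normal N G by (rule NN(1))
  define \<pi> where "\<pi> = (\<lambda>a. N #> a)"
  interpret Q: group "G Mod N" by (rule N.factorgroup_is_group)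
  interpret \<pi>: group_hom G "G Mod N" \<pi>
    using N.r_coset_hom_Mod by unfold_locales (simp add: \<pi>_def)
  have ker: "\<pi> x = \<one>\<^bsub>G Mod N\<^esub> \<longleftrightarrow> x \<in> N" if "x \<in> carrier G" for x
    using coset_join1[OF _ that N.subgroup_axioms] coset_join2[OF that N.subgroup_axioms]
    unfolding \<pi>_def FactGroup_def by auto
  have conj: "Q.conjugate (\<pi> g) (\<pi> x) = \<pi> (conjugate g x)" if "g \<in> carrier G" "x \<in> carrier G" for g x
    using that by (simp add: Q.conjugate_def conjugate_def)
  have surj: "\<exists>g\<in>carrier G. y = \<pi> g" if "y \<in> carrier (G Mod N)" for y
    using that by (auto simp: FactGroup_def RCOSETS_def \<pi>_def)
  have E: "S3_extension (G Mod N) (\<pi> ` V) (\<pi> c) (\<pi> s)"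
  proof (rule S3_extension.intro[OF Q.is_group S3_extension_axioms.intro])
    show "subgroup (\<pi> ` V) (G Mod N)" by (rule \<pi>.subgroup_img_is_subgroup[OF V])
    show "\<pi> c \<in> carrier (G Mod N)" "\<pi> s \<in> carrier (G Mod N)" using c s by auto
    show "\<pi> c \<otimes>\<^bsub>G Mod N\<^esub> \<pi> c \<otimes>\<^bsub>G Mod N\<^esub> \<pi> c = \<one>\<^bsub>G Mod N\<^esub>"
      using arg_cong[OF c3, of \<pi>] c by simp
    show "\<pi> s \<otimes>\<^bsub>G Mod N\<^esub> \<pi> s \<in> \<pi> ` V" using imageI[OF s2, of \<pi>] s by simp
    show "\<pi> s \<otimes>\<^bsub>G Mod N\<^esub> \<pi> c \<otimes>\<^bsub>G Mod N\<^esub> inv\<^bsub>G Mod N\<^esub> (\<pi> s) \<otimes>\<^bsub>G Mod N\<^esub> \<pi> c \<in> \<pi> ` V"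
      using imageI[OF scs, of \<pi>] s c by simp
  next
    fix y v assume y: "y \<in> carrier (G Mod N)" and "v \<in> \<pi> ` V"
    then obtain g w where "g \<in> carrier G" "y = \<pi> g" "w \<in> V" "v = \<pi> w" using surj by blast
    then show "Q.conjugate y v \<in> \<pi> ` V" using conj V_conj V_G by simp
  next
    fix v assume "v \<in> \<pi> ` V"
    then obtain w where w: "w \<in> V" "v = \<pi> w" by blast
    then show "v \<otimes>\<^bsub>G Mod N\<^esub> v = \<one>\<^bsub>G Mod N\<^esub>" using arg_cong[OF V_sq[OF w(1)], of \<pi>] V_G by simp
  next
    fix y assume "y \<in> carrier (G Mod N)"
    then obtain g where g: "g \<in> carrier G" "y = \<pi> g" using surj by blast
    obtain v where v: "v \<in> V" and gv: "g \<in> {v, v \<otimes> c, v \<otimes> (c \<otimes> c), v \<otimes> s, v \<otimes> (c \<otimes> s), v \<otimes> (c \<otimes> c \<otimes> s)}"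
      using gen[OF g(1)] by blast
    show "\<exists>v\<in>\<pi> ` V. y \<in> {v, v \<otimes>\<^bsub>G Mod N\<^esub> \<pi> c, v \<otimes>\<^bsub>G Mod N\<^esub> (\<pi> c \<otimes>\<^bsub>G Mod N\<^esub> \<pi> c),
       v \<otimes>\<^bsub>G Mod N\<^esub> \<pi> s, v \<otimes>\<^bsub>G Mod N\<^esub> (\<pi> c \<otimes>\<^bsub>G Mod N\<^esub> \<pi> s),
       v \<otimes>\<^bsub>G Mod N\<^esub> (\<pi> c \<otimes>\<^bsub>G Mod N\<^esub> \<pi> c \<otimes>\<^bsub>G Mod N\<^esub> \<pi> s)}"
      using gv V_G[OF v] c s unfolding g(2) by (intro bexI[OF _ imageI[OF v]]) auto
  next
    show "\<exists>v\<in>\<pi> ` V. Q.conjugate (\<pi> c) v \<noteq> v"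
    proof (rule bexI[OF _ imageI[OF v0(1)]], rule notI)
      assume "Q.conjugate (\<pi> c) (\<pi> v0) = \<pi> v0"
      then have "\<pi> (\<gamma> v0) = \<pi> v0" using conj c V_G v0 by simp
      then have "\<pi> (v0 \<otimes> \<gamma> v0) = \<pi> (v0 \<otimes> v0)" using V_G[OF v0(1)] V_G[OF gamma_V[OF v0(1)]] by simp
      then have "\<pi> (v0 \<otimes> \<gamma> v0) = \<one>\<^bsub>G Mod N\<^esub>" using V_sq[OF v0(1)] by simp
      then show False using ker v0 V_closed(1)[OF v0(1) gamma_V[OF v0(1)]] V_G by blast
    qed
  qed
  interpret E: S3_extension "G Mod N" "\<pi> ` V" "\<pi> c" "\<pi> s" by (rule E)
  have gE: "Q.conjugate (\<pi> c) (\<pi> v) = \<pi> (\<gamma> v)" if "v \<in> V" for v using conj c V_G that by simp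
  interpret E: minimal_S3_extension "G Mod N" "\<pi> ` V" "\<pi> c" "\<pi> s"
  proof
    fix U y assume U: "U \<lhd> G Mod N" "U \<subseteq> \<pi> ` V" "U \<noteq> {\<one>\<^bsub>G Mod N\<^esub>}" and "y \<in> \<pi> ` V"
    then obtain v where v: "v \<in> V" "y = \<pi> v" by blast
    interpret U: normal U "G Mod N" by (rule U(1))
    \<comment> \<open>The part of \<open>V\<close> above \<open>U\<close>. It contains
      \<open>N\<close> properly because \<open>U\<close> is nontrivial, so it cannot satisfy
      \<open>P\<close>.\<close>
    define U' where "U' = {u \<in> V. \<pi> u \<in> U}"
    have "U' \<lhd> G"
      unfolding normal_inv_iff
    proof
      show "subgroup U' G"
      proof (rule subgroupI)
        have "\<pi> \<one> \<in> U" using \<pi>.hom_one U.one_closed by simp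
        then have "\<one> \<in> U'" using V_closed(2) by (simp add: U'_def)
        then show "U' \<noteq> {}" by blast
        show "a \<otimes> b \<in> U'" if "a \<in> U'" "b \<in> U'" for a b
        proof -
          have ab: "a \<in> V" "b \<in> V" "\<pi> a \<in> U" "\<pi> b \<in> U" using that by (auto simp: U'_def)
          then have "\<pi> (a \<otimes> b) \<in> U" using \<pi>.hom_mult[OF V_G[OF ab(1)] V_G[OF ab(2)]] U.m_closed by metis
          then show ?thesis using ab V_closed(1) by (simp add: U'_def)
        qed
      qed (use V_G V_inv in \<open>auto simp: U'_def\<close>)
      show "\<forall>x\<in>carrier G. \<forall>h\<in>U'. x \<otimes> h \<otimes> inv x \<in> U'"
      proof (intro ballI)
        fix x h assume x: "x \<in> carrier G" and h: "h \<in> U'"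
        then have hV: "h \<in> V" and hU: "\<pi> h \<in> U" by (auto simp: U'_def)
        have "\<pi> (conjugate x h) \<in> U"
          using U.inv_op_closed2[OF _ hU, of "\<pi> x"] x V_G[OF hV] by (simp add: conjugate_def)
        then show "x \<otimes> h \<otimes> inv x \<in> U'" using V_conj[OF x hV] by (simp add: U'_def conjugate_def)
      qed
    qed
    moreover have U'V: "U' \<subseteq> V" by (auto simp: U'_def)
    moreover have "\<not> card U' \<le> card N"
    proof -
      have "N \<subseteq> U'"
      proof
        fix x assume x: "x \<in> N"
        then have xV: "x \<in> V" using NN(2) by blast
        then have "\<pi> x = \<one>\<^bsub>G Mod N\<^esub>" using ker[OF V_G[OF xV]] x by blast
        then show "x \<in> U'" using U.one_closed xV by (simp only: U'_def mem_Collect_eq)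
      qed
      moreover have "\<exists>u\<in>U'. u \<notin> N"
      proof -
        obtain z where z: "z \<in> U" "z \<noteq> \<one>\<^bsub>G Mod N\<^esub>" using U(3) U.one_closed by blast
        then obtain u where u: "u \<in> V" "z = \<pi> u" using U(2) by blast
        then have "u \<in> U'" using z(1) by (simp add: U'_def)
        moreover have "u \<notin> N" using ker[OF V_G[OF u(1)]] u(2) z(2) by blast
        ultimately show ?thesis by blast
      qed
      ultimately have "N \<subset> U'" by blast
      then have "card N < card U'" using U'V assms by (meson finite_subset psubset_card_mono)
      then show ?thesis by simp
    qed
    ultimately have "\<forall>v\<in>V. v \<otimes> \<gamma> v \<in> U'" using max[of U'] by (auto simp: P_def)
    then have "\<pi> (v \<otimes> \<gamma> v) \<in> U" using v(1) by (auto simp: U'_def)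
    then show "y \<otimes>\<^bsub>G Mod N\<^esub> Q.conjugate (\<pi> c) y \<in> U"
      using gE[OF v(1)] V_G[OF v(1)] V_G[OF gamma_V[OF v(1)]] unfolding v(2) by simp
  qed
  show ?thesis using that[OF NN] E.iso_sym_group_4 by blast
qed

end

section \<open>The symmetric group on three letters\<close>

lemma sym_group_3_generators:
  obtains r t where "r \<in> carrier (sym_group 3)" "t \<in> carrier (sym_group 3)" "r \<circ> r \<circ> r = id" "t \<circ> t = id"
    "t \<circ> r \<circ> t \<circ> r = id" "carrier (sym_group 3) = {id, r, r \<circ> r, t, r \<circ> t, r \<circ> r \<circ> t}"
proof -
  define r :: "nat \<Rightarrow> nat" where "r = (\<lambda>i. if i = 1 then 2 else if i = 2 then 3 else if i = 3 then 1 else i)"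
  define t :: "nat \<Rightarrow> nat" where "t = (\<lambda>i. if i = 1 then 2 else if i = 2 then 1 else i)"
  have rrr: "r \<circ> r \<circ> r = id" and tt: "t \<circ> t = id" and trtr: "t \<circ> r \<circ> t \<circ> r = id"
    by (auto simp: r_def t_def)
  have i3: "i \<in> {1..3} \<longleftrightarrow> i = 1 \<or> i = 2 \<or> i = 3" for i :: nat by auto
  have r: "r permutes {1..3}"
  proof (rule bij_imp_permutes)
    show "bij_betw r {1..3} {1..3}"
      by (rule bij_betwI[where g = "\<lambda>i. r (r i)"]) (auto simp: i3 r_def)
  qed (auto simp: i3 r_def)
  have t: "t permutes {1..3}"
  proof (rule bij_imp_permutes)
    show "bij_betw t {1..3} {1..3}"
      by (rule bij_betwI[where g = t]) (auto simp: i3 t_def)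
  qed (auto simp: i3 t_def)
  let ?S = "{id, r, r \<circ> r, t, r \<circ> t, r \<circ> r \<circ> t}"
  have sub: "?S \<subseteq> carrier (sym_group 3)"
    using r t by (auto simp: sym_group_def permutes_id permutes_compose)
  \<comment> \<open>A permutation of three letters is determined by the images of 1 and 2; they tell
    the six listed elements apart.\<close>
  define q where "q = (\<lambda>g::nat \<Rightarrow> nat. (g 1, g 2))"
  have "map q [id, r, r \<circ> r, t, r \<circ> t, r \<circ> r \<circ> t] = [(1, 2), (2, 3), (3, 1), (2, 1), (3, 2), (1, 3)]"
    by (simp add: q_def r_def t_def)
  then have "distinct (map q [id, r, r \<circ> r, t, r \<circ> t, r \<circ> r \<circ> t])" by simp
  then have "distinct [id, r, r \<circ> r, t, r \<circ> t, r \<circ> r \<circ> t]" by (simp only: distinct_map)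
  then have "card ?S = 6" using distinct_card[of "[id, r, r \<circ> r, t, r \<circ> t, r \<circ> r \<circ> t]"] by simp
  moreover have c6: "card (carrier (sym_group 3)) = 6" by (simp add: sym_group_card_carrier fact_numeral)
  moreover have "finite (carrier (sym_group 3))" using c6 by (simp add: card_ge_0_finite)
  ultimately have "carrier (sym_group 3) = ?S" using card_subset_eq[OF _ sub] by simp
  then show ?thesis using that[of r t] rrr tt trtr sub by simp
qed

text \<open>\<open>H\<close> stands for the preimage of the rotations, described as a proper
  subgroup that contains all squares. It contains \<open>V\<close> and \<open>c\<close>. If
  \<open>c\<close> centralized \<open>V\<close>, the element \<open>h\<close> would lie in a coset
  involving \<open>s\<close>; then \<open>s\<close> would be in \<open>H\<close>, and
  \<open>H\<close> would be everything.\<close>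

lemma (in group) S3_extension_lifts:
  assumes hom: "group_hom G (sym_group 3) \<pi>" and surj: "\<pi> ` carrier G = carrier (sym_group 3)"
    and ker: "kernel G (sym_group 3) \<pi> = V" and sq: "\<And>v. v \<in> V \<Longrightarrow> v \<otimes> v = \<one>"
    and H: "subgroup H G" "V \<subseteq> H" "H \<noteq> carrier G" "\<And>g. g \<in> carrier G \<Longrightarrow> g \<otimes> g \<in> H"
    and act: "h \<in> H" "v\<^sub>0 \<in> V" "conjugate h v\<^sub>0 \<noteq> v\<^sub>0"
  obtains c s where "S3_extension G V c s"
proof -
  interpret p: group_hom G "sym_group 3" \<pi> by (rule hom)
  note [simp del] = p.hom_mult
  have mul: "\<pi> (x \<otimes> y) = \<pi> x \<circ> \<pi> y" if "x \<in> carrier G" "y \<in> carrier G" for x y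
    using p.hom_mult[OF that] by (simp add: sym_group_mult)
  have V_iff: "x \<in> V \<longleftrightarrow> x \<in> carrier G \<and> \<pi> x = id" for x
    by (simp add: ker[symmetric] kernel_def sym_group_one)
  have VG: "v \<in> carrier G" if "v \<in> V" for v using that V_iff by blast
  have sV: "subgroup V G" using p.subgroup_kernel ker by simp
  have nV: "V \<lhd> G" using p.normal_kernel ker by simp
  obtain r t where r: "r \<in> carrier (sym_group 3)" and t: "t \<in> carrier (sym_group 3)"
    and rt: "r \<circ> r \<circ> r = id" "t \<circ> t = id" "t \<circ> r \<circ> t \<circ> r = id"
    and all: "carrier (sym_group 3) = {id, r, r \<circ> r, t, r \<circ> t, r \<circ> r \<circ> t}"
    by (rule sym_group_3_generators)
  obtain d where d: "d \<in> carrier G" "\<pi> d = r" using r surj by (metis imageE)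
  obtain s where s: "s \<in> carrier G" "\<pi> s = t" using t surj by (metis imageE)
  \<comment> \<open>The fourth power of \<open>d\<close> is still a lift of \<open>r\<close>; since
    the cube of \<open>d\<close> lies in \<open>V\<close>, the sixth power is trivial and
    \<open>c\<close> has trivial cube. Being a square, \<open>c\<close> lies in
    \<open>H\<close>.\<close>
  define c where "c = (d \<otimes> d) \<otimes> (d \<otimes> d)"
  have c: "c \<in> carrier G" using d by (simp add: c_def)
  have pc: "\<pi> c = r"
  proof -
    have "\<pi> c = (r \<circ> r \<circ> r) \<circ> r" using d by (simp add: c_def mul comp_assoc)
    then show ?thesis using rt(1) by simp
  qed
  have cH: "c \<in> H" unfolding c_def using H(4)[of "d \<otimes> d"] d by simp
  have "d \<otimes> d \<otimes> d \<in> V" using d rt(1) by (simp add: V_iff mul)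
  then have "(d \<otimes> d \<otimes> d) \<otimes> (d \<otimes> d \<otimes> d) = \<one>" by (rule sq)
  then have d6: "d \<otimes> (d \<otimes> (d \<otimes> (d \<otimes> (d \<otimes> d)))) = \<one>" using d by (simp add: m_assoc)
  have d6': "d \<otimes> (d \<otimes> (d \<otimes> (d \<otimes> (d \<otimes> (d \<otimes> x))))) = x" if "x \<in> carrier G" for x
  proof -
    have "d \<otimes> (d \<otimes> (d \<otimes> (d \<otimes> (d \<otimes> (d \<otimes> x))))) = (d \<otimes> (d \<otimes> (d \<otimes> (d \<otimes> (d \<otimes> d))))) \<otimes> x"
      using d that by (simp add: m_assoc)
    then show ?thesis using d6 that by simp
  qed
  have c3: "c \<otimes> c \<otimes> c = \<one>" unfolding c_def using d d6 d6' by (simp add: m_assoc)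
  have gen: "\<exists>v\<in>V. g \<in> {v, v \<otimes> c, v \<otimes> (c \<otimes> c), v \<otimes> s, v \<otimes> (c \<otimes> s), v \<otimes> (c \<otimes> c \<otimes> s)}"
    if g: "g \<in> carrier G" for g
  proof -
    have *: "\<exists>v\<in>V. g = v \<otimes> w" if w: "w \<in> carrier G" "\<pi> g = \<pi> w" for w
    proof (intro bexI)
      show "g = (g \<otimes> inv w) \<otimes> w" using g w(1) by (simp add: m_assoc)
      have "\<pi> (g \<otimes> inv w) = \<pi> (w \<otimes> inv w)"
        using mul[of g "inv w"] mul[of w "inv w"] g w by (simp del: r_inv p.hom_inv)
      then show "g \<otimes> inv w \<in> V" using g w(1) by (simp add: V_iff sym_group_one)
    qed
    have "\<pi> g \<in> carrier (sym_group 3)" using g by (rule p.hom_closed)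
    then consider "\<pi> g = \<pi> \<one>" | "\<pi> g = \<pi> c" | "\<pi> g = \<pi> (c \<otimes> c)" | "\<pi> g = \<pi> s" | "\<pi> g = \<pi> (c \<otimes> s)"
      | "\<pi> g = \<pi> (c \<otimes> c \<otimes> s)"
      using c s pc unfolding all by (auto simp: mul sym_group_one)
    then show ?thesis
    proof cases
      case 1 then show ?thesis using *[of \<one>] VG by auto
    next
      case 2 then show ?thesis using *[of c] c by blast
    next
      case 3 then show ?thesis using *[of "c \<otimes> c"] c by blast
    next
      case 4 then show ?thesis using *[of s] s(1) by blast
    next
      case 5 then show ?thesis using *[of "c \<otimes> s"] c s(1) by blast
    next
      case 6 then show ?thesis using *[of "c \<otimes> c \<otimes> s"] c s(1) by blast
    qed
  qed
  have nontriv: "\<exists>v\<in>V. conjugate c v \<noteq> v"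
  proof (rule ccontr)
    assume "\<not> ?thesis"
    then have fc: "conjugate c v = v" if "v \<in> V" for v using that by blast
    have v0: "v\<^sub>0 \<in> carrier G" using VG act(2) .
    have hG: "h \<in> carrier G" using act(1) subgroup.subset[OF H(1)] by blast
    have comm: "conjugate w v\<^sub>0 = v\<^sub>0" if w: "w \<in> V" for w
    proof -
      have wG: "w \<in> carrier G" using VG[OF w] .
      have "w \<otimes> v\<^sub>0 \<in> V" using subgroup.m_closed[OF sV w act(2)] .
      then have *: "w \<otimes> v\<^sub>0 \<otimes> (w \<otimes> v\<^sub>0) = \<one>" by (rule sq)
      have "inv (w \<otimes> v\<^sub>0) = w \<otimes> v\<^sub>0" using wG v0 * by (intro inv_equality) auto
      moreover have "inv w = w" "inv v\<^sub>0 = v\<^sub>0" using wG v0 sq[OF w] sq[OF act(2)] by (auto intro: inv_equality)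
      ultimately have "w \<otimes> v\<^sub>0 = v\<^sub>0 \<otimes> w" using inv_mult_group[OF wG v0] by simp
      then show ?thesis using conjugate_eq_iff_commute[OF wG v0] by blast
    qed
    obtain v where v: "v \<in> V" and h: "h \<in> {v, v \<otimes> c, v \<otimes> (c \<otimes> c), v \<otimes> s, v \<otimes> (c \<otimes> s), v \<otimes> (c \<otimes> c \<otimes> s)}"
      using gen[OF hG] by blast
    have fix_w: "conjugate (v \<otimes> w) v\<^sub>0 = v\<^sub>0" if "w \<in> carrier G" "conjugate w v\<^sub>0 = v\<^sub>0" for w
      using conjugate_conjugate[OF VG[OF v] that(1) v0] that(2) comm[OF v] by simp
    have "conjugate (c \<otimes> c) v\<^sub>0 = v\<^sub>0" using conjugate_conjugate[OF c c v0] fc[OF act(2)] by simp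
    then have "h \<noteq> v" "h \<noteq> v \<otimes> c" "h \<noteq> v \<otimes> (c \<otimes> c)"
      using comm[OF v] fix_w[OF c fc[OF act(2)]] fix_w[of "c \<otimes> c"] c act(3) by auto
    with h obtain w where w: "w \<in> {\<one>, c, c \<otimes> c}" and hw: "h = v \<otimes> (w \<otimes> s)" using s(1) by force
    have wH: "w \<in> H" using w cH subgroup.m_closed[OF H(1) cH cH] subgroup.one_closed[OF H(1)] by auto
    have vH: "v \<in> H" using v H(2) by blast
    have sub: "\<And>x. x \<in> H \<Longrightarrow> x \<in> carrier G" using subgroup.subset[OF H(1)] by blast
    have "s = inv w \<otimes> (inv v \<otimes> h)"
      using hw sub[OF wH] sub[OF vH] s(1) inv_solve_left by (simp add: m_assoc[symmetric])
    then have sH: "s \<in> H"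
      using subgroup.m_closed[OF H(1)] subgroup.m_inv_closed[OF H(1)] wH vH act(1) by simp
    have "g \<in> H" if g: "g \<in> carrier G" for g
    proof -
      obtain u where "u \<in> V" and u: "g \<in> {u, u \<otimes> c, u \<otimes> (c \<otimes> c), u \<otimes> s, u \<otimes> (c \<otimes> s), u \<otimes> (c \<otimes> c \<otimes> s)}"
        using gen[OF g] by blast
      then have "u \<in> H" using H(2) by blast
      with u cH sH show ?thesis using subgroup.m_closed[OF H(1)] by auto
    qed
    then show False using H(3) subgroup.subset[OF H(1)] by blast
  qed
  have "S3_extension G V c s"
  proof (intro S3_extension.intro S3_extension_axioms.intro)
    fix g v assume "g \<in> carrier G" "v \<in> V"
    then show "conjugate g v \<in> V" unfolding conjugate_def by (rule normal.inv_op_closed2[OF nV])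
  next
    show "s \<otimes> s \<in> V" using s rt(2) by (simp add: V_iff mul)
    have "\<pi> (s \<otimes> c \<otimes> inv s \<otimes> c) = t \<circ> r \<circ> \<pi> (inv s) \<circ> r" using s c pc by (simp add: mul del: p.hom_inv)
    moreover have "\<pi> (inv s) = t"
    proof -
      have "\<pi> (inv s) \<circ> t = id" using mul[of "inv s" s] s p.hom_one by (simp add: sym_group_one del: p.hom_inv)
      then show ?thesis using rt(2) by (metis comp_assoc comp_id id_comp)
    qed
    ultimately show "s \<otimes> c \<otimes> inv s \<otimes> c \<in> V" using rt(3) s(1) c by (simp add: V_iff del: p.hom_inv)
  qed (fact is_group sV sq c s(1) c3 gen nontriv)+
  then show ?thesis by (rule that)
qed

section \<open>Finiteness and fixed fields\<close>

lemma number_field_subfield: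
  assumes F: "number_field F" and K: "subfield K CC" "K \<subseteq> F"
  shows "number_field K"
proof -
  interpret R: ring CC by (rule ring_CC)
  have "subalgebra \<rat> K CC"
  proof (intro subalgebra.intro subalgebra_axioms.intro)
    show "subgroup K (add_monoid CC)" using subfield_CC_subring[OF K(1)] by (rule subring.axioms)
    fix q x :: complex assume "q \<in> \<rat>" "x \<in> K"
    then show "q \<otimes>\<^bsub>CC\<^esub> x \<in> K"
      using Rats_subset_subfield[OF K(1)] subring_CC_closed(5)[OF subfield_CC_subring[OF K(1)]] by auto
  qed
  then have "R.finite_dimension \<rat> K"
    using R.subalbegra_incl_imp_finite_dimension[OF subfield_Rats _ _ K(2)] F by (simp add: number_field_def)
  with K(1) show ?thesis by (simp add: number_field_def)
qed

lemma number_field_algebraic: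
  assumes "number_field F" "x \<in> F" "\<rat> \<subseteq> E" "subfield E CC"
  shows "alg_over E x"
proof -
  interpret R: ring CC by (rule ring_CC)
  have F: "subfield F CC" "R.finite_dimension \<rat> F" using assms(1) by (auto simp: number_field_def)
  have "(R.algebraic over \<rat>) x"
    using R.finite_dimension_imp_algebraic[OF subfield_Rats subfield_CC_subring[OF F(1)] F(2) assms(2)] .
  then have "alg_over \<rat> x" using algebraic_CC_iff[OF subfield_Rats] by (simp add: over_def)
  then show ?thesis using alg_over_mono assms(3) by blast
qed

context tower
begin

text \<open>The elements fixed by a nontrivial \<open>\<sigma>\<close> form a proper rational
  subspace, and finitely many of these do not cover \<open>M\<close>.\<close>

lemma V_moves_element:
  assumes fin: "finite V"
  obtains a where "a \<in> M" "\<And>\<sigma>. \<sigma> \<in> V \<Longrightarrow> \<sigma> a = a \<Longrightarrow> \<sigma> = \<one>\<^bsub>G\<^esub>"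
proof -
  note SM = subfield_CC_subring[OF sM]
  have "\<not> M \<subseteq> (\<Union>\<sigma>\<in>V - {\<one>\<^bsub>G\<^esub>}. {x. \<sigma> x = x})"
  proof
    assume cover: "M \<subseteq> (\<Union>\<sigma>\<in>V - {\<one>\<^bsub>G\<^esub>}. {x. \<sigma> x = x})"
    have "\<exists>\<sigma>\<in>V - {\<one>\<^bsub>G\<^esub>}. M \<subseteq> {x. \<sigma> x = x}"
    proof (rule subspace_union[OF _ SM cover])
      show "finite (V - {\<one>\<^bsub>G\<^esub>})" using fin by simp
      fix \<sigma> x y assume "\<sigma> \<in> V - {\<one>\<^bsub>G\<^esub>}" "x \<in> M" "y \<in> M" "x \<in> {x. \<sigma> x = x}" "y \<in> {x. \<sigma> x = x}"
      then show "x - y \<in> {x. \<sigma> x = x}" using field_emb_simps(4)[OF Gal_apply(2)[OF sM, of \<sigma> L] SM] by simp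
    next
      fix \<sigma> x and n :: nat assume "\<sigma> \<in> V - {\<one>\<^bsub>G\<^esub>}" "x \<in> M" "n > 0"
      then show "of_nat n * x \<in> {x. \<sigma> x = x} \<longleftrightarrow> x \<in> {x. \<sigma> x = x}"
        using field_emb_of_nat_mult[OF Gal_apply(2)[OF sM, of \<sigma> L] SM] by simp
    qed
    then obtain \<sigma> where s: "\<sigma> \<in> V" "\<sigma> \<noteq> \<one>\<^bsub>G\<^esub>" "\<And>x. x \<in> M \<Longrightarrow> \<sigma> x = x" by blast
    have "\<sigma> = \<one>\<^bsub>G\<^esub>" by (rule Gal_eqI[OF sM s(1) G.one_closed]) (simp add: s(3) Gal_one)
    with s(2) show False by blast
  qed
  then obtain a where "a \<in> M" "\<And>\<sigma>. \<sigma> \<in> V - {\<one>\<^bsub>G\<^esub>} \<Longrightarrow> \<sigma> a \<noteq> a" by blast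
  then show ?thesis using that[of a] by blast
qed

text \<open>With \<open>a\<close> as above, the interpolation polynomial of \<open>\<sigma> a \<mapsto> \<sigma> x\<close> is invariant under \<open>V\<close>,
  which makes \<open>a\<close> a primitive element of \<open>M\<close> over \<open>L\<close>.\<close>

lemma number_field_M:
  assumes fin: "finite V" and L: "number_field L"
  shows "number_field M"
proof -
  note SM = subfield_CC_subring[OF sM]
  interpret D: domain CC by (rule domain_CC)
  obtain a where a: "a \<in> M" "\<And>\<sigma>. \<sigma> \<in> V \<Longrightarrow> \<sigma> a = a \<Longrightarrow> \<sigma> = \<one>\<^bsub>G\<^esub>"
    using V_moves_element[OF fin] by metis
  note ap = Gal_apply[OF sM]
  \<comment> \<open>The Lagrange formula without its denominators.\<close>
  define P where "P = (\<lambda>x. \<Sum>\<sigma>\<in>V. [:\<sigma> x:] * (\<Prod>\<tau>\<in>V - {\<sigma>}. [:- \<tau> a, 1:]))"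
  have lin: "[:- \<tau> a, 1:] \<in> polys_over M" if "\<tau> \<in> V" for \<tau>
    using ap(1)[OF that a(1)] by (auto intro!: polys_over_closed[OF SM] subring_CC_closed[OF SM])
  have cst: "[:\<tau> x:] \<in> polys_over M" if "\<tau> \<in> V" "x \<in> M" for \<tau> x
    using ap(1)[OF that] by (auto intro!: polys_over_closed[OF SM])
  have trm: "[:\<sigma> x:] * (\<Prod>\<tau>\<in>V - {\<sigma>}. [:- \<tau> a, 1:]) \<in> polys_over M" if "\<sigma> \<in> V" "x \<in> M" for \<sigma> x
    using lin cst that by (intro polys_over_closed(5)[OF SM] polys_over_prod[OF SM]) auto
  have PM: "P x \<in> polys_over M" if "x \<in> M" for x
    unfolding P_def using trm that by (intro polys_over_sum[OF SM])
  have inv: "map_poly \<rho> (P x) = P x" if r: "\<rho> \<in> V" and x: "x \<in> M" for \<rho> x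
  proof -
    note e = ap(2)[OF r]
    have rG: "\<rho> \<in> carrier G" using V_G[OF r] .
    have bij: "bij_betw (\<lambda>\<sigma>. \<rho> \<otimes>\<^bsub>G\<^esub> \<sigma>) V V"
    proof (rule bij_betwI[where g = "\<lambda>\<sigma>. inv\<^bsub>G\<^esub> \<rho> \<otimes>\<^bsub>G\<^esub> \<sigma>"])
      show "(\<lambda>\<sigma>. \<rho> \<otimes>\<^bsub>G\<^esub> \<sigma>) \<in> V \<rightarrow> V" "(\<lambda>\<sigma>. inv\<^bsub>G\<^esub> \<rho> \<otimes>\<^bsub>G\<^esub> \<sigma>) \<in> V \<rightarrow> V"
        using r subgroup_V by (auto intro: subgroup.m_closed subgroup.m_inv_closed)
    qed (use rG V_G in \<open>auto simp: G.m_assoc[symmetric]\<close>)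
    have bij': "bij_betw (\<lambda>\<sigma>. \<rho> \<otimes>\<^bsub>G\<^esub> \<sigma>) (V - {\<sigma>}) (V - {\<rho> \<otimes>\<^bsub>G\<^esub> \<sigma>})" if "\<sigma> \<in> V" for \<sigma>
      using bij_betw_DiffI[OF bij, of "{\<sigma>}" "{\<rho> \<otimes>\<^bsub>G\<^esub> \<sigma>}"] that bij by (auto simp: bij_betw_def)
    have l1: "map_poly \<rho> [:- \<tau> a, 1:] = [:- (\<rho> \<otimes>\<^bsub>G\<^esub> \<tau>) a, 1:]" if "\<tau> \<in> V" for \<tau>
      using mult_apply[OF rG V_G[OF that] a(1)] field_emb_simps[OF e SM] ap(1)[OF that a(1)]
      by (simp add: map_poly_emb[OF e SM])
    have "map_poly \<rho> (P x) = (\<Sum>\<sigma>\<in>V. map_poly \<rho> ([:\<sigma> x:] * (\<Prod>\<tau>\<in>V - {\<sigma>}. [:- \<tau> a, 1:])))"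
      unfolding P_def by (rule map_poly_emb_sum[OF e SM trm[OF _ x]])
    also have "\<dots> = (\<Sum>\<sigma>\<in>V. [:(\<rho> \<otimes>\<^bsub>G\<^esub> \<sigma>) x:] * (\<Prod>\<tau>\<in>V - {\<rho> \<otimes>\<^bsub>G\<^esub> \<sigma>}. [:- \<tau> a, 1:]))"
    proof (rule sum.cong[OF refl])
      fix \<sigma> assume s: "\<sigma> \<in> V"
      have "map_poly \<rho> ([:\<sigma> x:] * (\<Prod>\<tau>\<in>V - {\<sigma>}. [:- \<tau> a, 1:])) =
          map_poly \<rho> [:\<sigma> x:] * map_poly \<rho> (\<Prod>\<tau>\<in>V - {\<sigma>}. [:- \<tau> a, 1:])"
        using lin cst[OF s x] by (intro map_poly_emb(3)[OF e SM] polys_over_prod[OF SM]) auto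
      also have "map_poly \<rho> [:\<sigma> x:] = [:(\<rho> \<otimes>\<^bsub>G\<^esub> \<sigma>) x:]"
        using mult_apply[OF rG V_G[OF s] x] by (simp add: map_poly_emb[OF e SM])
      also have "map_poly \<rho> (\<Prod>\<tau>\<in>V - {\<sigma>}. [:- \<tau> a, 1:]) = (\<Prod>\<tau>\<in>V - {\<sigma>}. map_poly \<rho> [:- \<tau> a, 1:])"
        using lin by (intro map_poly_emb_prod[OF e SM]) auto
      also have "\<dots> = (\<Prod>\<tau>\<in>V - {\<sigma>}. [:- (\<rho> \<otimes>\<^bsub>G\<^esub> \<tau>) a, 1:])"
        using l1 by (intro prod.cong) auto
      also have "\<dots> = (\<Prod>\<tau>\<in>V - {\<rho> \<otimes>\<^bsub>G\<^esub> \<sigma>}. [:- \<tau> a, 1:])"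
        by (rule prod.reindex_bij_betw[OF bij'[OF s]])
      finally show "map_poly \<rho> ([:\<sigma> x:] * (\<Prod>\<tau>\<in>V - {\<sigma>}. [:- \<tau> a, 1:])) =
          [:(\<rho> \<otimes>\<^bsub>G\<^esub> \<sigma>) x:] * (\<Prod>\<tau>\<in>V - {\<rho> \<otimes>\<^bsub>G\<^esub> \<sigma>}. [:- \<tau> a, 1:])" .
    qed
    also have "\<dots> = P x" unfolding P_def by (rule sum.reindex_bij_betw[OF bij])
    finally show ?thesis .
  qed
  have PL: "P x \<in> polys_over L" if x: "x \<in> M" for x
    unfolding polys_over_def
  proof (intro CollectI allI)
    fix i
    have "\<rho> (coeff (P x) i) = coeff (P x) i" if "\<rho> \<in> V" for \<rho>
      using arg_cong[OF inv[OF that x], of "\<lambda>p. coeff p i"] field_emb_simps(1)[OF ap(2)[OF that] SM]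
      by (simp add: coeff_map_poly)
    then show "coeff (P x) i \<in> L" using fixedM polys_overD[OF PM[OF x]] by blast
  qed
  \<comment> \<open>At \<open>a\<close> only the term of the identity survives, so
    \<open>P x\<close> takes the value \<open>x * d\<close>. The value of \<open>P 1\<close> is
    \<open>d\<close>, and the quotient shows that \<open>x\<close> lies in
    \<open>L(a)\<close>.\<close>
  define d where "d = (\<Prod>\<tau>\<in>V - {\<one>\<^bsub>G\<^esub>}. a - \<tau> a)"
  have oneV: "\<one>\<^bsub>G\<^esub> \<in> V" using subgroup.one_closed[OF subgroup_V] .
  have "d \<noteq> 0"
  proof
    assume "d = 0"
    then obtain \<tau> where "\<tau> \<in> V - {\<one>\<^bsub>G\<^esub>}" "a - \<tau> a = 0" using fin by (auto simp: d_def)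
    then show False using a(2)[of \<tau>] by simp
  qed
  have Pa: "poly (P x) a = x * d" if x: "x \<in> M" for x
  proof -
    have 0: "(\<Prod>\<tau>\<in>V - {\<sigma>}. a - \<tau> a) = 0" if "\<sigma> \<in> V - {\<one>\<^bsub>G\<^esub>}" for \<sigma>
      using fin that oneV a(1) by (intro prod_zero) (auto intro!: bexI[of _ "\<one>\<^bsub>G\<^esub>"] simp: Gal_one)
    have "poly (P x) a = (\<Sum>\<sigma>\<in>V. \<sigma> x * (\<Prod>\<tau>\<in>V - {\<sigma>}. a - \<tau> a))"
      by (simp add: P_def poly_sum poly_prod)
    also have "\<dots> = \<one>\<^bsub>G\<^esub> x * d + (\<Sum>\<sigma>\<in>V - {\<one>\<^bsub>G\<^esub>}. \<sigma> x * (\<Prod>\<tau>\<in>V - {\<sigma>}. a - \<tau> a))"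
      unfolding d_def by (rule sum.remove[OF fin oneV])
    also have "\<dots> = x * d" using 0 x by (simp add: Gal_one)
    finally show ?thesis .
  qed
  define E where "E = D.simple_extension L a"
  have alg: "(D.algebraic over L) a" using algM[OF a(1)] algebraic_CC_iff[OF sL] by (simp add: over_def)
  have E: "subfield E CC" unfolding E_def using D.simple_extension_is_subfield[OF sL, of a] alg by simp
  have "L \<subseteq> E" "a \<in> E"
    unfolding E_def using D.simple_extension_incl[of L a] D.simple_extension_mem[OF subfield_CC_subring[OF sL], of a]
      subring_CC_closed(1)[OF subfield_CC_subring[OF sL]] by auto
  then have PE: "poly p a \<in> E" if "p \<in> polys_over L" for p
    using poly_in_subring[OF subfield_CC_subring[OF E], of p a] polys_over_mono[of L E] that by blast
  have "x \<in> E" if x: "x \<in> M" for x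
  proof -
    have "1 \<in> M" using subring_CC_closed(2)[OF SM] .
    then have "x = poly (P x) a / poly (P 1) a" using Pa x \<open>d \<noteq> 0\<close> by simp
    then show ?thesis using subfield_CC_closed(2)[OF E PE[OF PL[OF x]] PE[OF PL[OF \<open>1 \<in> M\<close>]]] by simp
  qed
  moreover have "D.finite_dimension L E" unfolding E_def using D.finite_dimension_simple_extension[OF sL, of a] alg by simp
  then have "D.finite_dimension \<rat> E"
    using D.telescopic_base_dim(1)[OF subfield_Rats sL] L by (simp add: number_field_def)
  then have "number_field E" using E by (simp add: number_field_def)
  ultimately show ?thesis using number_field_subfield[OF _ sM] by blast
qed

text \<open>The fibres of restriction to \<open>L\<close> are empty or cosets of \<open>V\<close>,
  and the group of \<open>L\<close> is finite.\<close>

lemma finite_G: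
  assumes fin: "finite V"
  shows "finite (carrier G)"
proof -
  have "finite {g \<in> carrier G. restrict g L = y}" for y
  proof (cases "\<exists>h\<in>carrier G. restrict h L = y")
    case True
    then obtain h where h: "h \<in> carrier G" "restrict h L = y" by blast
    have "{g \<in> carrier G. restrict g L = y} \<subseteq> (\<lambda>v. h \<otimes>\<^bsub>G\<^esub> v) ` V"
    proof clarify
      fix g assume g: "g \<in> carrier G" "y = restrict g L"
      define v where "v = inv\<^bsub>G\<^esub> h \<otimes>\<^bsub>G\<^esub> g"
      have vG: "v \<in> carrier G" and gv: "g = h \<otimes>\<^bsub>G\<^esub> v" using g h by (auto simp: v_def G.m_assoc[symmetric])
      have "v x = x" if x: "x \<in> L" for x
      proof -
        have xM: "x \<in> M" using x LM by blast
        have "h (v x) = h x" using mult_apply[OF h(1) vG xM] gv h(2) g(2) x by (metis restrict_apply')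
        then show ?thesis
          using inj_onD[OF field_emb_inj_on[OF Gal_apply(2)[OF sM h(1)] sM]] Gal_apply(1)[OF sM vG xM] xM by blast
      qed
      then show "g \<in> (\<lambda>v. h \<otimes>\<^bsub>G\<^esub> v) ` V" using vG gv by (auto simp: V_iff)
    qed
    then show ?thesis using fin by (meson finite_imageI finite_subset)
  next
    case False
    then show ?thesis by (metis (mono_tags, lifting) empty_Collect_eq finite.emptyI)
  qed
  moreover have "carrier G \<subseteq> (\<Union>y\<in>carrier (Gal L \<rat>). {g \<in> carrier G. restrict g L = y})"
    using restrict_Gal[OF _ QL] by blast
  ultimately show ?thesis using finL by (meson finite_UN_I finite_subset)
qed

text \<open>Both halves come from \<open>emb_fixing_fixed_field_in_group\<close>: for
  \<open>N\<close> acting on \<open>M\<close> it identifies the kernel of restriction to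
  \<open>K\<close>, and for the image of restriction acting on \<open>K\<close> it gives
  surjectivity.\<close>

theorem fixed_field_of_normal:
  assumes fin: "finite V" and L: "number_field L" and N: "N \<lhd> G"
  defines "K \<equiv> {x \<in> M. \<forall>\<sigma>\<in>N. \<sigma> x = x}"
  shows "number_field K" "K \<subseteq> M" "galois_ext \<rat> K" "G Mod N \<cong> Gal K \<rat>"
proof -
  note SM = subfield_CC_subring[OF sM]
  have fG: "finite (carrier G)" by (rule finite_G[OF fin])
  have sN: "subgroup N G" using N by (rule normal_imp_subgroup)
  have NG: "\<sigma> \<in> carrier G" if "\<sigma> \<in> N" for \<sigma> using subgroup.subset[OF sN] that by blast
  have fN: "finite N" using finite_subset[OF subgroup.subset[OF sN] fG] .
  note ap = Gal_apply[OF sM]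
  show KM: "K \<subseteq> M" by (auto simp: K_def)
  have sK: "subfield K CC"
    unfolding subfield_CC_iff subring_CC_iff
  proof (intro conjI ballI)
    show "1 \<in> K" using subring_CC_closed(2)[OF SM] field_embD(1)[OF ap(2)[OF NG]] by (auto simp: K_def)
    fix x assume x: "x \<in> K"
    have fx: "\<sigma> z = z" if "\<sigma> \<in> N" "z \<in> K" for \<sigma> z using that by (simp add: K_def)
    have xM: "x \<in> M" using x KM by blast
    have "\<sigma> (inverse x) = inverse x" if s: "\<sigma> \<in> N" for \<sigma>
      using field_emb_inverse[OF ap(2)[OF NG[OF s]] sM xM] fx[OF s x] by simp
    then show "inverse x \<in> K" using subfield_CC_closed(1)[OF sM xM] by (simp add: K_def)
    fix y assume y: "y \<in> K"
    have yM: "y \<in> M" using y KM by blast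
    have "\<sigma> (x - y) = x - y" if s: "\<sigma> \<in> N" for \<sigma>
      using field_emb_simps(4)[OF ap(2)[OF NG[OF s]] SM xM yM] fx[OF s x] fx[OF s y] by simp
    then show "x - y \<in> K" using subring_CC_closed(4)[OF SM xM yM] by (simp add: K_def)
    have "\<sigma> (x * y) = x * y" if s: "\<sigma> \<in> N" for \<sigma>
      using field_embD(3)[OF ap(2)[OF NG[OF s]] xM yM] fx[OF s x] fx[OF s y] by simp
    then show "x * y \<in> K" using subring_CC_closed(5)[OF SM xM yM] by (simp add: K_def)
  qed
  show "number_field K" using number_field_subfield[OF number_field_M[OF fin L] sK KM] .
  then have algK: "alg_over \<rat> x" if "x \<in> K" for x using number_field_algebraic that subfield_Rats by blast
  have QK: "\<rat> \<subseteq> K" using Rats_subset_subfield[OF sK] .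
  have gK: "g x \<in> K" if g: "g \<in> carrier G" and x: "x \<in> K" for g x
  proof -
    have xM: "x \<in> M" using x by (simp add: K_def)
    have "\<sigma> (g x) = g x" if s: "\<sigma> \<in> N" for \<sigma>
    proof -
      define \<tau> where "\<tau> = inv\<^bsub>G\<^esub> g \<otimes>\<^bsub>G\<^esub> \<sigma> \<otimes>\<^bsub>G\<^esub> g"
      have t: "\<tau> \<in> N" unfolding \<tau>_def using normal.inv_op_closed1[OF N g s] .
      have "\<sigma> \<otimes>\<^bsub>G\<^esub> g = g \<otimes>\<^bsub>G\<^esub> \<tau>" using g NG[OF s] by (simp add: \<tau>_def G.m_assoc[symmetric])
      then have "\<sigma> (g x) = g (\<tau> x)" using mult_apply[OF NG[OF s] g xM] mult_apply[OF g NG[OF t] xM] by simp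
      moreover have "\<tau> x = x" using t x by (simp add: K_def)
      ultimately show ?thesis by simp
    qed
    then show ?thesis using ap(1)[OF g xM] by (simp add: K_def)
  qed
  have gKK: "g ` K = K" if g: "g \<in> carrier G" for g
  proof -
    have "x \<in> g ` K" if x: "x \<in> K" for x
    proof -
      have "(inv\<^bsub>G\<^esub> g) x \<in> K" using gK[of "inv\<^bsub>G\<^esub> g" x] g x by simp
      moreover have "x = g ((inv\<^bsub>G\<^esub> g) x)" using inv_apply[OF g, of x] x KM by auto
      ultimately show ?thesis by blast
    qed
    then show ?thesis using gK[OF g] by blast
  qed
  define res :: "(complex \<Rightarrow> complex) \<Rightarrow> complex \<Rightarrow> complex" where "res = (\<lambda>g. restrict g K)"
  have res: "res g \<in> carrier (Gal K \<rat>)" if g: "g \<in> carrier G" for g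
    unfolding res_def
    by (rule Gal_restrict_mem[OF sK field_emb_mono[OF ap(2)[OF g] KM] gKK[OF g] QK ap(4)[OF g]])
  interpret GK: group "Gal K \<rat>" by (rule group_Gal[OF sK QK])
  have hom: "res (g \<otimes>\<^bsub>G\<^esub> h) = res g \<otimes>\<^bsub>Gal K \<rat>\<^esub> res h" if g: "g \<in> carrier G" and h: "h \<in> carrier G" for g h
  proof (rule Gal_eqI[OF sK])
    show "res (g \<otimes>\<^bsub>G\<^esub> h) \<in> carrier (Gal K \<rat>)" "res g \<otimes>\<^bsub>Gal K \<rat>\<^esub> res h \<in> carrier (Gal K \<rat>)"
      using res g h by auto
    fix x assume x: "x \<in> K"
    then have xM: "x \<in> M" using KM by blast
    show "res (g \<otimes>\<^bsub>G\<^esub> h) x = (res g \<otimes>\<^bsub>Gal K \<rat>\<^esub> res h) x"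
      using Gal_apply(5)[OF sK res[OF g] res[OF h] x] mult_apply[OF g h xM] x gK[OF h x] by (simp add: res_def)
  qed
  interpret rh: group_hom G "Gal K \<rat>" res
    by unfold_locales (use res hom in \<open>auto simp: hom_def\<close>)
  have fixK: "x \<in> \<rat>" if x: "x \<in> K" and "\<And>g. g \<in> carrier G \<Longrightarrow> res g x = x" for x
    using fixed_Gal_M[of x] that KM by (auto simp: res_def)
  have surj: "res ` carrier G = carrier (Gal K \<rat>)"
  proof (intro equalityI subsetI)
    fix \<tau> assume t: "\<tau> \<in> carrier (Gal K \<rat>)"
    have "\<exists>\<sigma>\<in>res ` carrier G. \<forall>x\<in>K. \<tau> x = \<sigma> x"
    proof (rule emb_fixing_fixed_field_in_group[OF sK QK])
      show "subgroup (res ` carrier G) (Gal K \<rat>)" by (rule rh.subgroup_img_is_subgroup[OF G.subgroup_self])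
      show "finite (res ` carrier G)" using fG by simp
      show "field_emb K \<tau>" using Gal_apply(2)[OF sK t] .
      fix x assume x: "x \<in> K" and "\<And>\<sigma>. \<sigma> \<in> res ` carrier G \<Longrightarrow> \<sigma> x = x"
      then have "x \<in> \<rat>" using fixK by blast
      then show "\<tau> x = x" using Gal_apply(4)[OF sK t] by blast
    qed
    then obtain g where g: "g \<in> carrier G" "\<forall>x\<in>K. \<tau> x = res g x" by blast
    then have "\<tau> = res g" using Gal_eqI[OF sK t res[OF g(1)]] by blast
    then show "\<tau> \<in> res ` carrier G" using g(1) by blast
  qed (use res in blast)
  have ker: "kernel G (Gal K \<rat>) res = N"
  proof (intro equalityI subsetI)
    fix g assume "g \<in> kernel G (Gal K \<rat>) res"
    then have g: "g \<in> carrier G" "res g = \<one>\<^bsub>Gal K \<rat>\<^esub>" by (auto simp: kernel_def)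
    have gx: "g x = x" if "x \<in> K" for x using fun_cong[OF g(2), of x] that by (simp add: res_def Gal_one)
    have "\<exists>\<sigma>\<in>N. \<forall>x\<in>M. g x = \<sigma> x"
      by (rule emb_fixing_fixed_field_in_group[OF sM QM sN fN ap(2)[OF g(1)]]) (use gx in \<open>auto simp: K_def\<close>)
    then obtain \<sigma> where s: "\<sigma> \<in> N" "\<forall>x\<in>M. g x = \<sigma> x" by blast
    then have "g = \<sigma>" using Gal_eqI[OF sM g(1) NG[OF s(1)]] by blast
    then show "g \<in> N" using s(1) by simp
  next
    fix \<sigma> assume s: "\<sigma> \<in> N"
    have "res \<sigma> = \<one>\<^bsub>Gal K \<rat>\<^esub>"
      by (rule Gal_eqI[OF sK res[OF NG[OF s]] GK.one_closed]) (use s in \<open>simp add: res_def Gal_one K_def\<close>)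
    then show "\<sigma> \<in> kernel G (Gal K \<rat>) res" using NG[OF s] by (simp add: kernel_def)
  qed
  show "G Mod N \<cong> Gal K \<rat>" using rh.FactGroup_iso[OF surj] unfolding ker .
  show "galois_ext \<rat> K"
    unfolding galois_ext_iff using subfield_Rats sK QK algK fixK res by blast
qed

end

context tower
begin

lemma restrict_L:
  shows "group_hom G (Gal L \<rat>) (\<lambda>g. restrict g L)"
    "(\<lambda>g. restrict g L) ` carrier G = carrier (Gal L \<rat>)"
    "kernel G (Gal L \<rat>) (\<lambda>g. restrict g L) = V"
proof -
  interpret GL: group "Gal L \<rat>" by (rule group_Gal[OF sL QL])
  have res: "restrict g L \<in> carrier (Gal L \<rat>)" if "g \<in> carrier G" for g using restrict_Gal[OF that QL] .
  have hom: "restrict (g \<otimes>\<^bsub>G\<^esub> h) L = restrict g L \<otimes>\<^bsub>Gal L \<rat>\<^esub> restrict h L"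
    if g: "g \<in> carrier G" and h: "h \<in> carrier G" for g h
  proof (rule Gal_eqI[OF sL res GL.m_closed[OF res[OF g] res[OF h]]])
    fix x assume x: "x \<in> L"
    then have xM: "x \<in> M" and hx: "h x \<in> L" using LM Gal_apply(1)[OF sL res[OF h] x] by auto
    show "restrict (g \<otimes>\<^bsub>G\<^esub> h) L x = (restrict g L \<otimes>\<^bsub>Gal L \<rat>\<^esub> restrict h L) x"
      using Gal_apply(5)[OF sL res[OF g] res[OF h] x] mult_apply[OF g h xM] x hx by simp
  qed (use g h in simp)
  show "group_hom G (Gal L \<rat>) (\<lambda>g. restrict g L)"
    by unfold_locales (use res hom in \<open>auto simp: hom_def\<close>)
  show "(\<lambda>g. restrict g L) ` carrier G = carrier (Gal L \<rat>)"
  proof (intro equalityI subsetI)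
    fix g assume "g \<in> carrier (Gal L \<rat>)"
    then obtain h where "h \<in> carrier G" "restrict h L = g" by (rule lift_Gal[OF _ QL])
    then show "g \<in> (\<lambda>g. restrict g L) ` carrier G" by blast
  qed (use res in blast)
  show "kernel G (Gal L \<rat>) (\<lambda>g. restrict g L) = V"
  proof (intro equalityI subsetI)
    fix g assume "g \<in> kernel G (Gal L \<rat>) (\<lambda>g. restrict g L)"
    then have g: "g \<in> carrier G" "restrict g L = \<one>\<^bsub>Gal L \<rat>\<^esub>" by (auto simp: kernel_def)
    have "g x = x" if "x \<in> L" for x using fun_cong[OF g(2), of x] that by (simp add: Gal_one)
    then show "g \<in> V" using g(1) by (simp add: V_iff)
  next
    fix v assume v: "v \<in> V"
    have "restrict v L = \<one>\<^bsub>Gal L \<rat>\<^esub>"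
      by (rule Gal_eqI[OF sL res[OF V_G[OF v]] GL.one_closed]) (use v in \<open>simp add: Gal_one V_iff\<close>)
    then show "v \<in> kernel G (Gal L \<rat>) (\<lambda>g. restrict g L)" using V_G[OF v] by (simp add: kernel_def)
  qed
qed

theorem exists_sym_group_4_subfield:
  assumes sym3: "Gal L \<rat> \<cong> sym_group 3" and fin: "finite V" and L: "number_field L"
    and H: "subgroup H G" "V \<subseteq> H" "H \<noteq> carrier G" "\<And>g. g \<in> carrier G \<Longrightarrow> g \<otimes>\<^bsub>G\<^esub> g \<in> H"
    and act: "h \<in> H" "v \<in> V" "conj h v \<noteq> v"
  obtains K where "number_field K" "K \<subseteq> M" "galois_ext \<rat> K" "Gal K \<rat> \<cong> sym_group 4"
proof -
  interpret r: group_hom G "Gal L \<rat>" "\<lambda>g. restrict g L" by (rule restrict_L(1))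
  obtain \<phi> where iso: "\<phi> \<in> iso (Gal L \<rat>) (sym_group 3)" using sym3 by (auto simp: is_iso_def)
  interpret f: group_hom "Gal L \<rat>" "sym_group 3" \<phi>
    using iso r.H.is_group sym_group_is_group[of 3] by (simp add: group_hom_def group_hom_axioms_def iso_def)
  have bij: "bij_betw \<phi> (carrier (Gal L \<rat>)) (carrier (sym_group 3))" using iso by (simp add: iso_def)
  define \<pi> where "\<pi> = \<phi> \<circ> (\<lambda>g. restrict g L)"
  have "group_hom G (sym_group 3) \<pi>"
    unfolding \<pi>_def group_hom_def group_hom_axioms_def
    using hom_compose[OF r.homh f.homh] G.is_group sym_group_is_group[of 3] by simp
  moreover have "\<pi> ` carrier G = carrier (sym_group 3)"
    unfolding \<pi>_def image_comp[symmetric] restrict_L(2) using bij by (simp add: bij_betw_def)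
  moreover have "kernel G (sym_group 3) \<pi> = V"
  proof -
    have "\<phi> x = \<one>\<^bsub>sym_group 3\<^esub> \<longleftrightarrow> x = \<one>\<^bsub>Gal L \<rat>\<^esub>" if "x \<in> carrier (Gal L \<rat>)" for x
      using bij that f.hom_one inj_onD[of \<phi> "carrier (Gal L \<rat>)" x "\<one>\<^bsub>Gal L \<rat>\<^esub>"] r.H.one_closed by (auto simp: bij_betw_def)
    then have "kernel G (sym_group 3) \<pi> = kernel G (Gal L \<rat>) (\<lambda>g. restrict g L)"
      using r.hom_closed by (auto simp: kernel_def \<pi>_def)
    then show ?thesis by (simp only: restrict_L(3))
  qed
  moreover have "G.conjugate h v \<noteq> v" using act(3) by (simp add: conj_def G.conjugate_def)
  ultimately obtain c s where "S3_extension G V c s"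
    using G.S3_extension_lifts[of \<pi> V H h v] V_square H act(1,2) by metis
  then interpret e: S3_extension G V c s .
  obtain N where N: "N \<lhd> G" "G Mod N \<cong> sym_group 4" using e.exists_sym_group_4_quotient[OF fin] by metis
  note K = fixed_field_of_normal[OF fin L N(1)]
  have "Gal {x \<in> M. \<forall>\<sigma>\<in>N. \<sigma> x = x} \<rat> \<cong> G Mod N"
    using group.iso_sym[OF normal.factorgroup_is_group[OF N(1)] K(4)] .
  then show ?thesis using that[OF K(1,2,3)] iso_trans N(2) by blast
qed

end

section \<open>Real embeddings, primes away from \<open>l\<close>, and the conclusion\<close>

lemma real_of_unramified_outside:
  assumes F: "number_field F" "E \<subseteq> F" and unr: "unramified_outside S E F" "Infinite_Place \<notin> S" and E: "E \<subseteq> \<real>"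
  shows "F \<subseteq> \<real>"
proof -
  have "unramified_at_infinity E F" using F unr by (simp add: unramified_outside_def)
  moreover have "id \<in> ring_hom (sub_CC F) CC" by (simp add: ring_hom_CC_iff field_emb_def)
  ultimately show ?thesis using E by (force simp: unramified_at_infinity_def)
qed

lemma coprime_not_in_finite_place:
  assumes F: "subfield F CC" and P: "P \<in> finite_places F" "of_nat p \<in> P" and "Rings.coprime p q"
  shows "of_nat q \<notin> P"
proof
  assume q: "of_nat q \<in> P"
  note cl = finite_placeD[OF F P(1)]
  have S: "subring (ints_of F) CC" using subring_ints_of[OF subfield_CC_subring[OF F]] .
  obtain u v where "u * int p + v * int q = gcd (int p) (int q)" using bezout_int by blast
  then have "u * int p + v * int q = 1" using \<open>Rings.coprime p q\<close> by simp
  then have "(1::complex) = of_int u * of_nat p + of_int v * of_nat q"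
    by (metis of_int_1 of_int_add of_int_mult of_int_of_nat_eq)
  moreover have "of_int u * of_nat p + of_int v * of_nat q \<in> P"
    using cl(3)[OF cl(4)[OF subring_CC_closed(9)[OF S] P(2)] cl(4)[OF subring_CC_closed(9)[OF S] q]] .
  ultimately show False using cl(5) by simp
qed

theorem theorem3p2:
  fixes l :: nat and L M :: "complex set"
  assumes "Factorial_Ring.prime l" and "[l = 1] (mod 4)"
    and "3 dvd class_number (sqrt_field l)"
    and "number_field L" and "sqrt_field l \<subseteq> L"
    and "ring.dimension CC 3 (sqrt_field l) L"
    and "unramified_outside {} (sqrt_field l) L"
    and "galois_ext \<rat> L" and "Gal L \<rat> \<cong> sym_group 3"
    and "is_max_elementary_ext 2 {Finite_Place l} L M"
    and "\<exists>Q. Jordan_Hoelder_factor (group_algebra (residue_ring 2) (Gal L (sqrt_field l)))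
               (galois_module (sqrt_field l) L M) Q \<and>
             irreducible_module (group_algebra (residue_ring 2) (Gal L (sqrt_field l))) Q \<and>
             has_dimension (residue_ring 2)
               (restrict_scalars (residue_ring 2) (Gal L (sqrt_field l)) Q) 2"
  shows "\<exists>K. number_field K \<and> totally_real K \<and> galois_ext \<rat> K \<and> Gal K \<rat> \<cong> sym_group 4 \<and>
             unramified_outside {Finite_Place l} \<rat> K"
proof -
  interpret q: quadratic_field l using assms(1,2) by unfold_locales
  define k where "k = sqrt_field l"
  note sk = q.sqrt_field_subfield[folded k_def] and kL = assms(5)[folded k_def] and nL = assms(4)
  have "finite (carrier (sym_group 3))"
    using finite_permutations[of "{1..3::nat}"] by (simp add: sym_group_def)
  then have finL: "finite (carrier (Gal L \<rat>))"
    using assms(9) bij_betw_finite by (fastforce simp: is_iso_def iso_def)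
  interpret tower_over "{Finite_Place l}" L M k
    by (intro tower_over.intro tower.intro tower_over_axioms.intro) (fact assms(8,10) finL sk kL)+
  obtain Q where JH: "Jordan_Hoelder_factor R A Q"
    and dim: "has_dimension (residue_ring 2) (restrict_scalars (residue_ring 2) (Gal L k) Q) 2"
    using assms(11) unfolding k_def by blast
  have finV: "finite V" using JH finite_V by (auto simp: Jordan_Hoelder_factor_def)
  obtain h v where hv: "h \<in> H" "v \<in> V" "conj h v \<noteq> v" by (rule nontrivial_action[OF JH dim])

  have sM': "q.s \<in> M" using q.s_in_sqrt_field kL LM by (auto simp: k_def)
  \<comment> \<open>\<open>H\<close> is the stabilizer of the square root of \<open>l\<close>, which
    automorphisms send to itself or its negative. Hence squares lie in \<open>H\<close>, and
    irrationality makes \<open>H\<close> proper.\<close>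
  have H_iff: "g \<in> H \<longleftrightarrow> g q.s = q.s" if g: "g \<in> carrier G" for g
  proof
    assume gs: "g q.s = q.s"
    have "g x = x" if "x \<in> k" for x
    proof -
      obtain a b where ab: "a \<in> \<rat>" "b \<in> \<rat>" "x = a + b * q.s"
        using \<open>x \<in> k\<close> unfolding k_def by (rule q.sqrt_field_elem)
      have abM: "a \<in> M" "b \<in> M" using ab QM by auto
      note e = field_embD[OF Gal_apply(2)[OF sM g]]
      have "g x = g a + g b * g q.s"
        using e(2)[OF abM(1) subring_CC_closed(5)[OF subfield_CC_subring[OF sM] abM(2) sM']] e(3)[OF abM(2) sM'] ab(3)
        by simp
      then show ?thesis using Gal_apply(4)[OF sM g] ab gs by simp
    qed
    then show "g \<in> H" using g by (simp add: carrier_Gal[OF sM])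
  next
    assume "g \<in> H"
    then show "g q.s = q.s" using Gal_apply(4)[OF sM, of g k] q.s_in_sqrt_field by (simp add: k_def)
  qed
  have "V \<subseteq> H" by (rule Gal_mono[OF sM kL])
  moreover have "H \<noteq> carrier G"
  proof
    assume "H = carrier G"
    then have "q.s \<in> \<rat>" using fixed_Gal_M[OF sM'] H_iff by blast
    then show False using q.s_irrational by blast
  qed
  moreover have "g \<otimes>\<^bsub>G\<^esub> g \<in> H" if g: "g \<in> carrier G" for g
  proof -
    note e = Gal_apply(2)[OF sM g]
    have "g q.s * g q.s = g (q.s * q.s)" using field_embD(3)[OF e sM' sM'] by simp
    also have "\<dots> = q.s * q.s" using field_emb_simps(6)[OF e subfield_CC_subring[OF sM]] by (simp add: q.s2)
    finally have "g q.s = q.s \<or> g q.s = - q.s" by (simp add: square_eq_iff)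
    then have "g (g q.s) = q.s" using field_emb_simps(3)[OF e subfield_CC_subring[OF sM] sM'] by auto
    then show ?thesis using H_iff[of "g \<otimes>\<^bsub>G\<^esub> g"] mult_apply[OF g g sM'] g by simp
  qed
  ultimately obtain K where K: "number_field K" "K \<subseteq> M" "galois_ext \<rat> K" "Gal K \<rat> \<cong> sym_group 4"
    using exists_sym_group_4_subfield[OF assms(9) finV nL subgroup_H _ _ _ hv] by metis

  have nM: "number_field M" by (rule number_field_M[OF finV nL])
  have nk: "number_field k" by (rule number_field_subfield[OF nL sk kL])
  have "L \<subseteq> \<real>"
    using real_of_unramified_outside[OF nL assms(5,7)] q.sqrt_field_real by blast
  then have real: "M \<subseteq> \<real>" using real_of_unramified_outside[OF nM LM unrM] by blast
  \<comment> \<open>An embedding of \<open>F\<close> extends to \<open>M\<close>, and by normality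
    its image lies in \<open>M\<close>, which is real.\<close>
  have emb_real: "\<tau> ` F \<subseteq> \<real>" if F: "number_field F" "F \<subseteq> M" and t: "\<tau> \<in> ring_hom (sub_CC F) CC" for F \<tau>
  proof -
    have sF: "subfield F CC" using F(1) by (simp add: number_field_def)
    have "alg_over F x" if "x \<in> M" for x
      using number_field_algebraic[OF nM that Rats_subset_subfield[OF sF] sF] .
    moreover have "field_emb F \<tau>" using t by (simp add: ring_hom_CC_iff)
    ultimately obtain h where "field_emb M h" "\<And>x. x \<in> F \<Longrightarrow> h x = \<tau> x"
      using extend_field_emb[OF sF sM F(2)] by metis
    then show ?thesis using emb_image_M[of h] F(2) real by (metis image_mono image_cong subset_trans)
  qed

  \<comment> \<open>The step to \<open>L\<close> uses that \<open>L\<close> is unramified over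
    \<open>k\<close> everywhere; the step to \<open>M\<close> uses that a place above
    \<open>p \<noteq> l\<close> does not contain \<open>l\<close>.\<close>
  have red: "reduced_mod p M" if p: "Factorial_Ring.prime p" "p \<noteq> l" for p
  proof -
    have "reduced_mod p L"
    proof (rule reduced_mod_unramified_ext[OF nk nL kL p(1)])
      show "reduced_mod p k" using q.reduced_mod_sqrt_field[OF p] by (simp add: k_def)
      fix P assume "P \<in> finite_places k"
      then show "unramified_at_finite k L P"
        using assms(7) nL kL by (simp add: unramified_outside_def k_def)
    qed
    then show ?thesis
    proof (rule reduced_mod_unramified_ext[OF nL nM LM p(1)])
      fix P assume P: "P \<in> finite_places L" "of_nat p \<in> P"
      have "of_nat l \<notin> P" using coprime_not_in_finite_place[OF sL P] primes_coprime[OF p(1) assms(1) p(2)] by blast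
      then show "unramified_at_finite L M P" using unrM nM LM P(1) by (simp add: unramified_outside_def)
    qed
  qed
  have "unramified_outside {Finite_Place l} \<rat> K"
    unfolding unramified_outside_def
  proof (intro allI impI conjI ballI)
    fix F assume F: "number_field F \<and> \<rat> \<subseteq> F \<and> F \<subseteq> K"
    then have FM: "number_field F" "F \<subseteq> M" using K(2) by auto
    show "unramified_at_infinity \<rat> F" using emb_real[OF FM] by (simp add: unramified_at_infinity_def)
    fix P assume P: "P \<in> finite_places \<rat>"
      and lP: "\<forall>p. Factorial_Ring.prime p \<and> Finite_Place p \<in> {Finite_Place l} \<longrightarrow> of_nat p \<notin> P"
    show "unramified_at_finite \<rat> F P"
      by (rule unramified_at_finite_of_reduced[OF nM FM P]) (use red lP assms(1) in blast)
  qed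
  moreover have "totally_real K" using emb_real[OF K(1,2)] by (simp add: totally_real_def)
  ultimately show ?thesis using K by blast
qed

end
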